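(* Let $\mathcal A$ be a nonfull free factor system of a group $\Gamma$. The inclusion map $\iota\colon\mathcal O(\Gamma;\mathcal A)\to\mathcal{FS}(\Gamma;\mathcal A)$ is coarsely Lipschitz with respect to the log-Lipschitz semimetric $d_{\mathcal O}$ on $\mathcal O(\Gamma;\mathcal A)$ and the simplicial metric $d_{\mathcal{FS}}$ on $\mathcal{FS}(\Gamma;\mathcal A)$. More specifically, let $\Delta=\Delta(\Gamma;\mathcal A)>0$ be an integer constant with the Two Over All property (defined in the context). Then for all $S,T\in\mathcal O(\Gamma;\mathcal A)$, $$d_{\mathcal{FS}}(S,T)\le\frac{\Delta}{\log 2}\,d_{\mathcal O}(S,T)+2\Delta+1 .$$
   Context: Standing assumptions and definitions. $\Gamma$ is a nontrivial group that is neither infinite cyclic nor infinite dihedral. A free factor system of $\Gamma$ is a finite set $\mathcal A=\{[A_1],\dots,[A_I]\}$ ($I\ge 0$) of conjugacy classes of nontrivial subgroups for which there is a free factorization $\Gamma=A_1*\cdots*A_I*B$ with $B$ free of finite rank (possibly trivial). It is full if it equals $\{[\Gamma]\}$ and nonfull otherwise. $\mathcal A\sqsubset\mathcal B$ means that each subgroup representing an element of $\mathcal A$ is contained in a subgroup representing an element of $\mathcal B$. A free splitting of $\Gamma$ is a nontrivial minimal simplicial action of $\Gamma$ on a tree $T$ with trivial edge stabilizers and finitely many orbits of vertices and edges. $\mathcal F_{ell}(T)$ denotes the set of conjugacy classes of nontrivial vertex stabilizers, a nonfull free factor system; $T$ is a free splitting rel $\mathcal A$ if $\mathcal A\sqsubset\mathcal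 F_{ell}(T)$, and a Grushko free splitting rel $\mathcal A$ if $\mathcal A=\mathcal F_{ell}(T)$. Natural vertices of $T$ are the vertices with nontrivial stabilizer or valence $\ge 3$; natural edges are the closures of the complementary components of the set of natural vertices. The given simplicial structure on $T$ is a $\Gamma$-invariant subdivision of the natural one. Two free splittings are equivalent if there is a $\Gamma$-equivariant homeomorphism between them. A collapse map $S\to T$ is an equivariant map that collapses to a point each component of some proper $\Gamma$-invariant subforest of $S$; existence of one is written $S\succ T$. $\mathcal{FS}(\Gamma;\mathcal A)$ is the simplicial complex with one vertex for each equivalence class of free splittings rel $\mathcal A$ and one $n$-simplex for each $(n+1)$-tuple of distinct classes with $S_0\succ\cdots\succ S_n$; $d_{\mathcal{FS}}$ is its simplicial metric. This complex is the first barycentric subdivision of a coarser simplicial structure having one $k$-simplex for each equivalence class of free splittings rel $\mathcal A$ with exactly $k+1$ natural edge orbits; points of $\mathcal{FS}(\Gamma;\mathcal A)$ thereby correspond to $\Gamma$-equivariant isometry classes of free splittings rel $\mathcal A$ equipped with a $\Gamma$-invariant geodesic metric normalized so that the sum of lengths of representatives of the natural edge orbits is 1 (edge lengths being barycentric coordinates). Outer space $\mathcal O(\Gamma;\mathcal A)$ is the set of $\Gamma$-equivariant homothety classes of Grushko free splittings rel $\mathcal A$ equipped with $\Gamma$-invariant geodesic metrics; representing each class by its normalized representative gives the inclusion $\iota$. For normalized $S,T$, $d_{\mathcal O}(S,T)=\log\min_f \mathrm{Lip}(f)$ where $f\colon S\to T$ varies over all $\Gamma$-equivariant Lipschitz maps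 and $\mathrm{Lip}(f)$ is the Lipschitz constant. (This $d_{\mathcal O}$ satisfies the triangle inequality but need not be symmetric.) Convention: for $S,T\in\mathcal O(\Gamma;\mathcal A)$, in the displayed inequality $d_{\mathcal{FS}}(S,T)$ denotes the distance between the vertices of $\mathcal{FS}(\Gamma;\mathcal A)$ represented by the underlying (nonmetric) free splittings; the map taking $S$ to this vertex is within distance 1 of $\iota$. Foldable maps: a path in a tree is a single vertex or a finite edge path without backtracking. A map of trees is tight if it takes vertices to vertices and restricts on each edge to a path. Directions at a vertex $v$ are the oriented edges with initial vertex $v$; for a tight map $f$ injective on edges, two directions at $v$ are in the same gate if their images have the same initial direction at $f(v)$. A $\Gamma$-equivariant map of free splittings is foldable if it is tight, injective on each edge, and has at least two gates at each vertex. Two Over All property of $\Delta$: for any free splittings $S,T$ rel $\mathcal A$, any foldable map $f\colon S\to T$ and any integer $n\ge 1$, if $d_{\mathcal{FS}}(S,T)\ge n\Delta$ then there are two natural edges $E_1,E_2\subset S$ in distinct $\Gamma$-orbits such that each path $f(E_i)$ contains $2^{n-1}$ nonoverlapping subpaths, each of which contains, for every natural edge $E'$ of $T$, some $\Gamma$-translate of $E'$. (The paper proves that such a constant exists depending only on $|\mathcal A|$, the number of elements of $\mathcal A$, and on the rank of the free factor $B$ above.) *)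

theory Defs
  imports
    "HOL-Analysis.Analysis"
    "HOL-Algebra.Group_Action"
    "HOL-Algebra.Elementary_Groups"
begin

section \<open>Free factor systems\<close>

text \<open>The isometry group of the integers.\<close>

definition infinite_dihedral_group :: "(int \<Rightarrow> int) monoid" where
  "infinite_dihedral_group =
     \<lparr>carrier = {f. \<exists>n. f = (\<lambda>x. x + n) \<or> f = (\<lambda>x. n - x)}, mult = (\<circ>), one = id\<rparr>"

text \<open>Internal free products: every element has exactly one normal form. A letter \<open>(i, x)\<close>
  stands for the nontrivial element \<open>x\<close> of the factor \<open>H i\<close>.\<close>

definition fp_reduced :: "('a, 'm) monoid_scheme \<Rightarrow> 'i set \<Rightarrow> ('i \<Rightarrow> 'a set) \<Rightarrow> ('i \<times> 'a) list \<Rightarrow> bool" where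
  "fp_reduced G I H w \<longleftrightarrow>
     (\<forall>(i, x)\<in>set w. i \<in> I \<and> x \<in> H i - {\<one>\<^bsub>G\<^esub>}) \<and> successively (\<lambda>p q. fst p \<noteq> fst q) w"

definition fp_eval :: "('a, 'm) monoid_scheme \<Rightarrow> ('i \<times> 'a) list \<Rightarrow> 'a" where
  "fp_eval G w = foldr (\<lambda>p y. snd p \<otimes>\<^bsub>G\<^esub> y) w \<one>\<^bsub>G\<^esub>"

definition internal_free_product :: "('a, 'm) monoid_scheme \<Rightarrow> 'i set \<Rightarrow> ('i \<Rightarrow> 'a set) \<Rightarrow> bool" where
  "internal_free_product G I H \<longleftrightarrow>
     (\<forall>i\<in>I. subgroup (H i) G) \<and>
     (\<forall>g\<in>carrier G. \<exists>!w. fp_reduced G I H w \<and> fp_eval G w = g)"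

text \<open>Free bases: the letter \<open>(True, x)\<close> stands for \<open>x\<close> and \<open>(False, x)\<close> for its inverse.\<close>

definition free_reduced :: "'a set \<Rightarrow> (bool \<times> 'a) list \<Rightarrow> bool" where
  "free_reduced X w \<longleftrightarrow>
     snd ` set w \<subseteq> X \<and> successively (\<lambda>p q. \<not> (snd p = snd q \<and> fst p \<noteq> fst q)) w"

definition free_eval :: "('a, 'm) monoid_scheme \<Rightarrow> (bool \<times> 'a) list \<Rightarrow> 'a" where
  "free_eval G w =
     foldr (\<lambda>p y. (if fst p then snd p else inv\<^bsub>G\<^esub> (snd p)) \<otimes>\<^bsub>G\<^esub> y) w \<one>\<^bsub>G\<^esub>"

definition free_basis :: "('a, 'm) monoid_scheme \<Rightarrow> 'a set \<Rightarrow> 'a set \<Rightarrow> bool" where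
  "free_basis G B X \<longleftrightarrow>
     X \<subseteq> B \<and> (\<forall>b\<in>B. \<exists>!w. free_reduced X w \<and> free_eval G w = b)"

definition free_of_finite_rank :: "('a, 'm) monoid_scheme \<Rightarrow> 'a set \<Rightarrow> bool" where
  "free_of_finite_rank G B \<longleftrightarrow> subgroup B G \<and> (\<exists>X. finite X \<and> free_basis G B X)"

definition conj_class :: "('a, 'm) monoid_scheme \<Rightarrow> 'a set \<Rightarrow> 'a set set" where
  "conj_class G H = {g <#\<^bsub>G\<^esub> H #>\<^bsub>G\<^esub> inv\<^bsub>G\<^esub> g | g. g \<in> carrier G}"

text \<open>The factors \<open>H 0, \<dots>, H (n - 1)\<close> represent the system; \<open>H n\<close> is the free cofactor.\<close>

definition free_factor_system :: "('a, 'm) monoid_scheme \<Rightarrow> 'a set set set \<Rightarrow> bool" where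
  "free_factor_system G \<A> \<longleftrightarrow>
     (\<exists>n H. internal_free_product G {..n::nat} H \<and>
            (\<forall>i<n. H i \<noteq> {\<one>\<^bsub>G\<^esub>}) \<and> free_of_finite_rank G (H n) \<and>
            \<A> = (\<lambda>i. conj_class G (H i)) ` {..<n})"

definition full_ffs :: "('a, 'm) monoid_scheme \<Rightarrow> 'a set set set \<Rightarrow> bool" where
  "full_ffs G \<A> \<longleftrightarrow> \<A> = {conj_class G (carrier G)}"

definition ffs_le :: "'a set set set \<Rightarrow> 'a set set set \<Rightarrow> bool" where
  "ffs_le \<A> \<B> \<longleftrightarrow> (\<forall>H\<in>\<Union>\<A>. \<exists>K\<in>\<Union>\<B>. H \<subseteq> K)"


section \<open>Trees with a group action\<close>

record ('a, 'v) gtree =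
  verts :: "'v set"
  edges :: "'v set set"
  act :: "'a \<Rightarrow> 'v \<Rightarrow> 'v"

text \<open>Paths are given by their lists of vertices; a one-element list is a trivial path.\<close>

definition edge_path :: "('a, 'v) gtree \<Rightarrow> 'v list \<Rightarrow> bool" where
  "edge_path T p \<longleftrightarrow> p \<noteq> [] \<and> set p \<subseteq> verts T \<and>
     successively (\<lambda>u v. {u, v} \<in> edges T) p \<and>
     (\<forall>i. i + 2 < length p \<longrightarrow> p ! i \<noteq> p ! (i + 2))"

definition path_between :: "('a, 'v) gtree \<Rightarrow> 'v \<Rightarrow> 'v \<Rightarrow> 'v list \<Rightarrow> bool" where
  "path_between T u v p \<longleftrightarrow> edge_path T p \<and> hd p = u \<and> last p = v"

definition path_edges :: "'v list \<Rightarrow> 'v set set" where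
  "path_edges p = {{p ! i, p ! Suc i} | i. Suc i < length p}"

definition is_tree :: "('a, 'v) gtree \<Rightarrow> bool" where
  "is_tree T \<longleftrightarrow> verts T \<noteq> {} \<and>
     (\<forall>e\<in>edges T. \<exists>u\<in>verts T. \<exists>v\<in>verts T. u \<noteq> v \<and> e = {u, v}) \<and>
     (\<forall>u\<in>verts T. \<forall>v\<in>verts T. \<exists>!p. path_between T u v p)"

definition tree_geodesic :: "('a, 'v) gtree \<Rightarrow> 'v \<Rightarrow> 'v \<Rightarrow> 'v list" where
  "tree_geodesic T u v = (THE p. path_between T u v p)"

definition simplicial_action :: "('a, 'm) monoid_scheme \<Rightarrow> ('a, 'v) gtree \<Rightarrow> bool" where
  "simplicial_action G T \<longleftrightarrow> is_tree T \<and> group_action G (verts T) (act T) \<and>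
     (\<forall>g\<in>carrier G. \<forall>e\<in>edges T. act T g ` e \<in> edges T)"

definition nontrivial_action :: "('a, 'm) monoid_scheme \<Rightarrow> ('a, 'v) gtree \<Rightarrow> bool" where
  "nontrivial_action G T \<longleftrightarrow> \<not> (\<exists>v\<in>verts T. \<forall>g\<in>carrier G. act T g v = v)"

text \<open>A subtree of a tree is determined by its vertex set.\<close>

definition subtree :: "('a, 'v) gtree \<Rightarrow> 'v set \<Rightarrow> bool" where
  "subtree T W \<longleftrightarrow> W \<noteq> {} \<and> W \<subseteq> verts T \<and>
     (\<forall>u\<in>W. \<forall>v\<in>W. set (tree_geodesic T u v) \<subseteq> W)"

definition minimal_action :: "('a, 'm) monoid_scheme \<Rightarrow> ('a, 'v) gtree \<Rightarrow> bool" where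
  "minimal_action G T \<longleftrightarrow>
     (\<forall>W. subtree T W \<and> (\<forall>g\<in>carrier G. act T g ` W \<subseteq> W) \<longrightarrow> W = verts T)"

text \<open>Edge stabilizers are setwise stabilizers, so their triviality excludes inversions.\<close>

definition free_splitting :: "('a, 'm) monoid_scheme \<Rightarrow> ('a, 'v) gtree \<Rightarrow> bool" where
  "free_splitting G T \<longleftrightarrow>
     simplicial_action G T \<and> nontrivial_action G T \<and> minimal_action G T \<and>
     (\<forall>e\<in>edges T. stabilizer G (\<lambda>g. (`) (act T g)) e = {\<one>\<^bsub>G\<^esub>}) \<and>
     finite (orbits G (verts T) (act T)) \<and>
     finite (orbits G (edges T) (\<lambda>g. (`) (act T g)))"

definition F_ell :: "('a, 'm) monoid_scheme \<Rightarrow> ('a, 'v) gtree \<Rightarrow> 'a set set set" where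
  "F_ell G T = {conj_class G (stabilizer G (act T) v) | v.
                  v \<in> verts T \<and> stabilizer G (act T) v \<noteq> {\<one>\<^bsub>G\<^esub>}}"

definition free_splitting_rel ::
  "('a, 'm) monoid_scheme \<Rightarrow> 'a set set set \<Rightarrow> ('a, 'v) gtree \<Rightarrow> bool" where
  "free_splitting_rel G \<A> T \<longleftrightarrow> free_splitting G T \<and> ffs_le \<A> (F_ell G T)"

definition grushko_splitting_rel ::
  "('a, 'm) monoid_scheme \<Rightarrow> 'a set set set \<Rightarrow> ('a, 'v) gtree \<Rightarrow> bool" where
  "grushko_splitting_rel G \<A> T \<longleftrightarrow> free_splitting G T \<and> \<A> = F_ell G T"


section \<open>Natural structure\<close>

text \<open>The valence may be infinite, in which case \<open>card\<close> is \<open>0\<close>.\<close>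

definition natural_vertex :: "('a, 'm) monoid_scheme \<Rightarrow> ('a, 'v) gtree \<Rightarrow> 'v \<Rightarrow> bool" where
  "natural_vertex G T v \<longleftrightarrow> v \<in> verts T \<and>
     (stabilizer G (act T) v \<noteq> {\<one>\<^bsub>G\<^esub>} \<or>
      infinite {e\<in>edges T. v \<in> e} \<or> 3 \<le> card {e\<in>edges T. v \<in> e})"

text \<open>Two edges belong to the closure of the same component of the complement of the natural
  vertices iff they are linked by a chain of edges in which consecutive ones share a vertex that
  is not natural. A natural edge is the set of simplicial edges that subdivide it.\<close>

definition natural_link :: "('a, 'm) monoid_scheme \<Rightarrow> ('a, 'v) gtree \<Rightarrow> ('v set \<times> 'v set) set" where
  "natural_link G T =
     {(e, e'). e \<in> edges T \<and> e' \<in> edges T \<and> (\<exists>v\<in>e \<inter> e'. \<not> natural_vertex G T v)}"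

definition natural_edges :: "('a, 'm) monoid_scheme \<Rightarrow> ('a, 'v) gtree \<Rightarrow> 'v set set set" where
  "natural_edges G T = {(natural_link G T)\<^sup>* `` {e} | e. e \<in> edges T}"

definition translate :: "('a, 'v) gtree \<Rightarrow> 'a \<Rightarrow> 'v set set \<Rightarrow> 'v set set" where
  "translate T g E = (`) (act T g) ` E"

definition natural_edge_orbits ::
  "('a, 'm) monoid_scheme \<Rightarrow> ('a, 'v) gtree \<Rightarrow> 'v set set set set" where
  "natural_edge_orbits G T = orbits G (natural_edges G T) (translate T)"


section \<open>Geometric realization, equivalence, collapse\<close>

text \<open>Points of a simplicial complex are given by barycentric coordinates.\<close>

definition cell :: "'v set \<Rightarrow> ('v \<Rightarrow> real) set" where
  "cell s = {x. (\<forall>v. 0 \<le> x v) \<and> (\<forall>v. v \<notin> s \<longrightarrow> x v = 0) \<and> (\<Sum>v\<in>s. x v) = 1}"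

definition vertex_point :: "'v \<Rightarrow> 'v \<Rightarrow> real" where
  "vertex_point v = (\<lambda>w. if w = v then 1 else 0)"

definition realization :: "('a, 'v) gtree \<Rightarrow> ('v \<Rightarrow> real) set" where
  "realization T = vertex_point ` verts T \<union> (\<Union>e\<in>edges T. cell e)"

text \<open>The weak topology; on a closed edge the topology of the type of functions is the
  usual topology of an interval.\<close>

definition weakly_open :: "('a, 'v) gtree \<Rightarrow> ('v \<Rightarrow> real) set \<Rightarrow> bool" where
  "weakly_open T U \<longleftrightarrow> U \<subseteq> realization T \<and>
     (\<forall>e\<in>edges T. openin (top_of_set (cell e)) (U \<inter> cell e))"

definition tree_topology :: "('a, 'v) gtree \<Rightarrow> ('v \<Rightarrow> real) topology" where
  "tree_topology T = topology (weakly_open T)"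

lemma istopology_weakly_open: "istopology (weakly_open T)"
  unfolding istopology_def
proof (intro conjI allI impI)
  fix U V assume UV: "weakly_open T U" "weakly_open T V"
  have "openin (top_of_set (cell e)) (U \<inter> V \<inter> cell e)" if "e \<in> edges T" for e
  proof -
    have "U \<inter> V \<inter> cell e = (U \<inter> cell e) \<inter> (V \<inter> cell e)" by blast
    moreover have "openin (top_of_set (cell e)) ((U \<inter> cell e) \<inter> (V \<inter> cell e))"
      by (rule openin_Int) (use UV that in \<open>auto simp: weakly_open_def\<close>)
    ultimately show ?thesis by simp
  qed
  moreover have "U \<inter> V \<subseteq> realization T"
    using UV(1) unfolding weakly_open_def by blast
  ultimately show "weakly_open T (U \<inter> V)"
    unfolding weakly_open_def by simp
next
  fix \<K> assume *: "\<forall>K\<in>\<K>. weakly_open T K"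
  have "openin (top_of_set (cell e)) (\<Union>\<K> \<inter> cell e)" if "e \<in> edges T" for e
  proof -
    have "\<Union>\<K> \<inter> cell e = (\<Union>K\<in>\<K>. K \<inter> cell e)" by blast
    moreover have "openin (top_of_set (cell e)) (\<Union>K\<in>\<K>. K \<inter> cell e)"
      by (rule openin_Union) (use * that in \<open>auto simp: weakly_open_def\<close>)
    ultimately show ?thesis by simp
  qed
  moreover have "\<Union>\<K> \<subseteq> realization T"
    using * unfolding weakly_open_def by blast
  ultimately show "weakly_open T (\<Union>\<K>)"
    unfolding weakly_open_def by simp
qed

lemma openin_tree_topology: "openin (tree_topology T) = weakly_open T"
  by (simp add: tree_topology_def istopology_weakly_open)

lemma topspace_tree_topology: "topspace (tree_topology T) = realization T"
proof -
  have "openin (top_of_set (cell e)) (realization T \<inter> cell e)" if "e \<in> edges T" for e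
  proof -
    have "realization T \<inter> cell e = cell e" using that unfolding realization_def by blast
    then show ?thesis by simp
  qed
  then have "weakly_open T (realization T)" unfolding weakly_open_def by blast
  then show ?thesis
    unfolding topspace_def openin_tree_topology by (auto simp: weakly_open_def)
qed

definition point_act ::
  "('a, 'm) monoid_scheme \<Rightarrow> ('a, 'v) gtree \<Rightarrow> 'a \<Rightarrow> ('v \<Rightarrow> real) \<Rightarrow> 'v \<Rightarrow> real" where
  "point_act G T g x = (\<lambda>v. if v \<in> verts T then x (act T (inv\<^bsub>G\<^esub> g) v) else 0)"

definition equivariant_map ::
  "('a, 'm) monoid_scheme \<Rightarrow> ('a, 'v) gtree \<Rightarrow> ('a, 'w) gtree \<Rightarrow>
   (('v \<Rightarrow> real) \<Rightarrow> 'w \<Rightarrow> real) \<Rightarrow> bool" where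
  "equivariant_map G S T f \<longleftrightarrow> f ` realization S \<subseteq> realization T \<and>
     (\<forall>g\<in>carrier G. \<forall>x\<in>realization S. f (point_act G S g x) = point_act G T g (f x))"

definition equivalent_splittings ::
  "('a, 'm) monoid_scheme \<Rightarrow> ('a, 'v) gtree \<Rightarrow> ('a, 'w) gtree \<Rightarrow> bool" where
  "equivalent_splittings G S T \<longleftrightarrow>
     (\<exists>h. homeomorphic_map (tree_topology S) (tree_topology T) h \<and> equivariant_map G S T h)"

text \<open>A subforest is given by its set \<open>F\<close> of edges. Two points lie in the same component of it
  iff they lie on edges linked by a chain of edges of \<open>F\<close> with consecutive ones adjacent.\<close>

definition same_component :: "'v set set \<Rightarrow> ('v \<Rightarrow> real) \<Rightarrow> ('v \<Rightarrow> real) \<Rightarrow> bool" where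
  "same_component F x y \<longleftrightarrow> (\<exists>e\<in>F. \<exists>e'\<in>F. x \<in> cell e \<and> y \<in> cell e' \<and>
     (e, e') \<in> {(d, d'). d \<in> F \<and> d' \<in> F \<and> d \<inter> d' \<noteq> {}}\<^sup>*)"

definition collapse_map_along ::
  "('a, 'm) monoid_scheme \<Rightarrow> ('a, 'v) gtree \<Rightarrow> ('a, 'w) gtree \<Rightarrow> 'v set set \<Rightarrow>
   (('v \<Rightarrow> real) \<Rightarrow> 'w \<Rightarrow> real) \<Rightarrow> bool" where
  "collapse_map_along G S T F f \<longleftrightarrow>
     F \<subset> edges S \<and> (\<forall>g\<in>carrier G. translate S g F \<subseteq> F) \<and>
     equivariant_map G S T f \<and> quotient_map (tree_topology S) (tree_topology T) f \<and>
     (\<forall>x\<in>realization S. \<forall>y\<in>realization S. f x = f y \<longleftrightarrow> x = y \<or> same_component F x y)"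

definition collapses_along ::
  "('a, 'm) monoid_scheme \<Rightarrow> ('a, 'v) gtree \<Rightarrow> 'v set set \<Rightarrow> ('a, 'w) gtree \<Rightarrow> bool" where
  "collapses_along G S F T \<longleftrightarrow> (\<exists>f. collapse_map_along G S T F f)"

definition collapses ::
  "('a, 'm) monoid_scheme \<Rightarrow> ('a, 'v) gtree \<Rightarrow> ('a, 'w) gtree \<Rightarrow> bool" where
  "collapses G S T \<longleftrightarrow> (\<exists>F. collapses_along G S F T)"


section \<open>The free splitting complex\<close>

text \<open>The vertex set of a free splitting is a disjoint union of finitely many coset spaces of
  subgroups, so every free splitting is equivariantly isomorphic to one whose vertices are
  pairs of a coset and an index.\<close>

type_synonym 'a splitting = "('a, 'a set \<times> nat) gtree"

definition fs_class ::
  "('a, 'm) monoid_scheme \<Rightarrow> 'a set set set \<Rightarrow> 'a splitting \<Rightarrow> 'a splitting set" where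
  "fs_class G \<A> S = {T. free_splitting_rel G \<A> T \<and> equivalent_splittings G S T}"

definition fs_vertices ::
  "('a, 'm) monoid_scheme \<Rightarrow> 'a set set set \<Rightarrow> 'a splitting set set" where
  "fs_vertices G \<A> = {fs_class G \<A> S | S. free_splitting_rel G \<A> S}"

definition class_collapses ::
  "('a, 'm) monoid_scheme \<Rightarrow> 'a splitting set \<Rightarrow> 'a splitting set \<Rightarrow> bool" where
  "class_collapses G c d \<longleftrightarrow> (\<exists>S\<in>c. \<exists>T\<in>d. collapses G S T)"

definition fs_simplices ::
  "('a, 'm) monoid_scheme \<Rightarrow> 'a set set set \<Rightarrow> 'a splitting set set set" where
  "fs_simplices G \<A> = {set cs | cs. cs \<noteq> [] \<and> set cs \<subseteq> fs_vertices G \<A> \<and> distinct cs \<and>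
     successively (class_collapses G) cs}"

text \<open>The simplicial metric on vertices (least number of edges of an edge path, infinite if there
  is none), and the same for the vertices represented by two free splittings.\<close>

definition fs_vertex_dist ::
  "('a, 'm) monoid_scheme \<Rightarrow> 'a set set set \<Rightarrow> 'a splitting set \<Rightarrow> 'a splitting set \<Rightarrow> enat" where
  "fs_vertex_dist G \<A> c d = Inf {enat n | n p. p 0 = c \<and> p n = d \<and>
     (\<forall>i\<le>n. p i \<in> fs_vertices G \<A>) \<and>
     (\<forall>i<n. p i \<noteq> p (Suc i) \<and> {p i, p (Suc i)} \<in> fs_simplices G \<A>)}"

definition d_FS ::
  "('a, 'm) monoid_scheme \<Rightarrow> 'a set set set \<Rightarrow> 'a splitting \<Rightarrow> 'a splitting \<Rightarrow> enat" where
  "d_FS G \<A> S T = fs_vertex_dist G \<A> (fs_class G \<A> S) (fs_class G \<A> T)"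

text \<open>The simplicial metric on all points of the complex: the length metric for which every
  simplex is a regular Euclidean simplex with edges of length \<open>1\<close>.\<close>

definition simplex_dist :: "'c set \<Rightarrow> ('c \<Rightarrow> real) \<Rightarrow> ('c \<Rightarrow> real) \<Rightarrow> real" where
  "simplex_dist s x y = sqrt ((\<Sum>c\<in>s. (x c - y c)\<^sup>2) / 2)"

definition fs_point_dist ::
  "('a, 'm) monoid_scheme \<Rightarrow> 'a set set set \<Rightarrow>
   ('a splitting set \<Rightarrow> real) \<Rightarrow> ('a splitting set \<Rightarrow> real) \<Rightarrow> ereal" where
  "fs_point_dist G \<A> x y =
     Inf {ereal (\<Sum>i<n. simplex_dist (s i) (p i) (p (Suc i))) | n p s.
       p 0 = x \<and> p n = y \<and>
       (\<forall>i<n. s i \<in> fs_simplices G \<A> \<and> p i \<in> cell (s i) \<and> p (Suc i) \<in> cell (s i))}"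


section \<open>Outer space\<close>

text \<open>An invariant geodesic metric on a tree is given by the lengths \<open>len e\<close> of the edges; the
  distance is the infimum of the lengths of chains of segments in closed edges.\<close>

definition invariant_lengths ::
  "('a, 'm) monoid_scheme \<Rightarrow> ('a, 'v) gtree \<Rightarrow> ('v set \<Rightarrow> real) \<Rightarrow> bool" where
  "invariant_lengths G T len \<longleftrightarrow>
     (\<forall>e\<in>edges T. 0 < len e \<and> (\<forall>g\<in>carrier G. len (act T g ` e) = len e))"

definition segment_length ::
  "('v set \<Rightarrow> real) \<Rightarrow> 'v set \<Rightarrow> ('v \<Rightarrow> real) \<Rightarrow> ('v \<Rightarrow> real) \<Rightarrow> real" where
  "segment_length len e x y = len e * ((\<Sum>v\<in>e. \<bar>x v - y v\<bar>) / 2)"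

definition tree_dist ::
  "('a, 'v) gtree \<Rightarrow> ('v set \<Rightarrow> real) \<Rightarrow> ('v \<Rightarrow> real) \<Rightarrow> ('v \<Rightarrow> real) \<Rightarrow> real" where
  "tree_dist T len x y =
     Inf {(\<Sum>i<n. segment_length len (e i) (p i) (p (Suc i))) | n p e.
       p 0 = x \<and> p n = y \<and>
       (\<forall>i<n::nat. e i \<in> edges T \<and> p i \<in> cell (e i) \<and> p (Suc i) \<in> cell (e i))}"

definition natural_length :: "('v set \<Rightarrow> real) \<Rightarrow> 'v set set \<Rightarrow> real" where
  "natural_length len E = (\<Sum>e\<in>E. len e)"

definition normalized :: "('a, 'm) monoid_scheme \<Rightarrow> ('a, 'v) gtree \<Rightarrow> ('v set \<Rightarrow> real) \<Rightarrow> bool" where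
  "normalized G T len \<longleftrightarrow>
     (\<Sum>\<O>\<in>natural_edge_orbits G T. natural_length len (SOME E. E \<in> \<O>)) = 1"

type_synonym 'a metric_splitting = "'a splitting \<times> (('a set \<times> nat) set \<Rightarrow> real)"

text \<open>Points of outer space are given by normalized representatives.\<close>

definition outer_space ::
  "('a, 'm) monoid_scheme \<Rightarrow> 'a set set set \<Rightarrow> 'a metric_splitting set" where
  "outer_space G \<A> = {(T, len). grushko_splitting_rel G \<A> T \<and> invariant_lengths G T len \<and>
     normalized G T len}"

definition lipschitz_bound ::
  "'a metric_splitting \<Rightarrow> 'a metric_splitting \<Rightarrow>
   (('a set \<times> nat \<Rightarrow> real) \<Rightarrow> 'a set \<times> nat \<Rightarrow> real) \<Rightarrow> real \<Rightarrow> bool" where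
  "lipschitz_bound X Y f L \<longleftrightarrow> 0 \<le> L \<and>
     (\<forall>x\<in>realization (fst X). \<forall>y\<in>realization (fst X).
        tree_dist (fst Y) (snd Y) (f x) (f y) \<le> L * tree_dist (fst X) (snd X) x y)"

definition Lip ::
  "'a metric_splitting \<Rightarrow> 'a metric_splitting \<Rightarrow>
   (('a set \<times> nat \<Rightarrow> real) \<Rightarrow> 'a set \<times> nat \<Rightarrow> real) \<Rightarrow> real" where
  "Lip X Y f = Inf {L. lipschitz_bound X Y f L}"

text \<open>The infimum over all maps is attained, so it is the minimum.\<close>

definition d_outer ::
  "('a, 'm) monoid_scheme \<Rightarrow> 'a metric_splitting \<Rightarrow> 'a metric_splitting \<Rightarrow> real" where
  "d_outer G X Y =
     ln (Inf {Lip X Y f | f. equivariant_map G (fst X) (fst Y) f \<and> (\<exists>L. lipschitz_bound X Y f L)})"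

text \<open>The inclusion of outer space. Let \<open>t\<^sub>1 < \<dots> < t\<^sub>m\<close> be the lengths of natural edges of \<open>S\<close>,
  \<open>t\<^sub>0 = 0\<close>, and \<open>N\<^sub>j\<close> the number of natural edge orbits of length at least \<open>t\<^sub>j\<close>. In the coarser
  simplicial structure the metric splitting has the lengths of the natural edge orbits as barycentric
  coordinates. Collapsing the natural edges shorter than \<open>t\<^sub>j\<close> gives the vertex of the barycentric
  subdivision that is the barycenter, with coordinates \<open>1 / N\<^sub>j\<close>, of the face spanned by the orbits
  of length at least \<open>t\<^sub>j\<close>. Hence the coordinate at that vertex is \<open>(t\<^sub>j - t\<^sub>j\<^sub>-\<^sub>1) N\<^sub>j\<close>.\<close>

definition natural_lengths ::
  "('a, 'm) monoid_scheme \<Rightarrow> 'a metric_splitting \<Rightarrow> real set" where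
  "natural_lengths G X = natural_length (snd X) ` natural_edges G (fst X)"

definition shorter_edges ::
  "('a, 'm) monoid_scheme \<Rightarrow> 'a metric_splitting \<Rightarrow> real \<Rightarrow> ('a set \<times> nat) set set" where
  "shorter_edges G X t = \<Union>{E\<in>natural_edges G (fst X). natural_length (snd X) E < t}"

definition outer_inclusion ::
  "('a, 'm) monoid_scheme \<Rightarrow> 'a set set set \<Rightarrow> 'a metric_splitting \<Rightarrow> 'a splitting set \<Rightarrow> real" where
  "outer_inclusion G \<A> X c =
     (\<Sum>t\<in>natural_lengths G X.
        if c \<in> fs_vertices G \<A> \<and> (\<exists>T\<in>c. collapses_along G (fst X) (shorter_edges G X t) T)
        then (t - Max (insert 0 {s\<in>natural_lengths G X. s < t})) *
             real (card {\<O>\<in>natural_edge_orbits G (fst X). \<forall>E\<in>\<O>. t \<le> natural_length (snd X) E})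
        else 0)"

definition coarsely_lipschitz_on ::
  "'x set \<Rightarrow> ('x \<Rightarrow> 'x \<Rightarrow> real) \<Rightarrow> ('y \<Rightarrow> 'y \<Rightarrow> ereal) \<Rightarrow> ('x \<Rightarrow> 'y) \<Rightarrow> bool" where
  "coarsely_lipschitz_on X dX dY f \<longleftrightarrow>
     (\<exists>K\<ge>0. \<exists>C\<ge>0. \<forall>x\<in>X. \<forall>y\<in>X. dY (f x) (f y) \<le> ereal (K * dX x y + C))"


section \<open>Foldable maps and the Two Over All property\<close>

text \<open>A tight equivariant map is given by its restriction \<open>f\<close> to the vertices: it takes an edge with
  ends \<open>u\<close>, \<open>v\<close> to the unique path from \<open>f u\<close> to \<open>f v\<close>, and is injective on the edge
  iff that path is nontrivial. A direction at \<open>v\<close> is given by the other end of the edge.\<close>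

definition directions :: "('a, 'v) gtree \<Rightarrow> 'v \<Rightarrow> 'v set" where
  "directions T v = {w\<in>verts T. {v, w} \<in> edges T}"

definition same_gate :: "('a, 'w) gtree \<Rightarrow> ('v \<Rightarrow> 'w) \<Rightarrow> 'v \<Rightarrow> 'v \<Rightarrow> 'v \<Rightarrow> bool" where
  "same_gate T f v w w' \<longleftrightarrow>
     tree_geodesic T (f v) (f w) ! 1 = tree_geodesic T (f v) (f w') ! 1"

definition foldable_map ::
  "('a, 'm) monoid_scheme \<Rightarrow> ('a, 'v) gtree \<Rightarrow> ('a, 'w) gtree \<Rightarrow> ('v \<Rightarrow> 'w) \<Rightarrow> bool" where
  "foldable_map G S T f \<longleftrightarrow>
     f ` verts S \<subseteq> verts T \<and>
     (\<forall>g\<in>carrier G. \<forall>v\<in>verts S. f (act S g v) = act T g (f v)) \<and>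
     (\<forall>u v. {u, v} \<in> edges S \<longrightarrow> f u \<noteq> f v) \<and>
     (\<forall>v\<in>verts S. \<exists>w\<in>directions S v. \<exists>w'\<in>directions S v. \<not> same_gate T f v w w')"

text \<open>The edges crossed by the image of a set of edges.\<close>

definition image_edges ::
  "('a, 'w) gtree \<Rightarrow> ('v \<Rightarrow> 'w) \<Rightarrow> 'v set set \<Rightarrow> 'w set set" where
  "image_edges T f E = \<Union>{path_edges (tree_geodesic T (f u) (f v)) | u v. {u, v} \<in> E}"

text \<open>Since \<open>f\<close> has two gates at each interior vertex of a natural edge \<open>E\<close>, the image of \<open>E\<close> is
  a path, and subpaths of it are given by their sets of edges; they do not overlap iff these
  sets are disjoint.\<close>

definition contains_full_subpaths ::
  "('a, 'm) monoid_scheme \<Rightarrow> ('a, 'w) gtree \<Rightarrow> 'w set set \<Rightarrow> nat \<Rightarrow> bool" where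
  "contains_full_subpaths G T P k \<longleftrightarrow>
     (\<exists>Q. (\<forall>j<k. (\<exists>p. edge_path T p \<and> Q j = path_edges p) \<and> Q j \<subseteq> P \<and>
                  (\<forall>E'\<in>natural_edges G T. \<exists>g\<in>carrier G. translate T g E' \<subseteq> Q j)) \<and>
          disjoint_family_on Q {..<k})"

definition two_over_all ::
  "('a, 'm) monoid_scheme \<Rightarrow> 'a set set set \<Rightarrow> nat \<Rightarrow> bool" where
  "two_over_all G \<A> \<Delta> \<longleftrightarrow>
     (\<forall>(S :: 'a splitting) (T :: 'a splitting) f n.
        free_splitting_rel G \<A> S \<and> free_splitting_rel G \<A> T \<and> foldable_map G S T f \<and>
        1 \<le> n \<and> enat (n * \<Delta>) \<le> d_FS G \<A> S T \<longrightarrow>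
        (\<exists>E1\<in>natural_edges G S. \<exists>E2\<in>natural_edges G S.
           orbit G (translate S) E1 \<noteq> orbit G (translate S) E2 \<and>
           contains_full_subpaths G T (image_edges T f E1) (2 ^ (n - 1)) \<and>
           contains_full_subpaths G T (image_edges T f E2) (2 ^ (n - 1))))"

end

theory Submission
  imports Defs
begin

text \<open>
  Let \<open>h : S \<rightarrow> T\<close> be an equivariant map with Lipschitz constant \<open>L\<close> between two points of outer
  space. The proof replaces \<open>h\<close> by a foldable map whose total length, the sum over the orbits of edges of
  \<open>S\<close> of the lengths of their images, is at most \<open>L\<close>, and then plays the Two Over All property against
  that bound.

  \<^bold>\<open>Rounding.\<close> Orient the edges of \<open>T\<close> equivariantly and, for a level \<open>\<theta>\<close> in \<open>[0, 1)\<close>, push every point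
  of an edge to one of its ends according to whether its coordinate exceeds \<open>\<theta>\<close>. For random \<open>\<theta>\<close> the
  expected distance of two rounded points is at most their distance (\<open>round_vdist_le\<close>). As \<open>S\<close> has
  volume \<open>1\<close> (\<open>volume\<close>), some level turns \<open>h\<close> into an equivariant map of vertices of total length at
  most \<open>L\<close> (\<open>rounded_map\<close>).

  \<^bold>\<open>Tightening.\<close> Among the vertex maps of total length at most \<open>L\<close> take one, \<open>k\<close>, that crosses the fewest
  edges (\<open>taut_exists\<close>). Collapse the edges of \<open>S\<close> on which \<open>k\<close> is constant. A vertex of the
  quotient \<open>S'\<close> with nontrivial stabilizer has two gates because the stabilizer moves every
  direction at the image point. A vertex with trivial stabilizer and only one gate could be pushed along
  that gate, shortening some images and lengthening none (\<open>push\<close>). So the map induced on \<open>S'\<close> is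
  foldable (\<open>foldable_collapse\<close>), while \<open>S\<close> and \<open>S'\<close> are at distance at most \<open>1\<close>.

  \<^bold>\<open>Counting.\<close> If the distance of \<open>S'\<close> and \<open>T\<close> is at least \<open>n \<Delta>\<close>, there are two inequivalent
  natural edges of \<open>S'\<close> each of whose images contains \<open>2\<^sup>n\<^sup>-\<^sup>1\<close> disjoint paths crossing every natural edge of
  \<open>T\<close> up to translation. Each of these paths has length at least the volume \<open>1\<close> of \<open>T\<close>, so the total
  length is at least \<open>2\<^sup>n\<close> (\<open>two_natural_edges_length\<close>) and \<open>2\<^sup>n \<le> L\<close>. Moreover \<open>1 \<le> L\<close>, since the images of the
  edges cover \<open>T\<close> by minimality (\<open>volume_le_image_length\<close>). Taking logarithms gives the inequality, and in
  particular finiteness of the distance. That \<open>d_outer\<close> is the logarithm of an infimum over a nonempty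
  set needs some Lipschitz map to exist; it is the linear extension of a vertex map
  (\<open>linear_map_lipschitz\<close>).

  For the inclusion itself, a point of outer space lies in a simplex one of whose vertices is the underlying
  free splitting (\<open>outer_inclusion_simplex\<close>), so distances of points exceed those of vertices by at
  most \<open>2\<close>.

  Trees are handled through the set \<open>sep T u v\<close> of edges separating two vertices. As
  \<open>sep T u w\<close> is the symmetric difference of \<open>sep T u v\<close> and \<open>sep T v w\<close> (\<open>sep_triangle\<close>), most arguments
  about geodesics become Boolean ones; dually,
  a connected graph is a tree as soon as every edge is a bridge (\<open>is_tree_if_bridges\<close>), a
  criterion that passes to collapses at once.
\<close>

section \<open>Trees and separating edges\<close>

definition sep :: "('a, 'v) gtree \<Rightarrow> 'v \<Rightarrow> 'v \<Rightarrow> 'v set set" where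
  "sep T u v = path_edges (tree_geodesic T u v)"

text \<open>The equivalence relation whose classes are the vertex sets of the components of the forest \<open>F\<close>.\<close>

definition joined :: "'v set set \<Rightarrow> ('v \<times> 'v) set" where
  "joined F = {(u, v). {u, v} \<in> F}\<^sup>*"

text \<open>A predicate that changes exactly across \<open>e\<close>, that is, one side of the bridge \<open>e\<close>.\<close>

definition splits_at :: "('a, 'v) gtree \<Rightarrow> 'v set \<Rightarrow> ('v \<Rightarrow> bool) \<Rightarrow> bool" where
  "splits_at T e \<psi> \<longleftrightarrow> (\<forall>a b. {a, b} \<in> edges T \<longrightarrow> (\<psi> a \<noteq> \<psi> b \<longleftrightarrow> {a, b} = e))"

lemma edge_path_iff_nth:
  "edge_path T p \<longleftrightarrow> p \<noteq> [] \<and> set p \<subseteq> verts T \<and>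
     (\<forall>i. Suc i < length p \<longrightarrow> {p ! i, p ! Suc i} \<in> edges T) \<and>
     (\<forall>i. i + 2 < length p \<longrightarrow> p ! i \<noteq> p ! (i + 2))"
  by (auto simp: edge_path_def successively_conv_nth)

lemma edge_path_Cons:
  "edge_path T (u # p) \<longleftrightarrow> u \<in> verts T \<and>
     (p = [] \<or> edge_path T p \<and> {u, hd p} \<in> edges T \<and> (tl p = [] \<or> u \<noteq> hd (tl p)))"
proof (cases p)
  case Nil
  then show ?thesis by (simp add: edge_path_def)
next
  case (Cons a r)
  have "(\<forall>i. i + 2 < length (u # p) \<longrightarrow> (u # p) ! i \<noteq> (u # p) ! (i + 2)) \<longleftrightarrow>
    (r = [] \<or> u \<noteq> hd r) \<and> (\<forall>i. i + 2 < length p \<longrightarrow> p ! i \<noteq> p ! (i + 2))" (is "?L \<longleftrightarrow> ?R")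
  proof
    assume L: ?L
    have "r = [] \<or> u \<noteq> hd r" using L[rule_format, of 0] Cons by (cases r) auto
    moreover have "p ! i \<noteq> p ! (i + 2)" if "i + 2 < length p" for i
      using L[rule_format, of "Suc i"] that by simp
    ultimately show ?R by blast
  next
    assume R: ?R
    show ?L
    proof (intro allI impI)
      fix i assume "i + 2 < length (u # p)"
      then show "(u # p) ! i \<noteq> (u # p) ! (i + 2)"
        using R Cons by (cases i) (auto simp: hd_conv_nth)
    qed
  qed
  then show ?thesis
    unfolding edge_path_def using Cons by (auto simp: successively_Cons)
qed

lemma edge_path_rev: "edge_path T (rev p) \<longleftrightarrow> edge_path T p"
proof -
  have *: "edge_path T (rev p)" if p: "edge_path T p" for p
  proof -
    have "rev p ! i \<noteq> rev p ! (i + 2)" if "i + 2 < length p" for i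
    proof -
      define j where "j = length p - Suc (i + 2)"
      have j: "j + 2 < length p" "length p - Suc i = j + 2" using that by (auto simp: j_def)
      then have "rev p ! (i + 2) = p ! j" "rev p ! i = p ! (j + 2)"
        using that by (auto simp: rev_nth j_def)
      with j have "j + 2 < length p" "rev p ! (i + 2) = p ! j" "rev p ! i = p ! (j + 2)" by auto
      then show ?thesis using p unfolding edge_path_def by metis
    qed
    then show ?thesis
      using p unfolding edge_path_def by (auto simp: insert_commute)
  qed
  from *[of p] *[of "rev p"] show ?thesis by auto
qed

lemma edge_path_append_right: "edge_path T (p @ q) \<Longrightarrow> q \<noteq> [] \<Longrightarrow> edge_path T q"
  by (induction p) (auto simp: edge_path_Cons)

lemma edge_path_append_left: "edge_path T (p @ q) \<Longrightarrow> p \<noteq> [] \<Longrightarrow> edge_path T p"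
  using edge_path_append_right[of T "rev q" "rev p"] by (metis edge_path_rev rev_append rev_is_Nil_conv)

lemma edge_path_snoc:
  assumes "edge_path T p" "w \<in> verts T" "{last p, w} \<in> edges T"
    "length p \<ge> 2 \<Longrightarrow> p ! (length p - 2) \<noteq> w"
  shows "edge_path T (p @ [w])"
  unfolding edge_path_iff_nth
proof (intro conjI allI impI)
  show "set (p @ [w]) \<subseteq> verts T" using assms by (auto simp: edge_path_def)
  fix i
  show "{(p @ [w]) ! i, (p @ [w]) ! Suc i} \<in> edges T" if "Suc i < length (p @ [w])"
  proof (cases "Suc i < length p")
    case True
    then show ?thesis using assms(1) by (auto simp: nth_append edge_path_iff_nth)
  next
    case False
    with that have "Suc i = length p" by simp
    then have "p ! i = last p" by (metis diff_Suc_1 last_conv_nth length_0_conv nat.distinct(1))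
    with \<open>Suc i = length p\<close> assms(3) show ?thesis by (simp add: nth_append)
  qed
  show "(p @ [w]) ! i \<noteq> (p @ [w]) ! (i + 2)" if "i + 2 < length (p @ [w])"
  proof (cases "i + 2 < length p")
    case True
    then show ?thesis using assms(1) by (auto simp: nth_append edge_path_iff_nth)
  next
    case False
    with that have "i + 2 = length p" by simp
    then have "i = length p - 2" "length p \<ge> 2" by auto
    then show ?thesis using assms(4) \<open>i + 2 = length p\<close> by (simp add: nth_append)
  qed
qed simp

lemma path_edges_Nil [simp]: "path_edges [u] = {}" "path_edges [] = {}"
  by (auto simp: path_edges_def)

lemma path_edges_Cons: "path_edges (u # v # p) = insert {u, v} (path_edges (v # p))"
proof -
  have "{i. Suc i < length (u # v # p)} = insert 0 (Suc ` {i. Suc i < length (v # p)})"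
    by (auto simp: image_iff) (metis Suc_pred neq0_conv not_less_eq)
  moreover have "path_edges q = (\<lambda>i. {q ! i, q ! Suc i}) ` {i. Suc i < length q}" for q :: "'a list"
    by (auto simp: path_edges_def)
  ultimately show ?thesis by (auto simp: image_image)
qed

lemma path_edges_append:
  "p \<noteq> [] \<Longrightarrow> q \<noteq> [] \<Longrightarrow> path_edges (p @ q) = insert {last p, hd q} (path_edges p \<union> path_edges q)"
proof (induction p rule: induct_list012)
  case (2 x)
  then show ?case by (cases q) (auto simp: path_edges_Cons)
qed (auto simp: path_edges_Cons)

lemma path_edges_rev: "path_edges (rev p) = path_edges p"
proof (induction p)
  case (Cons u p)
  show ?case
  proof (cases p)
    case (Cons a r)
    have "path_edges (rev p @ [u]) = insert {last (rev p), u} (path_edges (rev p))"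
      using Cons by (subst path_edges_append) auto
    also have "{last (rev p), u} = {u, a}" using Cons by (simp add: insert_commute)
    finally show ?thesis using Cons.IH Cons by (simp add: path_edges_Cons)
  qed simp
qed simp

lemma finite_path_edges: "finite (path_edges p)"
  by (induction p rule: induct_list012) (auto simp: path_edges_Cons)

lemma path_edges_map: "path_edges (map f p) = (`) f ` path_edges p"
  by (induction p rule: induct_list012) (auto simp: path_edges_Cons)

lemma path_edges_mem: "e \<in> path_edges p \<Longrightarrow> w \<in> e \<Longrightarrow> w \<in> set p"
  by (auto simp: path_edges_def)

lemma edge_path_edges: "edge_path T p \<Longrightarrow> path_edges p \<subseteq> edges T"
  by (auto simp: path_edges_def edge_path_iff_nth)

lemma splits_at_path:
  assumes "splits_at T e \<psi>" "edge_path T p" "e \<notin> path_edges p" "w \<in> set p"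
  shows "\<psi> w = \<psi> (hd p)"
  using assms(2-4)
proof (induction p arbitrary: w)
  case (Cons u p)
  show ?case
  proof (cases p)
    case (Cons a r)
    then have "{u, a} \<in> edges T" "{u, a} \<noteq> e" "edge_path T p" "e \<notin> path_edges p"
      using Cons.prems by (auto simp: edge_path_Cons path_edges_Cons)
    then have "\<psi> u = \<psi> a" "w \<in> set p \<Longrightarrow> \<psi> w = \<psi> (hd p)"
      using Cons.IH[of w] assms(1) unfolding splits_at_def by blast+
    moreover have "w = u \<or> w \<in> set p" using Cons.prems by simp
    ultimately show ?thesis using Cons by (metis list.sel(1))
  qed (use Cons.prems in auto)
qed simp

text \<open>A graph in which every edge is a bridge has no reduced closed path: the first edge has to be
  crossed a second time, which cuts off a shorter closed path.\<close>

lemma no_closed_path: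
  assumes bridges: "\<And>e. e \<in> edges T \<Longrightarrow> \<exists>\<psi>. splits_at T e \<psi>"
    and "edge_path T p" "hd p = last p"
  shows "length p = 1"
  using assms(2,3)
proof (induction "length p" arbitrary: p rule: less_induct)
  case less
  show ?case
  proof (rule ccontr)
    assume ne: "length p \<noteq> 1"
    from less.prems obtain u a r where p: "p = u # a # r"
      using ne by (metis One_nat_def edge_path_def length_Cons length_0_conv neq_Nil_conv)
    have ep: "edge_path T (a # r)" and e: "{u, a} \<in> edges T"
      using less.prems(1) p by (auto simp: edge_path_Cons)
    obtain \<psi> where \<psi>: "splits_at T {u, a} \<psi>" using bridges e by blast
    have "\<psi> u \<noteq> \<psi> a" using \<psi> e unfolding splits_at_def by blast
    moreover have "u \<in> set (a # r)" using less.prems(2) p by (auto split: if_splits)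
    ultimately have "{u, a} \<in> path_edges (a # r)" using splits_at_path[OF \<psi> ep] by fastforce
    then obtain i where i: "Suc i < length (a # r)" "{(a # r) ! i, (a # r) ! Suc i} = {u, a}"
      unfolding path_edges_def by auto
    have closed: False if "l < m" "m < length p" "p ! l = p ! m" "m - l + 1 < length p" for l m
    proof -
      define q where "q = take (m - l + 1) (drop l p)"
      have q: "length q = m - l + 1" using that by (simp add: q_def)
      have "edge_path T (drop l p)"
        using less.prems(1) that by (metis append_take_drop_id drop_eq_Nil edge_path_append_right leD order_less_trans)
      then have "edge_path T q"
        unfolding q_def using that by (metis append_take_drop_id edge_path_append_left q q_def list.size(3) add_is_0 zero_neq_one)
      moreover have "hd q = p ! l" "last q = p ! m"
        using that q by (auto simp: q_def hd_conv_nth last_conv_nth)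
      ultimately have "length q = 1" using less.hyps[of q] that q by simp
      then show False using q that by simp
    qed
    show False
    proof (cases "p ! Suc i = u")
      case True
      then show False using closed[of 0 "Suc i"] i p by simp
    next
      case False
      then have pi: "p ! Suc i = a" "p ! Suc (Suc i) = u" using i p by (auto simp: doubleton_eq_iff)
      show False
      proof (cases "i = 0")
        case True
        then show False using less.prems(1) i p pi unfolding edge_path_def
          by (metis add_0 add_2_eq_Suc' length_Cons nth_Cons_0 not_less_eq)
      next
        case False
        then show False using closed[of 1 "Suc i"] i p pi by simp
      qed
    qed
  qed
qed

text \<open>By the previous lemma a reduced path does not return to its first vertex, so it crosses its first edge
  once. Hence the side of that edge on which the path ends determines the first step.\<close>

lemma is_tree_if_bridges:
  assumes "verts T \<noteq> {}"
    and wf: "\<And>e. e \<in> edges T \<Longrightarrow> \<exists>u\<in>verts T. \<exists>v\<in>verts T. u \<noteq> v \<and> e = {u, v}"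
    and conn: "\<And>u v. u \<in> verts T \<Longrightarrow> v \<in> verts T \<Longrightarrow> (u, v) \<in> joined (edges T)"
    and bridges: "\<And>e. e \<in> edges T \<Longrightarrow> \<exists>\<psi>. splits_at T e \<psi>"
  shows "is_tree T"
proof -
  have ex: "\<exists>p. path_between T u v p" if "u \<in> verts T" "(u, v) \<in> joined (edges T)" for u v
    using that(2) unfolding joined_def
  proof (induction rule: rtrancl_induct)
    case base
    have "path_between T u u [u]" using that by (simp add: path_between_def edge_path_def)
    then show ?case by blast
  next
    case (step v w)
    then obtain p where p: "edge_path T p" "hd p = u" "last p = v" by (auto simp: path_between_def)
    have ew: "{v, w} \<in> edges T" using step by simp
    obtain a b where "a \<in> verts T" "b \<in> verts T" "{v, w} = {a, b}" using wf[OF ew] by blast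
    then have "w \<in> verts T" by (auto simp: doubleton_eq_iff)
    note ew = ew this
    have pn: "p \<noteq> []" using p by (simp add: edge_path_def)
    show ?case
    proof (cases "length p \<ge> 2 \<and> p ! (length p - 2) = w")
      case True
      then have "butlast p \<noteq> []" by (cases p rule: rev_cases) auto
      moreover have "p = butlast p @ [v]" using pn p by (metis append_butlast_last_id)
      moreover have "last (butlast p) = w"
        using True \<open>butlast p \<noteq> []\<close> by (cases p rule: rev_cases) (auto simp: last_conv_nth nth_append numeral_2_eq_2)
      moreover have "hd (butlast p) = u" using \<open>butlast p \<noteq> []\<close> \<open>p = _\<close> p(2) by (metis hd_append2)
      ultimately have "path_between T u w (butlast p)"
        using p unfolding path_between_def by (metis edge_path_append_left)
      then show ?thesis by blast
    next
      case False
      then have "edge_path T (p @ [w])" by (intro edge_path_snoc) (use p ew in simp_all)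
      then have "path_between T u w (p @ [w])" using p pn by (simp add: path_between_def)
      then show ?thesis by blast
    qed
  qed
  have uniq: "p = p'" if "edge_path T p" "edge_path T p'" "hd p = hd p'" "last p = last p'" for p p'
    using that
  proof (induction p arbitrary: p')
    case Nil
    then show ?case by (simp add: edge_path_def)
  next
    case (Cons u p)
    have p'u: "p' = u # tl p'" using Cons.prems by (cases p') (auto simp: edge_path_def)
    show ?case
    proof (cases "p = [] \<or> tl p' = []")
      case True
      then have "hd (u # p) = last (u # p) \<or> hd p' = last p'" using p'u by (metis last_ConsL list.sel(1))
      then have "hd (u # p) = last (u # p)" "hd p' = last p'" using Cons.prems by auto
      then have "length (u # p) = 1" "length p' = 1" using no_closed_path bridges Cons.prems by metis+
      then show ?thesis using p'u by (metis One_nat_def length_0_conv length_Cons nat.inject)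
    next
      case False
      then obtain a r a' r' where p: "p = a # r" and p': "p' = u # a' # r'"
        using p'u by (metis neq_Nil_conv)
      have e: "{u, a} \<in> edges T" "{u, a'} \<in> edges T" and ep: "edge_path T (a # r)" "edge_path T (a' # r')"
        using Cons.prems p p' by (auto simp: edge_path_Cons)
      have nou: "u \<notin> set (tl s)" if s: "edge_path T s" "hd s = u" for s
      proof
        assume "u \<in> set (tl s)"
        then obtain xs ys where "tl s = xs @ u # ys" by (meson split_list)
        then have "s = (u # xs @ [u]) @ ys" using s by (cases s) (auto simp: edge_path_def)
        then have "edge_path T (u # xs @ [u])" using s edge_path_append_left by blast
        then have "length (u # xs @ [u]) = 1" using no_closed_path[OF bridges] by fastforce
        then show False by simp
      qed
      obtain \<psi> where \<psi>: "splits_at T {u, a} \<psi>" using bridges e by blast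
      have "\<psi> u \<noteq> \<psi> a" using \<psi> e unfolding splits_at_def by blast
      moreover have "{u, a} \<notin> path_edges (a # r)"
        using nou[of "u # p"] Cons.prems p path_edges_mem by fastforce
      then have "\<psi> (last p) = \<psi> a" using splits_at_path[OF \<psi> ep(1), of "last p"] p by simp
      ultimately have "\<psi> (hd p') \<noteq> \<psi> (last p')" using Cons.prems p p' by simp
      then have "{u, a} \<in> path_edges p'" using splits_at_path[OF \<psi> Cons.prems(2)]
        by (metis Cons.prems(2) edge_path_def last_in_set)
      moreover have "{u, a} \<notin> path_edges (a' # r')"
        using nou[of p'] Cons.prems p' path_edges_mem by fastforce
      ultimately have "a = a'" using p' by (auto simp: path_edges_Cons doubleton_eq_iff)
      then have "p = a' # r'" using Cons.IH[of "a' # r'"] ep p p' Cons.prems by auto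
      then show ?thesis using p' by simp
    qed
  qed
  have "\<exists>!p. path_between T u v p" if "u \<in> verts T" "v \<in> verts T" for u v
  proof -
    from ex[OF that(1) conn[OF that]] obtain p where "path_between T u v p" by blast
    moreover have "q = p" if "path_between T u v q" for q
      using uniq that \<open>path_between T u v p\<close> unfolding path_between_def by metis
    ultimately show ?thesis by blast
  qed
  then show ?thesis using assms(1) wf unfolding is_tree_def by simp
qed

locale tree =
  fixes T :: "('a, 'v) gtree"
  assumes is_tree: "is_tree T"
begin

lemma edge_verts: "{u, v} \<in> edges T \<Longrightarrow> u \<in> verts T \<and> v \<in> verts T \<and> u \<noteq> v"
proof -
  assume "{u, v} \<in> edges T"
  then obtain a b where "a \<in> verts T" "b \<in> verts T" "a \<noteq> b" "{u, v} = {a, b}"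
    using is_tree unfolding is_tree_def by meson
  then show ?thesis by (auto simp: doubleton_eq_iff)
qed

lemma edgeE:
  assumes "e \<in> edges T"
  obtains u v where "u \<in> verts T" "v \<in> verts T" "u \<noteq> v" "e = {u, v}"
proof -
  have "\<exists>u\<in>verts T. \<exists>v\<in>verts T. u \<noteq> v \<and> e = {u, v}" using assms is_tree unfolding is_tree_def by simp
  then show thesis using that by auto
qed

lemma geodesic: "u \<in> verts T \<Longrightarrow> v \<in> verts T \<Longrightarrow> path_between T u v (tree_geodesic T u v)"
  unfolding tree_geodesic_def by (rule theI') (use is_tree in \<open>simp add: is_tree_def\<close>)

lemma geodesic_eq: "path_between T u v p \<Longrightarrow> tree_geodesic T u v = p"
proof -
  assume p: "path_between T u v p"
  then have "u \<in> verts T" "v \<in> verts T"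
    unfolding path_between_def edge_path_def by (auto dest: hd_in_set last_in_set)
  then have "\<exists>!p. path_between T u v p" using is_tree unfolding is_tree_def by simp
  then show ?thesis unfolding tree_geodesic_def using p by (rule the1_equality)
qed

lemma geodesic_props:
  assumes "u \<in> verts T" "v \<in> verts T"
  shows "edge_path T (tree_geodesic T u v)" "hd (tree_geodesic T u v) = u"
    "last (tree_geodesic T u v) = v" "tree_geodesic T u v \<noteq> []"
    "set (tree_geodesic T u v) \<subseteq> verts T"
  using geodesic[OF assms] by (auto simp: path_between_def edge_path_def)

lemma geodesic_self [simp]: "u \<in> verts T \<Longrightarrow> tree_geodesic T u u = [u]"
  by (rule geodesic_eq) (simp add: path_between_def edge_path_def)

lemma edge_path_distinct: "edge_path T p \<Longrightarrow> distinct p"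
proof (induction p)
  case (Cons u p)
  have "u \<notin> set p"
  proof
    assume "u \<in> set p"
    then obtain xs ys where "p = xs @ u # ys" by (meson split_list)
    then have "u # p = (u # xs @ [u]) @ ys" by simp
    then have "edge_path T (u # xs @ [u])"
      using Cons.prems edge_path_append_left[of T "u # xs @ [u]" ys] by simp
    then have "path_between T u u (u # xs @ [u])" by (simp add: path_between_def)
    moreover have "u \<in> verts T" using Cons.prems by (simp add: edge_path_def)
    ultimately have "[u] = u # xs @ [u]" using geodesic_eq geodesic_self by metis
    then show False by simp
  qed
  then show ?case using Cons by (auto simp: edge_path_Cons)
qed simp

lemma geodesic_step:
  assumes "u \<in> verts T" "{v, w} \<in> edges T"
  shows "tree_geodesic T u w = tree_geodesic T u v @ [w] \<and> w \<notin> set (tree_geodesic T u v) \<or>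
         tree_geodesic T u v = tree_geodesic T u w @ [v] \<and> v \<notin> set (tree_geodesic T u w)"
proof -
  have vw: "v \<in> verts T" "w \<in> verts T" using edge_verts assms by auto
  define p where "p = tree_geodesic T u v"
  have p: "edge_path T p" "hd p = u" "last p = v" "p \<noteq> []"
    using geodesic_props[OF assms(1) vw(1)] by (auto simp: p_def)
  show ?thesis
  proof (cases "length p \<ge> 2 \<and> p ! (length p - 2) = w")
    case True
    define q where "q = butlast p"
    have pq: "p = q @ [v]" using p by (metis append_butlast_last_id q_def)
    have "length q \<ge> 1" using True pq by simp
    then have "q \<noteq> []" by auto
    have "last q = w"
      using True \<open>q \<noteq> []\<close> pq by (auto simp: last_conv_nth nth_append numeral_2_eq_2)
    moreover have "hd q = u" using \<open>q \<noteq> []\<close> pq p(2) by (metis hd_append2)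
    moreover have "edge_path T q" using pq p \<open>q \<noteq> []\<close> edge_path_append_left by metis
    ultimately have "tree_geodesic T u w = q" by (intro geodesic_eq) (simp add: path_between_def)
    moreover have "v \<notin> set q" using edge_path_distinct[OF p(1)] pq by simp
    ultimately show ?thesis using pq p_def by simp
  next
    case False
    then have "edge_path T (p @ [w])" by (intro edge_path_snoc) (use p vw assms in simp_all)
    moreover from this have "tree_geodesic T u w = p @ [w]"
      using p by (intro geodesic_eq) (simp add: path_between_def)
    moreover have "w \<notin> set p" using edge_path_distinct[OF \<open>edge_path T (p @ [w])\<close>] by simp
    ultimately show ?thesis using p_def by simp
  qed
qed

lemma walk_induct [consumes 2, case_names start step]:
  assumes "u \<in> verts T" "v \<in> verts T" "P u"
    and step: "\<And>v w. v \<in> verts T \<Longrightarrow> w \<in> verts T \<Longrightarrow> {v, w} \<in> edges T \<Longrightarrow> P v \<Longrightarrow> P w"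
  shows "P v"
proof -
  have "P (last p)" if "edge_path T p" "P (hd p)" for p
    using that
  proof (induction p)
    case (Cons a p)
    show ?case
    proof (cases p)
      case (Cons b r)
      then have "P b" using Cons.prems step[of a b] edge_verts by (auto simp: edge_path_Cons)
      then show ?thesis using Cons.IH Cons.prems Cons by (auto simp: edge_path_Cons)
    qed (use Cons.prems in auto)
  qed (simp add: edge_path_def)
  then show ?thesis using geodesic_props[OF assms(1,2)] assms(3) by metis
qed

lemma sep_self [simp]: "u \<in> verts T \<Longrightarrow> sep T u u = {}"
  by (simp add: sep_def)

lemma finite_sep: "finite (sep T u v)"
  by (simp add: sep_def finite_path_edges)

lemma sep_edges: "u \<in> verts T \<Longrightarrow> v \<in> verts T \<Longrightarrow> sep T u v \<subseteq> edges T"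
  unfolding sep_def using edge_path_edges geodesic_props by metis

lemma sep_step:
  assumes "u \<in> verts T" "{v, w} \<in> edges T"
  shows "sep T u w = sym_diff (sep T u v) {{v, w}}"
proof -
  have vw: "v \<in> verts T" "w \<in> verts T" using edge_verts assms by auto
  note gv = geodesic_props[OF assms(1) vw(1)] and gw = geodesic_props[OF assms(1) vw(2)]
  from geodesic_step[OF assms] show ?thesis
  proof
    assume A: "tree_geodesic T u w = tree_geodesic T u v @ [w] \<and> w \<notin> set (tree_geodesic T u v)"
    then have "sep T u w = insert {v, w} (sep T u v)"
      unfolding sep_def using gv by (simp add: path_edges_append)
    moreover have "{v, w} \<notin> sep T u v" using A path_edges_mem unfolding sep_def by fastforce
    ultimately show ?thesis by blast
  next
    assume A: "tree_geodesic T u v = tree_geodesic T u w @ [v] \<and> v \<notin> set (tree_geodesic T u w)"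
    then have "sep T u v = insert {v, w} (sep T u w)"
      unfolding sep_def using gw by (simp add: path_edges_append insert_commute)
    moreover have "{v, w} \<notin> sep T u w" using A path_edges_mem unfolding sep_def by fastforce
    ultimately show ?thesis by blast
  qed
qed

lemma sep_triangle:
  assumes "u \<in> verts T" "v \<in> verts T" "w \<in> verts T"
  shows "sep T u w = sym_diff (sep T u v) (sep T v w)"
  using assms(2,3)
proof (induction rule: walk_induct)
  case (step x w)
  then have "sep T u w = sym_diff (sep T u x) {{x, w}}" "sep T v w = sym_diff (sep T v x) {{x, w}}"
    using sep_step assms by auto
  then show ?case using step by blast
qed (use assms in auto)

lemma sep_commute: "u \<in> verts T \<Longrightarrow> v \<in> verts T \<Longrightarrow> sep T u v = sep T v u"
  using sep_triangle[of u v u] sep_self[of u] by blast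

lemma sep_edge: "{u, v} \<in> edges T \<Longrightarrow> sep T u v = {{u, v}}"
  using sep_step[of u u v] edge_verts by auto

lemma sep_iff_splits:
  assumes "splits_at T e \<psi>" "e \<in> edges T" "u \<in> verts T" "v \<in> verts T"
  shows "e \<in> sep T u v \<longleftrightarrow> \<psi> u \<noteq> \<psi> v"
  using assms(3,4)
proof (induction rule: walk_induct)
  case (step v w)
  have "\<psi> v \<noteq> \<psi> w \<longleftrightarrow> {v, w} = e" using assms(1) step unfolding splits_at_def by blast
  then show ?case using step sep_step[of u v w] assms(3) by auto
qed (use assms in auto)

lemma splits_at_sep: "u \<in> verts T \<Longrightarrow> e \<in> edges T \<Longrightarrow> splits_at T e (\<lambda>v. e \<in> sep T u v)"
  unfolding splits_at_def using sep_step by blast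

lemma joined_edges: "u \<in> verts T \<Longrightarrow> v \<in> verts T \<Longrightarrow> (u, v) \<in> joined (edges T)"
proof (induction rule: walk_induct)
  case (step v w)
  then show ?case unfolding joined_def by (auto intro: rtrancl_into_rtrancl)
qed (simp add: joined_def)

lemma joined_iff_sep:
  assumes "F \<subseteq> edges T" "u \<in> verts T" "v \<in> verts T"
  shows "(u, v) \<in> joined F \<longleftrightarrow> sep T u v \<subseteq> F"
proof
  assume "(u, v) \<in> joined F"
  then show "sep T u v \<subseteq> F"
    unfolding joined_def
  proof (induction rule: rtrancl_induct)
    case (step v w)
    have vw: "{v, w} \<in> F" using step.hyps(2) by simp
    then have "sep T u w = sym_diff (sep T u v) {{v, w}}" using assms(1,2) by (intro sep_step) blast+
    then show ?case using vw step.IH by blast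
  qed (use assms in auto)
next
  have *: "(hd p, last p) \<in> joined F" if "edge_path T p" "path_edges p \<subseteq> F" for p
    using that
  proof (induction p)
    case (Cons a p)
    show ?case
    proof (cases p)
      case (Cons b r)
      then have "(a, b) \<in> {(u, v). {u, v} \<in> F}" "(b, last p) \<in> joined F"
        using Cons.IH Cons.prems by (auto simp: edge_path_Cons path_edges_Cons)
      then show ?thesis using Cons unfolding joined_def by (auto intro: converse_rtrancl_into_rtrancl)
    qed (simp add: joined_def)
  qed (simp add: edge_path_def)
  assume "sep T u v \<subseteq> F"
  then show "(u, v) \<in> joined F" using *[of "tree_geodesic T u v"] geodesic_props[OF assms(2,3)]
    unfolding sep_def by simp
qed

end

lemma joined_refl [simp]: "(u, u) \<in> joined F" by (simp add: joined_def)

lemma joined_sym: "(u, v) \<in> joined F \<Longrightarrow> (v, u) \<in> joined F"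
proof -
  have "sym {(u, v). {u, v} \<in> F}" by (auto simp: sym_def insert_commute)
  then show "(u, v) \<in> joined F \<Longrightarrow> (v, u) \<in> joined F"
    unfolding joined_def using sym_rtrancl symD by metis
qed

lemma joined_trans: "(u, v) \<in> joined F \<Longrightarrow> (v, w) \<in> joined F \<Longrightarrow> (u, w) \<in> joined F"
  unfolding joined_def by (rule rtrancl_trans)

lemma joined_edge: "{u, v} \<in> F \<Longrightarrow> (u, v) \<in> joined F"
  by (auto simp: joined_def)

lemma joined_mono: "F \<subseteq> F' \<Longrightarrow> joined F \<subseteq> joined F'"
  unfolding joined_def by (rule rtrancl_mono) auto

lemma (in tree) sep_xor:
  assumes "u \<in> verts T" "v \<in> verts T" "w \<in> verts T"
  shows "e \<in> sep T u w \<longleftrightarrow> (e \<in> sep T u v) \<noteq> (e \<in> sep T v w)"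
  using sep_triangle[OF assms] by auto

section \<open>Sets with a group action\<close>

text \<open>The values outside \<open>X\<close> are arbitrary, so that the actions induced on edges and on natural edges, which are
  given by taking images, are instances.\<close>

definition gset :: "('a, 'm) monoid_scheme \<Rightarrow> 'x set \<Rightarrow> ('a \<Rightarrow> 'x \<Rightarrow> 'x) \<Rightarrow> bool" where
  "gset G X a \<longleftrightarrow> (\<forall>g\<in>carrier G. \<forall>x\<in>X. a g x \<in> X) \<and> (\<forall>x\<in>X. a \<one>\<^bsub>G\<^esub> x = x) \<and>
     (\<forall>g\<in>carrier G. \<forall>h\<in>carrier G. \<forall>x\<in>X. a (g \<otimes>\<^bsub>G\<^esub> h) x = a g (a h x))"

definition transversal :: "('a, 'm) monoid_scheme \<Rightarrow> 'x set \<Rightarrow> ('a \<Rightarrow> 'x \<Rightarrow> 'x) \<Rightarrow> 'x set \<Rightarrow> bool" where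
  "transversal G X a R \<longleftrightarrow> finite R \<and> R \<subseteq> X \<and> (\<forall>x\<in>X. \<exists>!r. r \<in> R \<and> r \<in> orbit G a x)"

context group
begin

context
  fixes X :: "'x set" and act :: "'a \<Rightarrow> 'x \<Rightarrow> 'x"
  assumes gset: "gset G X act"
begin

lemma gset_closed: "g \<in> carrier G \<Longrightarrow> x \<in> X \<Longrightarrow> act g x \<in> X"
  using gset by (simp add: gset_def)

lemma gset_one: "x \<in> X \<Longrightarrow> act \<one> x = x"
  using gset by (simp add: gset_def)

lemma gset_mult: "g \<in> carrier G \<Longrightarrow> h \<in> carrier G \<Longrightarrow> x \<in> X \<Longrightarrow> act (g \<otimes> h) x = act g (act h x)"
  using gset by (simp add: gset_def)

lemma gset_inv: "g \<in> carrier G \<Longrightarrow> x \<in> X \<Longrightarrow> act (inv g) (act g x) = x"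
  using gset_mult[of "inv g" g x] gset_one by simp

lemma gset_inv': "g \<in> carrier G \<Longrightarrow> x \<in> X \<Longrightarrow> act g (act (inv g) x) = x"
  using gset_mult[of g "inv g" x] gset_one by simp

lemma gset_inj: "g \<in> carrier G \<Longrightarrow> x \<in> X \<Longrightarrow> y \<in> X \<Longrightarrow> act g x = act g y \<longleftrightarrow> x = y"
  using gset_inv by metis

lemma gset_inj_on: "g \<in> carrier G \<Longrightarrow> inj_on (act g) X"
  using gset_inj by (auto simp: inj_on_def)

lemma gset_orbit_refl: "x \<in> X \<Longrightarrow> x \<in> orbit G act x"
  unfolding orbit_def using gset_one one_closed by force

lemma gset_orbit_eq:
  assumes "x \<in> X" "y \<in> orbit G act x"
  shows "orbit G act y = orbit G act x"
proof -
  obtain g where g: "g \<in> carrier G" "y = act g x" using assms unfolding orbit_def by auto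
  show ?thesis
  proof
    show "orbit G act y \<subseteq> orbit G act x"
    proof
      fix z assume "z \<in> orbit G act y"
      then obtain h where h: "h \<in> carrier G" "z = act h y" unfolding orbit_def by auto
      then have "z = act (h \<otimes> g) x" using g assms(1) gset_mult by simp
      then show "z \<in> orbit G act x" unfolding orbit_def using g h by blast
    qed
    show "orbit G act x \<subseteq> orbit G act y"
    proof
      fix z assume "z \<in> orbit G act x"
      then obtain h where h: "h \<in> carrier G" "z = act h x" unfolding orbit_def by auto
      then have "z = act (h \<otimes> inv g) y" using g assms(1) gset_mult gset_inv gset_closed by simp
      moreover have "h \<otimes> inv g \<in> carrier G" using g h by simp
      ultimately show "z \<in> orbit G act y" unfolding orbit_def by blast
    qed
  qed
qed

lemma gset_orbit_sub: "x \<in> X \<Longrightarrow> orbit G act x \<subseteq> X"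
  unfolding orbit_def using gset_closed by auto

lemma gset_orbit_act: "x \<in> X \<Longrightarrow> g \<in> carrier G \<Longrightarrow> orbit G act (act g x) = orbit G act x"
  by (rule gset_orbit_eq) (auto simp: orbit_def)

lemma orbit_someE:
  assumes "x \<in> X"
  obtains g where "g \<in> carrier G" "(SOME r. r \<in> orbit G act x) \<in> X" "x = act g (SOME r. r \<in> orbit G act x)"
proof -
  have s: "(SOME r. r \<in> orbit G act x) \<in> orbit G act x" using gset_orbit_refl[OF assms] by (rule someI)
  then have "x \<in> orbit G act (SOME r. r \<in> orbit G act x)"
    using gset_orbit_eq[OF assms s] gset_orbit_refl[OF assms] by simp
  then show thesis using that s gset_orbit_sub assms unfolding orbit_def by blast
qed

lemma orbits_someE:
  assumes "\<O> \<in> orbits G X act"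
  obtains "(SOME x. x \<in> \<O>) \<in> X" "\<O> = orbit G act (SOME x. x \<in> \<O>)"
proof -
  obtain x where x: "x \<in> X" "\<O> = orbit G act x" using assms unfolding orbits_def by auto
  have s: "(SOME r. r \<in> orbit G act x) \<in> orbit G act x" using gset_orbit_refl[OF x(1)] by (rule someI)
  then show thesis using that gset_orbit_eq[OF x(1) s] gset_orbit_sub[OF x(1)] x(2) by auto
qed

lemma transversal_some:
  assumes "finite (orbits G X act)"
  shows "transversal G X act ((\<lambda>\<O>. SOME x. x \<in> \<O>) ` orbits G X act)"
  unfolding transversal_def
proof (intro conjI ballI)
  show "(\<lambda>\<O>. SOME x. x \<in> \<O>) ` orbits G X act \<subseteq> X" using orbits_someE by blast
  fix x assume x: "x \<in> X"
  have o: "orbit G act x \<in> orbits G X act" using x by (auto simp: orbits_def)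
  show "\<exists>!r. r \<in> (\<lambda>\<O>. SOME x. x \<in> \<O>) ` orbits G X act \<and> r \<in> orbit G act x"
  proof (rule ex1I[of _ "SOME r. r \<in> orbit G act x"])
    show "(SOME r. r \<in> orbit G act x) \<in> (\<lambda>\<O>. SOME x. x \<in> \<O>) ` orbits G X act \<and>
      (SOME r. r \<in> orbit G act x) \<in> orbit G act x"
      using o gset_orbit_refl[OF x] by (auto intro: someI)
    fix r assume r: "r \<in> (\<lambda>\<O>. SOME x. x \<in> \<O>) ` orbits G X act \<and> r \<in> orbit G act x"
    then obtain \<O> where \<O>: "\<O> \<in> orbits G X act" "r = (SOME x. x \<in> \<O>)" by blast
    then have "\<O> = orbit G act r" using orbits_someE by metis
    then have "\<O> = orbit G act x" using r gset_orbit_eq[OF x] by simp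
    then show "r = (SOME r. r \<in> orbit G act x)" using \<O> by simp
  qed
qed (use assms in simp)

lemma sum_orbits_some:
  fixes w :: "'x \<Rightarrow> real"
  shows "(\<Sum>\<O>\<in>orbits G X act. w (SOME x. x \<in> \<O>)) = sum w ((\<lambda>\<O>. SOME x. x \<in> \<O>) ` orbits G X act)"
proof -
  have "inj_on (\<lambda>\<O>. SOME x. x \<in> \<O>) (orbits G X act)"
    by (rule inj_onI) (metis orbits_someE)
  then show ?thesis by (simp add: sum.reindex)
qed

text \<open>Moving each element of \<open>A\<close> to the representative of its orbit is injective when the elements of \<open>A\<close>
  are pairwise inequivalent.\<close>

lemma transversal_sum_ge:
  fixes w :: "'x \<Rightarrow> real"
  assumes R: "transversal G X act R"
    and A: "finite A" "A \<subseteq> X" "\<And>x y. x \<in> A \<Longrightarrow> y \<in> A \<Longrightarrow> y \<in> orbit G act x \<Longrightarrow> x = y"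
    and w: "\<And>x. x \<in> X \<Longrightarrow> 0 \<le> w x" "\<And>g x. g \<in> carrier G \<Longrightarrow> x \<in> X \<Longrightarrow> w (act g x) = w x"
  shows "sum w A \<le> sum w R"
proof -
  define r where "r x = (THE r. r \<in> R \<and> r \<in> orbit G act x)" for x
  have r: "r x \<in> R \<and> r x \<in> orbit G act x" if "x \<in> A" for x
  proof -
    have "x \<in> X" using that A(2) by blast
    then have "\<exists>!r. r \<in> R \<and> r \<in> orbit G act x" using R by (simp add: transversal_def)
    then show ?thesis unfolding r_def by (rule theI')
  qed
  have inj: "inj_on r A"
  proof (rule inj_onI)
    fix x y assume xy: "x \<in> A" "y \<in> A" "r x = r y"
    have "orbit G act (r x) = orbit G act x" "orbit G act (r y) = orbit G act y"
      using gset_orbit_eq r xy A(2) by blast+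
    then have "y \<in> orbit G act x" using xy A(2) gset_orbit_refl by (metis subsetD)
    then show "x = y" using A(3) xy by blast
  qed
  have "w (r x) = w x" if "x \<in> A" for x
    using r[OF that] w(2) that A(2) unfolding orbit_def by auto
  then have "sum w A = sum w (r ` A)" using inj by (simp add: sum.reindex)
  also have "\<dots> \<le> sum w R"
    by (rule sum_mono2) (use R r w(1) in \<open>auto simp: transversal_def\<close>)
  finally show ?thesis .
qed

lemma transversal_sum_le:
  fixes w :: "'x \<Rightarrow> real"
  assumes R: "transversal G X act R"
    and A: "finite A" "A \<subseteq> X" "\<And>x. x \<in> X \<Longrightarrow> \<exists>y\<in>A. y \<in> orbit G act x"
    and w: "\<And>x. x \<in> X \<Longrightarrow> 0 \<le> w x" "\<And>g x. g \<in> carrier G \<Longrightarrow> x \<in> X \<Longrightarrow> w (act g x) = w x"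
  shows "sum w R \<le> sum w A"
proof -
  have RX: "R \<subseteq> X" using R by (simp add: transversal_def)
  define r where "r x = (SOME y. y \<in> A \<and> y \<in> orbit G act x)" for x
  have r: "r x \<in> A \<and> r x \<in> orbit G act x" if "x \<in> R" for x
    unfolding r_def by (rule someI_ex) (use that A(3) RX in blast)
  have inj: "inj_on r R"
  proof (rule inj_onI)
    fix x y assume xy: "x \<in> R" "y \<in> R" "r x = r y"
    have "orbit G act (r x) = orbit G act x" "orbit G act (r y) = orbit G act y"
      using gset_orbit_eq r xy RX by blast+
    then have "y \<in> orbit G act x" "x \<in> orbit G act x" "x \<in> X" using xy RX gset_orbit_refl by (metis subsetD)+
    then show "x = y" using R xy(1,2) unfolding transversal_def by blast
  qed
  have "w (r x) = w x" if "x \<in> R" for x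
    using r[OF that] w(2) that RX unfolding orbit_def by auto
  then have "sum w R = sum w (r ` R)" using inj by (simp add: sum.reindex)
  also have "\<dots> \<le> sum w A"
    by (rule sum_mono2) (use A r w(1) in auto)
  finally show ?thesis .
qed

end

text \<open>Choose the value on one representative of each orbit and spread it by the action; the condition on
  stabilizers makes this independent of the group element used.\<close>

lemma equivariant_choice:
  assumes X: "gset G X a" and Y: "gset G Y b"
    and ex: "\<And>x. x \<in> X \<Longrightarrow> \<exists>y\<in>Y. P x y \<and> (\<forall>g\<in>carrier G. a g x = x \<longrightarrow> b g y = y)"
    and inv: "\<And>g x y. g \<in> carrier G \<Longrightarrow> x \<in> X \<Longrightarrow> y \<in> Y \<Longrightarrow> P x y \<Longrightarrow> P (a g x) (b g y)"
  obtains k where "\<And>x. x \<in> X \<Longrightarrow> k x \<in> Y" "\<And>x. x \<in> X \<Longrightarrow> P x (k x)"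
    "\<And>g x. g \<in> carrier G \<Longrightarrow> x \<in> X \<Longrightarrow> k (a g x) = b g (k x)"
proof -
  define rep where "rep x = (SOME r. r \<in> orbit G a x)" for x
  define \<gamma> where "\<gamma> x = (SOME g. g \<in> carrier G \<and> x = a g (rep x))" for x
  define y where "y r = (SOME y. y \<in> Y \<and> P r y \<and> (\<forall>g\<in>carrier G. a g r = r \<longrightarrow> b g y = y))" for r
  define k where "k x = b (\<gamma> x) (y (rep x))" for x
  have rep: "rep x \<in> X" if "x \<in> X" for x using orbit_someE[OF X that] unfolding rep_def by metis
  have \<gamma>: "\<gamma> x \<in> carrier G \<and> x = a (\<gamma> x) (rep x)" if "x \<in> X" for x
    unfolding \<gamma>_def by (rule someI_ex) (use orbit_someE[OF X that] in \<open>unfold rep_def, metis\<close>)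
  have y: "y r \<in> Y \<and> P r (y r) \<and> (\<forall>g\<in>carrier G. a g r = r \<longrightarrow> b g (y r) = y r)" if "r \<in> X" for r
    unfolding y_def by (rule someI_ex) (use ex[OF that] in blast)
  have rep_act: "rep (a g x) = rep x" if "g \<in> carrier G" "x \<in> X" for g x
    unfolding rep_def using gset_orbit_act[OF X] that by simp
  show thesis
  proof (rule that[of k])
    fix x assume x: "x \<in> X"
    show "k x \<in> Y" unfolding k_def using gset_closed[OF Y] \<gamma> y rep x by simp
    show "P x (k x)" unfolding k_def using inv[of "\<gamma> x" "rep x" "y (rep x)"] \<gamma>[OF x] y rep x by simp
    fix g assume g: "g \<in> carrier G"
    let ?r = "rep x"
    have gx: "a g x \<in> X" using gset_closed[OF X] g x by simp
    have c: "\<gamma> (a g x) \<in> carrier G" "\<gamma> x \<in> carrier G" using \<gamma> gx x by auto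
    have 1: "a (g \<otimes> \<gamma> x) ?r = a g x" using gset_mult[OF X g c(2) rep[OF x]] \<gamma>[OF x] by simp
    have 2: "a (\<gamma> (a g x)) ?r = a g x" using \<gamma>[OF gx] rep_act[OF g x] by simp
    have "a (inv \<gamma> (a g x) \<otimes> (g \<otimes> \<gamma> x)) ?r = a (inv \<gamma> (a g x)) (a (\<gamma> (a g x)) ?r)"
      using gset_mult[OF X _ _ rep[OF x]] 1 2 c g by simp
    also have "\<dots> = ?r" using gset_inv[OF X] c rep[OF x] by simp
    finally have "b (inv \<gamma> (a g x) \<otimes> (g \<otimes> \<gamma> x)) (y ?r) = y ?r" using y rep[OF x] c g by simp
    then have "b (\<gamma> (a g x)) (y ?r) = b (\<gamma> (a g x)) (b (inv \<gamma> (a g x) \<otimes> (g \<otimes> \<gamma> x)) (y ?r))" by simp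
    also have "\<dots> = b (g \<otimes> \<gamma> x) (y ?r)"
      using gset_mult[OF Y, of "inv \<gamma> (a g x)" "g \<otimes> \<gamma> x" "y ?r"] gset_inv'[OF Y] gset_closed[OF Y] c g y[OF rep[OF x]] by simp
    also have "\<dots> = b g (b (\<gamma> x) (y ?r))" using gset_mult[OF Y] c g y[OF rep[OF x]] by simp
    finally show "k (a g x) = b g (k x)" unfolding k_def using rep_act[OF g x] by simp
  qed
qed

end

section \<open>Free splittings\<close>

locale splitting = group G for G :: "('a, 'm) monoid_scheme" (structure) +
  fixes T :: "('a, 'v) gtree"
  assumes fs: "free_splitting G T"

sublocale splitting \<subseteq> tree T
  using fs by unfold_locales (simp add: free_splitting_def simplicial_action_def)

lemma (in group) gset_if_group_action:
  assumes "group_action G X a" shows "gset G X a"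
proof -
  interpret group_action G X a by fact
  show ?thesis unfolding gset_def
    using element_image composition_rule id_eq_one by (metis restrict_apply')
qed

context splitting
begin

lemma gset_verts: "gset G (verts T) (act T)"
  by (rule gset_if_group_action) (use fs in \<open>simp add: free_splitting_def simplicial_action_def\<close>)

lemmas act_verts = gset_closed[OF gset_verts]
  and act_one = gset_one[OF gset_verts]
  and act_mult = gset_mult[OF gset_verts]
  and act_inv = gset_inv[OF gset_verts]
  and act_inv' = gset_inv'[OF gset_verts]
  and act_inj = gset_inj[OF gset_verts]

lemma act_edge_set: "g \<in> carrier G \<Longrightarrow> e \<in> edges T \<Longrightarrow> act T g ` e \<in> edges T"
  using fs by (simp add: free_splitting_def simplicial_action_def)

lemma act_edge: "g \<in> carrier G \<Longrightarrow> {u, v} \<in> edges T \<Longrightarrow> {act T g u, act T g v} \<in> edges T"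
  using act_edge_set[of g "{u, v}"] by simp

lemma edge_sub: "e \<in> edges T \<Longrightarrow> e \<subseteq> verts T"
  using edgeE by blast

lemma gset_edges: "gset G (edges T) (\<lambda>g. (`) (act T g))"
proof -
  have "act T (g \<otimes> h) ` e = act T g ` act T h ` e" if "g \<in> carrier G" "h \<in> carrier G" "e \<in> edges T" for g h e
    unfolding image_image by (rule image_cong) (use edge_sub[OF that(3)] that act_mult in auto)
  moreover have "act T \<one> ` e = e" if "e \<in> edges T" for e
    using edge_sub[OF that] act_one by (metis image_cong image_ident subsetD)
  ultimately show ?thesis unfolding gset_def using act_edge_set by auto
qed

lemma edge_stab: "g \<in> carrier G \<Longrightarrow> e \<in> edges T \<Longrightarrow> act T g ` e = e \<Longrightarrow> g = \<one>"
proof -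
  assume "g \<in> carrier G" "e \<in> edges T" "act T g ` e = e"
  then have "g \<in> stabilizer G (\<lambda>g. (`) (act T g)) e" by (simp add: stabilizer_def)
  then show ?thesis using fs \<open>e \<in> edges T\<close> unfolding free_splitting_def by blast
qed

lemma edge_path_act: "g \<in> carrier G \<Longrightarrow> edge_path T p \<Longrightarrow> edge_path T (map (act T g) p)"
  unfolding edge_path_iff_nth using act_edge act_verts
  by (auto simp: act_inj) (metis act_inj add_2_eq_Suc' add_lessD1 nth_mem subsetD)

lemma geodesic_act:
  assumes "g \<in> carrier G" "u \<in> verts T" "v \<in> verts T"
  shows "tree_geodesic T (act T g u) (act T g v) = map (act T g) (tree_geodesic T u v)"
  using geodesic_props[OF assms(2,3)] edge_path_act[OF assms(1)]
  by (intro geodesic_eq) (simp add: path_between_def hd_map last_map)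

lemma sep_act:
  assumes "g \<in> carrier G" "u \<in> verts T" "v \<in> verts T"
  shows "sep T (act T g u) (act T g v) = (`) (act T g) ` sep T u v"
  unfolding sep_def using geodesic_act[OF assms] by (simp add: path_edges_map)

lemma no_fixed_vertex: "v \<in> verts T \<Longrightarrow> \<exists>g\<in>carrier G. act T g v \<noteq> v"
  using fs by (auto simp: free_splitting_def nontrivial_action_def)

lemma verts_nonempty: "verts T \<noteq> {}"
  using is_tree by (simp add: is_tree_def)

lemma incident_edge:
  assumes "v \<in> verts T" obtains w where "{v, w} \<in> edges T"
proof -
  obtain g where "g \<in> carrier G" "act T g v \<noteq> v" using no_fixed_vertex assms by blast
  then have gv: "act T g v \<in> verts T" "act T g v \<noteq> v" using act_verts assms by auto
  note p = geodesic_props[OF assms gv(1)]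
  then obtain r where "tree_geodesic T v (act T g v) = v # r" by (metis list.collapse)
  then show thesis using p gv(2) that by (cases r) (auto simp: edge_path_Cons)
qed

lemma edges_nonempty: "edges T \<noteq> {}"
  using verts_nonempty incident_edge by blast

text \<open>In a minimal action both sides of every edge meet every orbit of vertices: otherwise the
  hull of the orbit misses one side.\<close>

lemma minimal_sep:
  assumes v: "v \<in> verts T" and e: "e \<in> edges T"
  obtains g h where "g \<in> carrier G" "h \<in> carrier G" "e \<in> sep T (act T g v) (act T h v)"
proof (rule ccontr)
  assume "\<not> thesis"
  with that have no: "\<And>g h. g \<in> carrier G \<Longrightarrow> h \<in> carrier G \<Longrightarrow> e \<notin> sep T (act T g v) (act T h v)" by blast
  define \<O> where "\<O> = orbit G (act T) v"
  have \<O>V: "\<O> \<subseteq> verts T" unfolding \<O>_def using gset_orbit_sub[OF gset_verts v] .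
  have v\<O>: "v \<in> \<O>" unfolding \<O>_def using gset_orbit_refl[OF gset_verts v] .
  have act\<O>: "act T g x \<in> \<O>" if "g \<in> carrier G" "x \<in> \<O>" for g x
    using that act_mult[of g _ v] v unfolding \<O>_def orbit_def by auto (metis m_closed)
  define W where "W = {x \<in> verts T. \<forall>d\<in>edges T. (\<forall>u\<in>\<O>. d \<notin> sep T v u) \<longrightarrow> d \<notin> sep T v x}"
  have W_iff: "x \<in> W \<longleftrightarrow> x \<in> verts T \<and> (\<forall>d\<in>edges T. (\<forall>u\<in>\<O>. d \<notin> sep T v u) \<longrightarrow> d \<notin> sep T v x)" for x
    by (simp add: W_def)
  \<comment> \<open>The description of \<open>W\<close> by separation from all points of the orbit does not mention \<open>v\<close>, hence is invariant.\<close>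
  have W_iff2: "x \<in> W \<longleftrightarrow> x \<in> verts T \<and> (\<forall>d\<in>edges T. (\<forall>u\<in>\<O>. \<forall>u'\<in>\<O>. d \<notin> sep T u u') \<longrightarrow> (\<forall>u\<in>\<O>. d \<notin> sep T u x))" for x
  proof -
    have 1: "(\<forall>u\<in>\<O>. d \<notin> sep T v u) \<longleftrightarrow> (\<forall>u\<in>\<O>. \<forall>u'\<in>\<O>. d \<notin> sep T u u')" for d
    proof (intro iffI ballI)
      fix u u' assume "\<forall>u\<in>\<O>. d \<notin> sep T v u" "u \<in> \<O>" "u' \<in> \<O>"
      then show "d \<notin> sep T u u'" using sep_xor[of u v u' d] sep_commute[of u v] v \<O>V by auto
    qed (use v\<O> in blast)
    have 2: "(\<forall>u\<in>\<O>. d \<notin> sep T u x) \<longleftrightarrow> d \<notin> sep T v x" if "\<forall>u\<in>\<O>. d \<notin> sep T v u" "x \<in> verts T" for d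
    proof (intro iffI ballI)
      fix u assume "d \<notin> sep T v x" "u \<in> \<O>"
      then show "d \<notin> sep T u x" using that sep_xor[of u v x d] sep_commute[of u v] v \<O>V by auto
    qed (use v\<O> in blast)
    show ?thesis
    proof (cases "x \<in> verts T")
      case True
      have "((\<forall>u\<in>\<O>. d \<notin> sep T v u) \<longrightarrow> d \<notin> sep T v x) \<longleftrightarrow>
        ((\<forall>u\<in>\<O>. \<forall>u'\<in>\<O>. d \<notin> sep T u u') \<longrightarrow> (\<forall>u\<in>\<O>. d \<notin> sep T u x))" for d
        using 1[of d] 2[of d, OF _ True] by argo
      then show ?thesis unfolding W_iff using True by simp
    qed (simp add: W_iff)
  qed
  have "subtree T W"
    unfolding subtree_def
  proof (intro conjI ballI)
    have "v \<in> W" using v unfolding W_iff by simp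
    then show "W \<noteq> {}" by blast
    show "W \<subseteq> verts T" unfolding W_def by auto
    fix x y assume xy: "x \<in> W" "y \<in> W"
    then have xyV: "x \<in> verts T" "y \<in> verts T" by (auto simp: W_def)
    show "set (tree_geodesic T x y) \<subseteq> W"
    proof
      fix z assume z: "z \<in> set (tree_geodesic T x y)"
      then have zV: "z \<in> verts T" using geodesic_props[OF xyV] by blast
      obtain p q where pq: "tree_geodesic T x y = p @ z # q" using z by (meson split_list)
      then have "tree_geodesic T x y = (p @ [z]) @ q" by simp
      then have "edge_path T (p @ [z])"
        using geodesic_props(1)[OF xyV] edge_path_append_left[of T "p @ [z]" q] by simp
      moreover have "hd (p @ [z]) = x" using pq geodesic_props(2)[OF xyV] by (cases p) auto
      ultimately have "tree_geodesic T x z = p @ [z]" by (intro geodesic_eq) (simp add: path_between_def)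
      moreover have "path_edges (p @ [z]) \<subseteq> path_edges ((p @ [z]) @ q)"
        using path_edges_append[of "p @ [z]" q] by (cases "q = []") auto
      ultimately have "sep T x z \<subseteq> sep T x y" unfolding sep_def pq by simp
      moreover have "d \<notin> sep T v x" "d \<notin> sep T v y" if "d \<in> edges T" "\<forall>u\<in>\<O>. d \<notin> sep T v u" for d
        using that xy unfolding W_iff by simp_all
      ultimately have "d \<notin> sep T v z" if "d \<in> edges T" "\<forall>u\<in>\<O>. d \<notin> sep T v u" for d
        using that sep_xor[of v x z d] sep_xor[of v x y d] zV xyV v by blast
      then show "z \<in> W" using zV unfolding W_iff by simp
    qed
  qed
  moreover have "act T g ` W \<subseteq> W" if g: "g \<in> carrier G" for g
  proof
    fix y assume "y \<in> act T g ` W"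
    then obtain x where x: "x \<in> W" "y = act T g x" by blast
    have xV: "x \<in> verts T" using x by (simp add: W_def)
    have "d \<notin> sep T u y" if d: "d \<in> edges T" "\<forall>u\<in>\<O>. \<forall>u'\<in>\<O>. d \<notin> sep T u u'" "u \<in> \<O>" for d u
    proof
      assume du: "d \<in> sep T u y"
      have ig: "inv g \<in> carrier G" using g by simp
      let ?d = "act T (inv g) ` d"
      have "?d \<notin> sep T u1 u2" if u: "u1 \<in> \<O>" "u2 \<in> \<O>" for u1 u2
      proof
        assume "?d \<in> sep T u1 u2"
        then have "act T g ` ?d \<in> sep T (act T g u1) (act T g u2)" using sep_act[OF g] u \<O>V by blast
        moreover have "act T g ` ?d = d" using gset_inv'[OF gset_edges g d(1)] .
        ultimately have "d \<in> sep T (act T g u1) (act T g u2)" by simp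
        then show False using d(2) act\<O>[OF g u(1)] act\<O>[OF g u(2)] by simp
      qed
      moreover have "?d \<in> sep T (act T (inv g) u) (act T (inv g) y)"
        using sep_act[OF ig] du d(3) \<O>V act_verts[OF g xV] x by blast
      moreover have "act T (inv g) y = x" using x act_inv[OF g xV] by simp
      ultimately have "\<forall>u1\<in>\<O>. \<forall>u2\<in>\<O>. ?d \<notin> sep T u1 u2" "?d \<in> sep T (act T (inv g) u) x" by simp_all
      moreover have "\<forall>u\<in>\<O>. ?d \<notin> sep T u x"
        using x(1) act_edge_set[OF ig d(1)] calculation(1) unfolding W_iff2 by simp
      ultimately show False using act\<O>[OF ig d(3)] by simp
    qed
    then show "y \<in> W" unfolding W_iff2 using act_verts[OF g xV] x by simp
  qed
  ultimately have "W = verts T" using fs unfolding free_splitting_def minimal_action_def by blast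
  obtain a b where ab: "a \<in> verts T" "b \<in> verts T" "e = {a, b}" using edgeE[OF e] by metis
  have "\<forall>u\<in>\<O>. e \<notin> sep T v u"
  proof
    fix u assume "u \<in> \<O>"
    then obtain g where "g \<in> carrier G" "u = act T g v" unfolding \<O>_def orbit_def by auto
    then show "e \<notin> sep T v u" using no[of \<one> g] act_one v by simp
  qed
  then have "e \<notin> sep T v a" "e \<notin> sep T v b"
    using \<open>W = verts T\<close> ab(1,2) e W_iff[of a] W_iff[of b] by simp_all
  moreover have "sep T v b = sym_diff (sep T v a) {e}" using sep_step v e ab by simp
  ultimately show False by blast
qed

lemma finite_vert_orbits: "finite (orbits G (verts T) (act T))"
  and finite_edge_orbits: "finite (orbits G (edges T) (\<lambda>g. (`) (act T g)))"
  using fs by (auto simp: free_splitting_def)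

end

section \<open>Collapsing an invariant forest\<close>

definition collapsed :: "('v \<Rightarrow> 'w) \<Rightarrow> 'v set \<Rightarrow> bool" where
  "collapsed q e \<longleftrightarrow> (\<exists>w. q ` e = {w})"

text \<open>The last condition says that the fibres are subtrees.\<close>

definition simplicial_collapse ::
  "('a, 'm) monoid_scheme \<Rightarrow> ('a, 'v) gtree \<Rightarrow> ('a, 'w) gtree \<Rightarrow> ('v \<Rightarrow> 'w) \<Rightarrow> bool" where
  "simplicial_collapse G S T q \<longleftrightarrow> q ` verts S = verts T \<and>
     (\<forall>g\<in>carrier G. \<forall>v\<in>verts S. q (act S g v) = act T g (q v)) \<and>
     edges T = {q ` e | e. e \<in> edges S \<and> \<not> collapsed q e} \<and>
     (\<forall>u\<in>verts S. \<forall>v\<in>verts S. q u = q v \<longrightarrow> sep S u v \<subseteq> {e \<in> edges S. collapsed q e})"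

definition collapse_tree :: "('a, 'v) gtree \<Rightarrow> ('v \<Rightarrow> 'w) \<Rightarrow> ('a, 'w) gtree" where
  "collapse_tree S q = \<lparr>verts = q ` verts S, edges = {q ` e | e. e \<in> edges S \<and> \<not> collapsed q e},
     act = \<lambda>g. restrict (\<lambda>w. q (act S g (SOME v. v \<in> verts S \<and> q v = w))) (q ` verts S)\<rparr>"

lemma collapsed_doubleton [simp]: "collapsed q {u, v} \<longleftrightarrow> q u = q v"
  unfolding collapsed_def by auto

lemma orbit_image: "orbit G a x = (\<lambda>g. a g x) ` carrier G"
  by (auto simp: orbit_def)

lemma (in group) group_action_if_gset:
  assumes X: "gset G X a" and ext: "\<And>g. g \<in> carrier G \<Longrightarrow> a g \<in> extensional X"
  shows "group_action G X a"
proof -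
  have bij: "a g \<in> Bij X" if g: "g \<in> carrier G" for g
  proof -
    have "bij_betw (a g) X X"
    proof (rule bij_betwI)
      show "a g \<in> X \<rightarrow> X" "a (inv g) \<in> X \<rightarrow> X" using gset_closed[OF X] g by auto
      show "\<And>x. x \<in> X \<Longrightarrow> a (inv g) (a g x) = x" "\<And>x. x \<in> X \<Longrightarrow> a g (a (inv g) x) = x"
        using gset_inv[OF X] gset_inv'[OF X] g by auto
    qed
    then show ?thesis using ext g by (simp add: Bij_def)
  qed
  have "a (g \<otimes> h) = compose X (a g) (a h)" if "g \<in> carrier G" "h \<in> carrier G" for g h
    by (rule extensionalityI[of _ X]) (use that ext gset_mult[OF X] in \<open>auto simp: compose_def\<close>)
  then have "a \<in> hom G (BijGroup X)"
    using bij by (auto simp: hom_def BijGroup_def)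
  then show ?thesis
    unfolding group_action_def group_hom_def group_hom_axioms_def using group_BijGroup by (simp add: is_group)
qed

context splitting
begin

context
  fixes F and q :: "'v \<Rightarrow> 'w"
  assumes F: "F \<subseteq> edges T" and Finv: "\<And>g e. g \<in> carrier G \<Longrightarrow> e \<in> F \<Longrightarrow> act T g ` e \<in> F"
    and q: "\<And>u v. u \<in> verts T \<Longrightarrow> v \<in> verts T \<Longrightarrow> q u = q v \<longleftrightarrow> (u, v) \<in> joined F"
begin

lemma q_eq_iff: "u \<in> verts T \<Longrightarrow> v \<in> verts T \<Longrightarrow> q u = q v \<longleftrightarrow> sep T u v \<subseteq> F"
  using q joined_iff_sep[OF F] by simp

lemma collapsed_iff: "e \<in> edges T \<Longrightarrow> collapsed q e \<longleftrightarrow> e \<in> F"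
proof -
  assume e: "e \<in> edges T"
  then obtain a b where "a \<in> verts T" "b \<in> verts T" "e = {a, b}" using edgeE by metis
  then show ?thesis using q_eq_iff[of a b] sep_edge[of a b] e by simp
qed

lemma q_sep:
  assumes "q u = q v" "e \<notin> F" "u \<in> verts T" "v \<in> verts T" "w \<in> verts T"
  shows "e \<in> sep T w u \<longleftrightarrow> e \<in> sep T w v"
  using assms q_eq_iff[of u v] sep_xor[of w u v e] by auto

lemma q_act_cong:
  assumes "q u = q v" "u \<in> verts T" "v \<in> verts T" "g \<in> carrier G"
  shows "q (act T g u) = q (act T g v)"
proof -
  have "sep T (act T g u) (act T g v) \<subseteq> F"
    using assms sep_act[of g u v] Finv q_eq_iff by auto
  then show ?thesis using q_eq_iff act_verts assms by simp
qed

lemma q_inj_edges: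
  assumes "e \<in> edges T" "d \<in> edges T" "e \<notin> F" "q ` e = q ` d"
  shows "e = d"
proof -
  obtain a b where ab: "a \<in> verts T" "b \<in> verts T" "e = {a, b}" using edgeE assms(1) by metis
  obtain c c' where c: "c \<in> verts T" "c' \<in> verts T" "d = {c, c'}" using edgeE assms(2) by metis
  have *: "e = {c, c'}" if c: "c \<in> verts T" "c' \<in> verts T" "{c, c'} \<in> edges T" "q a = q c" "q b = q c'" for c c'
  proof -
    have "e \<in> sep T a b" using sep_edge[of a b] ab assms(1) by simp
    then have "e \<in> sep T a c'" using q_sep[OF c(5) assms(3)] ab c by simp
    then have "e \<in> sep T c' a" using sep_commute ab c by simp
    then have "e \<in> sep T c' c" using q_sep[OF c(4) assms(3)] ab c by simp
    then show ?thesis using sep_commute sep_edge[of c c'] c by simp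
  qed
  have "q a = q c \<and> q b = q c' \<or> q a = q c' \<and> q b = q c"
    using assms(4) ab c by (auto simp: doubleton_eq_iff)
  then show ?thesis using *[of c c'] *[of c' c] c assms(2) by (auto simp: insert_commute)
qed

abbreviation "T' \<equiv> collapse_tree T q"

lemma verts': "verts T' = q ` verts T" and edges': "edges T' = {q ` e | e. e \<in> edges T \<and> e \<notin> F}"
  using collapsed_iff by (auto simp: collapse_tree_def)

lemma edges'E:
  assumes "e' \<in> edges T'"
  obtains e where "e \<in> edges T" "e \<notin> F" "e' = q ` e"
  using assms unfolding edges' mem_Collect_eq by auto

lemma edges'I: "e \<in> edges T \<Longrightarrow> e \<notin> F \<Longrightarrow> q ` e \<in> edges T'"
  unfolding edges' mem_Collect_eq by auto

lemma act': "g \<in> carrier G \<Longrightarrow> v \<in> verts T \<Longrightarrow> act T' g (q v) = q (act T g v)"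
proof -
  assume g: "g \<in> carrier G" and v: "v \<in> verts T"
  define u where "u = (SOME u. u \<in> verts T \<and> q u = q v)"
  have "u \<in> verts T \<and> q u = q v" unfolding u_def by (rule someI[of _ v]) (use v in simp)
  then have "q (act T g u) = q (act T g v)" using q_act_cong g v by blast
  then show ?thesis using v by (simp add: collapse_tree_def u_def)
qed

lemma act'_edge: "g \<in> carrier G \<Longrightarrow> e \<in> edges T \<Longrightarrow> act T' g ` q ` e = q ` act T g ` e"
  unfolding image_image by (rule image_cong) (use edge_sub act' in auto)

lemma splits_at_collapse:
  assumes e: "e \<in> edges T" "e \<notin> F" and a: "a \<in> verts T"
  obtains \<psi> where "splits_at T' (q ` e) \<psi>" "\<And>v. v \<in> verts T \<Longrightarrow> \<psi> (q v) \<longleftrightarrow> e \<in> sep T a v"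
proof -
  define \<psi> where "\<psi> w \<longleftrightarrow> e \<in> sep T a (SOME v. v \<in> verts T \<and> q v = w)" for w
  have \<psi>: "\<psi> (q v) \<longleftrightarrow> e \<in> sep T a v" if v: "v \<in> verts T" for v
  proof -
    define u where "u = (SOME u. u \<in> verts T \<and> q u = q v)"
    have "u \<in> verts T \<and> q u = q v" unfolding u_def by (rule someI[of _ v]) (use v in simp)
    then show ?thesis using q_sep[of u v e a] e a v unfolding \<psi>_def u_def by blast
  qed
  have "splits_at T' (q ` e) \<psi>"
    unfolding splits_at_def
  proof (intro allI impI)
    fix x y assume xy: "{x, y} \<in> edges T'"
    then obtain d where d: "d \<in> edges T" "d \<notin> F" "{x, y} = q ` d" using edges'E by metis
    then obtain c c' where c: "c \<in> verts T" "c' \<in> verts T" "d = {c, c'}" using edgeE by metis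
    have "\<psi> x \<noteq> \<psi> y \<longleftrightarrow> \<psi> (q c) \<noteq> \<psi> (q c')" using d c by (auto simp: doubleton_eq_iff)
    also have "\<dots> \<longleftrightarrow> d = e" using \<psi>[OF c(1)] \<psi>[OF c(2)] splits_at_sep[OF a e(1)] d(1) c(3)
      unfolding splits_at_def by blast
    also have "\<dots> \<longleftrightarrow> {x, y} = q ` e" using q_inj_edges[OF e(1) d(1) e(2)] d(3) by metis
    finally show "\<psi> x \<noteq> \<psi> y \<longleftrightarrow> {x, y} = q ` e" .
  qed
  with \<psi> that show thesis by blast
qed

text \<open>A side of an edge outside \<open>F\<close> is a union of components of \<open>F\<close>, so all remaining edges are still bridges.\<close>

lemma tree_collapse: "is_tree T'"
proof (rule is_tree_if_bridges)
  show "verts T' \<noteq> {}" using verts_nonempty verts' by simp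
  show "\<exists>u\<in>verts T'. \<exists>v\<in>verts T'. u \<noteq> v \<and> e' = {u, v}" if "e' \<in> edges T'" for e'
  proof -
    obtain e where e: "e \<in> edges T" "e \<notin> F" "e' = q ` e" using \<open>e' \<in> edges T'\<close> edges'E by metis
    then obtain a b where ab: "a \<in> verts T" "b \<in> verts T" "e = {a, b}" using edgeE by metis
    then have "q a \<noteq> q b" using collapsed_iff e by force
    then show ?thesis using ab e verts' by auto
  qed
  show "\<exists>\<psi>. splits_at T' e' \<psi>" if "e' \<in> edges T'" for e'
  proof -
    obtain e where e: "e \<in> edges T" "e \<notin> F" "e' = q ` e" using \<open>e' \<in> edges T'\<close> edges'E by metis
    obtain a where "a \<in> verts T" using verts_nonempty by blast
    with e show ?thesis using splits_at_collapse by metis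
  qed
  have "(q u, q v) \<in> joined (edges T')" if "u \<in> verts T" "v \<in> verts T" for u v
    using that
  proof (induction rule: walk_induct)
    case (step v w)
    have "(q v, q w) \<in> joined (edges T')"
    proof (cases "{v, w} \<in> F")
      case True
      then have "q v = q w" using step collapsed_iff[of "{v, w}"] by simp
      then show ?thesis by simp
    next
      case False
      then have "q ` {v, w} \<in> edges T'" using edges'I step by metis
      then show ?thesis by (intro joined_edge) simp
    qed
    then show ?case using step joined_trans by metis
  qed simp
  then show "(x, y) \<in> joined (edges T')" if "x \<in> verts T'" "y \<in> verts T'" for x y
    using that unfolding verts' by blast
qed

lemma sep_collapse:
  assumes e: "e \<in> edges T" "e \<notin> F" and "u \<in> verts T" "v \<in> verts T"
  shows "q ` e \<in> sep T' (q u) (q v) \<longleftrightarrow> e \<in> sep T u v"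
proof -
  interpret T': tree T' by unfold_locales (rule tree_collapse)
  obtain \<psi> where \<psi>: "splits_at T' (q ` e) \<psi>" "\<And>v. v \<in> verts T \<Longrightarrow> \<psi> (q v) \<longleftrightarrow> e \<in> sep T u v"
    using splits_at_collapse[OF e assms(3)] by blast
  have "q ` e \<in> edges T'" using edges'I e by metis
  then have "q ` e \<in> sep T' (q u) (q v) \<longleftrightarrow> \<psi> (q u) \<noteq> \<psi> (q v)"
    using T'.sep_iff_splits[OF \<psi>(1)] verts' assms by simp
  then show ?thesis using \<psi>(2) assms by simp
qed

lemma gset_collapse: "gset G (verts T') (act T')"
  unfolding gset_def verts'
  using act' act_verts act_one act_mult by (auto simp: act')

text \<open>By \<open>minimal_sep\<close> the translates of a vertex of an invariant subtree lie on both sides of each edge, and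
  this is inherited from the uncollapsed tree.\<close>

lemma minimal_collapse: "minimal_action G T'"
  unfolding minimal_action_def
proof (intro allI impI)
  interpret T': tree T' by unfold_locales (rule tree_collapse)
  fix W assume "subtree T' W \<and> (\<forall>g\<in>carrier G. act T' g ` W \<subseteq> W)"
  then have W: "W \<noteq> {}" "W \<subseteq> verts T'" "\<And>u v. u \<in> W \<Longrightarrow> v \<in> W \<Longrightarrow> set (tree_geodesic T' u v) \<subseteq> W"
    and Winv: "\<And>g w. g \<in> carrier G \<Longrightarrow> w \<in> W \<Longrightarrow> act T' g w \<in> W"
    unfolding subtree_def by blast+
  obtain w where w: "w \<in> W" using W by blast
  then obtain v where v: "v \<in> verts T" "w = q v" using W verts' by blast
  have "x \<in> W" if x: "x \<in> verts T'" for x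
  proof (cases "x = w")
    case False
    have wV: "w \<in> verts T'" using w W by blast
    note p = T'.geodesic_props[OF x wV]
    obtain y r where "tree_geodesic T' x w = x # y # r"
      using p False by (cases "tree_geodesic T' x w" rule: remdups_adj.cases) auto
    then have "{x, y} \<in> edges T'" using p by (auto simp: edge_path_Cons)
    then obtain e where e: "e \<in> edges T" "e \<notin> F" "{x, y} = q ` e" using edges'E by metis
    obtain g h where gh: "g \<in> carrier G" "h \<in> carrier G" "e \<in> sep T (act T g v) (act T h v)"
      using minimal_sep[OF v(1) e(1)] by metis
    then have "q ` e \<in> sep T' (act T' g w) (act T' h w)"
      using sep_collapse[OF e(1,2)] act' act_verts v by simp
    then have "x \<in> set (tree_geodesic T' (act T' g w) (act T' h w))"
      unfolding sep_def e(3)[symmetric] using path_edges_mem[of "{x, y}" _ x] by simp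
    then show ?thesis using W(3) Winv gh w by blast
  qed (use w in simp)
  then show "W = verts T'" using W by blast
qed

lemma free_splitting_collapse:
  assumes proper: "F \<noteq> edges T"
  shows "free_splitting G T'"
  unfolding free_splitting_def
proof (intro conjI ballI)
  have ext: "act T' g \<in> extensional (verts T')" if "g \<in> carrier G" for g
    unfolding verts' by (simp add: collapse_tree_def)
  show "simplicial_action G T'"
    unfolding simplicial_action_def
  proof (intro conjI ballI)
    show "is_tree T'" by (rule tree_collapse)
    show "group_action G (verts T') (act T')"
      by (rule group_action_if_gset[OF gset_collapse]) (rule ext)
    fix g e' assume g: "g \<in> carrier G" and "e' \<in> edges T'"
    then obtain e where e: "e \<in> edges T" "e \<notin> F" "e' = q ` e" using edges'E by metis
    have "act T g ` e \<notin> F"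
    proof
      assume "act T g ` e \<in> F"
      then have "act T (inv g) ` act T g ` e \<in> F" using Finv g by simp
      then show False using e gset_inv[OF gset_edges g e(1)] by simp
    qed
    then show "act T' g ` e' \<in> edges T'" using act'_edge[OF g e(1)] e(3) act_edge_set[OF g e(1)] edges'I by simp
  qed
  show "nontrivial_action G T'"
    unfolding nontrivial_action_def
  proof
    assume "\<exists>v\<in>verts T'. \<forall>g\<in>carrier G. act T' g v = v"
    then obtain v where v: "v \<in> verts T" "\<And>g. g \<in> carrier G \<Longrightarrow> act T' g (q v) = q v"
      unfolding verts' by blast
    obtain e where e: "e \<in> edges T" "e \<notin> F" using proper F by blast
    obtain g h where gh: "g \<in> carrier G" "h \<in> carrier G" "e \<in> sep T (act T g v) (act T h v)"
      using minimal_sep[OF v(1) e(1)] by metis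
    have "q (act T g v) = q (act T h v)" using v gh act' by metis
    then show False using gh e q_eq_iff act_verts v by blast
  qed
  show "minimal_action G T'" by (rule minimal_collapse)
  show "stabilizer G (\<lambda>g. (`) (act T' g)) e' = {\<one>}" if "e' \<in> edges T'" for e'
  proof -
    obtain e where e: "e \<in> edges T" "e \<notin> F" "e' = q ` e" using \<open>e' \<in> edges T'\<close> edges'E by metis
    have "g = \<one>" if "g \<in> carrier G" "act T' g ` e' = e'" for g
    proof -
      have "q ` e = q ` act T g ` e" using act'_edge e that by simp
      then have "act T g ` e = e" using q_inj_edges[OF e(1) act_edge_set[OF that(1) e(1)] e(2)] by simp
      then show ?thesis using edge_stab that(1) e by blast
    qed
    moreover have "act T' \<one> ` e' = e'"
      using act'_edge[OF one_closed e(1)] gset_one[OF gset_edges e(1)] e by simp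
    ultimately show ?thesis by (auto simp: stabilizer_def)
  qed
  have "orbits G (verts T') (act T') \<subseteq> (`) q ` orbits G (verts T) (act T)"
  proof
    fix \<O> assume "\<O> \<in> orbits G (verts T') (act T')"
    then obtain v where v: "v \<in> verts T" "\<O> = orbit G (act T') (q v)" unfolding orbits_def verts' by blast
    then have "\<O> = q ` orbit G (act T) v" using v(1) by (simp add: orbit_image image_image act' cong: image_cong_simp)
    then show "\<O> \<in> (`) q ` orbits G (verts T) (act T)" unfolding orbits_def using v by blast
  qed
  then show "finite (orbits G (verts T') (act T'))" using finite_vert_orbits finite_surj by blast
  have "orbits G (edges T') (\<lambda>g. (`) (act T' g)) \<subseteq> (`) ((`) q) ` orbits G (edges T) (\<lambda>g. (`) (act T g))"
  proof
    fix \<O> assume "\<O> \<in> orbits G (edges T') (\<lambda>g. (`) (act T' g))"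
    then obtain e' where "e' \<in> edges T'" "\<O> = orbit G (\<lambda>g. (`) (act T' g)) e'"
      unfolding orbits_def by blast
    then obtain e where e: "e \<in> edges T" "\<O> = orbit G (\<lambda>g. (`) (act T' g)) (q ` e)"
      using edges'E by metis
    moreover have "act T' g ` q ` e = q ` act T g ` e" if "g \<in> carrier G" for g
      using act'_edge that e by blast
    ultimately have "\<O> = (`) q ` orbit G (\<lambda>g. (`) (act T g)) e"
      unfolding orbit_image image_image[of "(`) q"] by (simp cong: image_cong_simp)
    then show "\<O> \<in> (`) ((`) q) ` orbits G (edges T) (\<lambda>g. (`) (act T g))"
      unfolding orbits_def using e by blast
  qed
  then show "finite (orbits G (edges T') (\<lambda>g. (`) (act T' g)))"
    using finite_edge_orbits finite_surj by blast
qed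

lemma simplicial_collapse: "simplicial_collapse G T T' q"
  unfolding simplicial_collapse_def
proof (intro conjI ballI impI)
  show "edges T' = {q ` e |e. e \<in> edges T \<and> \<not> collapsed q e}" "q ` verts T = verts T'"
    by (simp_all add: collapse_tree_def)
  fix u v assume "u \<in> verts T" "v \<in> verts T" "q u = q v"
  then show "sep T u v \<subseteq> {e \<in> edges T. collapsed q e}" using q_eq_iff collapsed_iff F by blast
qed (simp add: act')

lemma ffs_le_collapse:
  assumes "ffs_le \<A> (F_ell G T)"
  shows "ffs_le \<A> (F_ell G T')"
  unfolding ffs_le_def
proof
  fix H assume "H \<in> \<Union>\<A>"
  with assms have "\<exists>K\<in>\<Union> (F_ell G T). H \<subseteq> K" unfolding ffs_le_def by (rule bspec)
  then obtain K C where K: "H \<subseteq> K" "K \<in> C" "C \<in> F_ell G T" by blast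
  then obtain v where v: "v \<in> verts T" "stabilizer G (act T) v \<noteq> {\<one>}" "C = conj_class G (stabilizer G (act T) v)"
    unfolding F_ell_def by blast
  let ?s = "stabilizer G (act T) v" and ?s' = "stabilizer G (act T') (q v)"
  have sub: "?s \<subseteq> ?s'" unfolding stabilizer_def using act' v by auto
  obtain g where g: "g \<in> carrier G" "K = g <# ?s #> inv g" using K v unfolding conj_class_def by blast
  have "K \<subseteq> g <# ?s' #> inv g" unfolding g l_coset_def r_coset_def using sub by blast
  moreover have "?s' \<noteq> {\<one>}"
  proof -
    have "\<one> \<in> ?s" using v act_one by (simp add: stabilizer_def)
    then show ?thesis using sub v by blast
  qed
  then have "conj_class G ?s' \<in> F_ell G T'" using v(1) verts' unfolding F_ell_def by blast
  moreover have "g <# ?s' #> inv g \<in> conj_class G ?s'" using g(1) unfolding conj_class_def by blast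
  ultimately show "\<exists>K\<in>\<Union> (F_ell G T'). H \<subseteq> K" using K(1) by (meson UnionI order_trans)
qed

end

text \<open>A vertex of the collapsed tree is encoded by a component \<open>C\<close> of the forest: the index of its
  orbit together with the set of all \<open>g\<close> that carry a chosen vertex of that orbit into \<open>C\<close>.\<close>

lemma quotient_map_exists:
  assumes F: "F \<subseteq> edges T" and Finv: "\<And>g e. g \<in> carrier G \<Longrightarrow> e \<in> F \<Longrightarrow> act T g ` e \<in> F"
  obtains q :: "'v \<Rightarrow> 'a set \<times> nat"
    where "\<And>u v. u \<in> verts T \<Longrightarrow> v \<in> verts T \<Longrightarrow> q u = q v \<longleftrightarrow> (u, v) \<in> joined F"
proof -
  define r where "r = joined F"
  have r: "(u, u) \<in> r" "(u, v) \<in> r \<Longrightarrow> (v, u) \<in> r" "(u, v) \<in> r \<Longrightarrow> (v, w) \<in> r \<Longrightarrow> (u, w) \<in> r" for u v w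
    unfolding r_def using joined_sym joined_trans by auto
  have ract: "(act T g u, act T g v) \<in> r" if "(u, v) \<in> r" "g \<in> carrier G" "u \<in> verts T" "v \<in> verts T" for g u v
  proof -
    have "sep T (act T g u) (act T g v) \<subseteq> F"
      using that sep_act[of g u v] Finv joined_iff_sep[OF F] unfolding r_def by auto
    then show ?thesis unfolding r_def using joined_iff_sep[OF F] act_verts that by simp
  qed
  define o' where "o' v = {w \<in> verts T. \<exists>g\<in>carrier G. (act T g w, v) \<in> r}" for v
  have o'_cong: "o' u = o' v" if "(u, v) \<in> r" for u v
    unfolding o'_def using r that by blast
  have o'_sub: "o' v \<subseteq> o' (act T h v)" if h: "h \<in> carrier G" "v \<in> verts T" for h v
  proof
    fix w assume "w \<in> o' v"
    then obtain g where g: "g \<in> carrier G" "w \<in> verts T" "(act T g w, v) \<in> r" unfolding o'_def by blast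
    have "act T (h \<otimes> g) w = act T h (act T g w)" using act_mult g h by simp
    then have "(act T (h \<otimes> g) w, act T h v) \<in> r" using ract[OF g(3) h(1)] act_verts g h by simp
    then show "w \<in> o' (act T h v)" unfolding o'_def using g h by blast
  qed
  have o'_act: "o' (act T h v) = o' v" if h: "h \<in> carrier G" "v \<in> verts T" for h v
    using o'_sub[OF h] o'_sub[of "inv h" "act T h v"] h act_inv act_verts by auto
  have "o' ` verts T \<subseteq> (\<lambda>\<O>. o' (SOME x. x \<in> \<O>)) ` orbits G (verts T) (act T)"
  proof
    fix X assume "X \<in> o' ` verts T"
    then obtain v where v: "v \<in> verts T" "X = o' v" by blast
    obtain g where "g \<in> carrier G" "(SOME r. r \<in> orbit G (act T) v) \<in> verts T" "v = act T g (SOME r. r \<in> orbit G (act T) v)"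
      using orbit_someE[OF gset_verts v(1)] by metis
    then have "X = o' (SOME r. r \<in> orbit G (act T) v)" using o'_act v by metis
    then show "X \<in> (\<lambda>\<O>. o' (SOME x. x \<in> \<O>)) ` orbits G (verts T) (act T)"
      using v by (auto simp: orbits_def)
  qed
  then have "finite (o' ` verts T)" using finite_vert_orbits finite_surj by blast
  then obtain f :: "'v set \<Rightarrow> nat" where f: "inj_on f (o' ` verts T)"
    using finite_imp_inj_to_nat_seg by metis
  define rep where "rep X = (SOME x. x \<in> X)" for X :: "'v set"
  define q where "q v = ({g \<in> carrier G. (act T g (rep (o' v)), v) \<in> r}, f (o' v))" for v
  have "q u = q v \<longleftrightarrow> (u, v) \<in> joined F" if uv: "u \<in> verts T" "v \<in> verts T" for u v
  proof
    assume quv: "q u = q v"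
    then have o: "o' u = o' v" using f uv unfolding q_def inj_on_def by auto
    have "u \<in> o' u" unfolding o'_def using uv act_one r(1) one_closed by force
    then have "rep (o' u) \<in> o' u" unfolding rep_def by (rule someI)
    then obtain g where g: "g \<in> carrier G" "(act T g (rep (o' u)), u) \<in> r" unfolding o'_def by blast
    then have "g \<in> fst (q u)" unfolding q_def by simp
    then have "g \<in> fst (q v)" using quv by simp
    then have "(act T g (rep (o' u)), v) \<in> r" unfolding q_def o by simp
    then show "(u, v) \<in> joined F" using g r unfolding r_def by blast
  next
    assume "(u, v) \<in> joined F"
    then have uvr: "(u, v) \<in> r" by (simp add: r_def)
    have "(x, u) \<in> r \<longleftrightarrow> (x, v) \<in> r" for x using uvr r by blast
    then show "q u = q v" unfolding q_def using o'_cong[OF uvr] by simp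
  qed
  then show thesis using that by blast
qed

end

section \<open>Geometric realizations\<close>

text \<open>The point of the edge with ends \<open>a\<close> and \<open>b\<close> that has coordinate \<open>s\<close> at \<open>b\<close>. For \<open>a = b\<close> it is the vertex
  \<open>a\<close>, so that collapsed edges need no separate treatment.\<close>

definition seg :: "'v \<Rightarrow> 'v \<Rightarrow> real \<Rightarrow> 'v \<Rightarrow> real" where
  "seg a b s = (\<lambda>w. (if w = a then 1 - s else 0) + (if w = b then s else 0))"

lemma seg_self [simp]: "seg a a s = vertex_point a"
  by (auto simp: seg_def vertex_point_def)

lemma seg_0 [simp]: "seg a b 0 = vertex_point a" and seg_1 [simp]: "seg a b 1 = vertex_point b"
  by (auto simp: seg_def vertex_point_def)

lemma seg_swap: "seg b a s = seg a b (1 - s)"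
  by (auto simp: seg_def)

lemma seg_eq_iff: "a \<noteq> b \<Longrightarrow> seg a b s = seg a b t \<longleftrightarrow> s = t"
  by (auto simp: seg_def fun_eq_iff)

lemma vertex_point_eq_iff [simp]: "vertex_point a = vertex_point b \<longleftrightarrow> a = b"
  by (auto simp: vertex_point_def fun_eq_iff split: if_splits)

lemma seg_eq_vertex_point:
  assumes "a \<noteq> b" "seg a b s = vertex_point w"
  shows "s = 0 \<and> w = a \<or> s = 1 \<and> w = b"
proof -
  have "1 - s = (if a = w then 1 else 0)" using fun_cong[OF assms(2), of a] assms(1)
    by (simp add: seg_def vertex_point_def)
  moreover have "s = (if b = w then 1 else 0)" using fun_cong[OF assms(2), of b] assms(1)
    by (simp add: seg_def vertex_point_def)
  ultimately show ?thesis by (auto split: if_splits)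
qed

lemma cell_seg: "a \<noteq> b \<Longrightarrow> cell {a, b} = seg a b ` {0..1}"
proof
  assume ab: "a \<noteq> b"
  show "cell {a, b} \<subseteq> seg a b ` {0..1}"
  proof
    fix x assume x: "x \<in> cell {a, b}"
    then have "x = seg a b (x b)" using ab by (auto simp: cell_def seg_def fun_eq_iff)
    moreover have "x b \<in> {0..1}" using x ab unfolding cell_def by (simp add: add_increasing2)
      (metis add_increasing le_add_same_cancel2 add.commute)
    ultimately show "x \<in> seg a b ` {0..1}" by blast
  qed
  show "seg a b ` {0..1} \<subseteq> cell {a, b}" using ab by (auto simp: cell_def seg_def)
qed

lemma seg_in_cell: "0 \<le> s \<Longrightarrow> s \<le> 1 \<Longrightarrow> a \<noteq> b \<Longrightarrow> seg a b s \<in> cell {a, b}"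
  by (simp add: cell_seg)

lemma vertex_point_in_cell_iff: "finite e \<Longrightarrow> vertex_point v \<in> cell e \<longleftrightarrow> v \<in> e"
  by (auto simp: cell_def vertex_point_def split: if_splits)

lemma cell_open_iff:
  assumes "a \<noteq> b"
  shows "openin (top_of_set (cell {a, b})) (U \<inter> cell {a, b}) \<longleftrightarrow>
         openin (top_of_set {0..1}) {s \<in> {0..1}. seg a b s \<in> U}"
proof -
  have cont1: "continuous_on {0..1} (seg a b)"
  proof (rule continuous_on_coordinatewise_then_product)
    show "continuous_on {0..1} (\<lambda>s. seg a b s i)" for i
      unfolding seg_def by (cases "i = a"; cases "i = b") (auto intro!: continuous_intros)
  qed
  have cont2: "continuous_on (cell {a, b}) (\<lambda>x. x b)"
    by (rule continuous_on_product_coordinates[THEN continuous_on_subset]) simp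
  have b: "seg a b s b = s" for s using assms by (simp add: seg_def)
  have hom: "homeomorphism {0..1} (cell {a, b}) (seg a b) (\<lambda>x. x b)"
    unfolding homeomorphism_def using cont1 cont2 b by (auto simp: cell_seg[OF assms] image_iff)
  have 1: "seg a b ` {s \<in> {0..1}. seg a b s \<in> U} = U \<inter> cell {a, b}"
    by (auto simp: cell_seg[OF assms])
  have 2: "(\<lambda>x. x b) ` (U \<inter> cell {a, b}) = {s \<in> {0..1}. seg a b s \<in> U}"
    unfolding 1[symmetric] image_image using b by simp
  show ?thesis
    using homeomorphism_imp_open_map[OF hom, of "{s \<in> {0..1}. seg a b s \<in> U}"]
      homeomorphism_imp_open_map[OF homeomorphism_symD[OF hom], of "U \<inter> cell {a, b}"]
    unfolding 1 2 by blast
qed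

text \<open>The affine extension of a map of vertices that sends each edge to an edge or to a vertex.\<close>

definition realize :: "('v \<Rightarrow> 'w) \<Rightarrow> ('v \<Rightarrow> real) \<Rightarrow> 'w \<Rightarrow> real" where
  "realize q x = (\<lambda>w. \<Sum>v\<in>{v. x v \<noteq> 0 \<and> q v = w}. x v)"

lemma realize_seg: assumes "a \<noteq> b" shows "realize q (seg a b s) = seg (q a) (q b) s"
proof
  fix w
  have "realize q (seg a b s) w = (\<Sum>v\<in>{v \<in> {a, b}. q v = w}. seg a b s v)"
    unfolding realize_def by (rule sum.mono_neutral_left) (auto simp: seg_def split: if_splits)
  also have "{v \<in> {a, b}. q v = w} = (if q a = w then {a} else {}) \<union> (if q b = w then {b} else {})" by auto
  also have "sum (seg a b s) \<dots> = seg (q a) (q b) s w" using assms by (auto simp: seg_def)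
  finally show "realize q (seg a b s) w = seg (q a) (q b) s w" .
qed

context splitting
begin

lemma realization_eq: "realization T = (\<Union>e\<in>edges T. cell e)"
proof -
  have "vertex_point v \<in> (\<Union>e\<in>edges T. cell e)" if v: "v \<in> verts T" for v
  proof -
    obtain w where "{v, w} \<in> edges T" using incident_edge v by blast
    then show ?thesis using vertex_point_in_cell_iff[of "{v, w}" v] by blast
  qed
  then show ?thesis unfolding realization_def by blast
qed

lemma vertex_point_realization: "v \<in> verts T \<Longrightarrow> vertex_point v \<in> realization T"
  by (simp add: realization_def)

lemma cellE:
  assumes "e \<in> edges T" "x \<in> cell e"
  obtains a b s where "a \<in> verts T" "b \<in> verts T" "a \<noteq> b" "e = {a, b}" "0 \<le> s" "s \<le> 1" "x = seg a b s"
proof -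
  obtain a b where "a \<in> verts T" "b \<in> verts T" "a \<noteq> b" "e = {a, b}" using edgeE assms(1) by metis
  then show thesis using that assms(2) cell_seg[of a b] by auto
qed

lemma realizationE:
  assumes "x \<in> realization T"
  obtains a b s where "a \<in> verts T" "b \<in> verts T" "a \<noteq> b" "{a, b} \<in> edges T" "0 \<le> s" "s \<le> 1" "x = seg a b s"
proof -
  obtain e where e: "e \<in> edges T" "x \<in> cell e" using assms unfolding realization_eq by blast
  show thesis by (rule cellE[OF e]) (rule that, use e in auto)
qed

lemma seg_realization: "{a, b} \<in> edges T \<Longrightarrow> 0 \<le> s \<Longrightarrow> s \<le> 1 \<Longrightarrow> seg a b s \<in> realization T"
  unfolding realization_eq using seg_in_cell[of s a b] edge_verts[of a b] by auto

lemma point_act_seg: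
  assumes "g \<in> carrier G" "a \<in> verts T" "b \<in> verts T"
  shows "point_act G T g (seg a b s) = seg (act T g a) (act T g b) s"
proof
  fix w
  have "act T (inv g) w = v \<longleftrightarrow> w = act T g v" if "w \<in> verts T" "v \<in> verts T" for v
    using that assms(1) act_inv act_inv' by metis
  then show "point_act G T g (seg a b s) w = seg (act T g a) (act T g b) s w"
    using assms act_verts by (auto simp: point_act_def seg_def)
qed

lemma point_act_realization: "g \<in> carrier G \<Longrightarrow> x \<in> realization T \<Longrightarrow> point_act G T g x \<in> realization T"
  by (erule realizationE) (simp add: point_act_seg seg_realization act_edge)

lemma weakly_open_iff:
  "weakly_open T U \<longleftrightarrow> U \<subseteq> realization T \<and>
     (\<forall>a b. {a, b} \<in> edges T \<longrightarrow> openin (top_of_set {0..1}) {s \<in> {0..1}. seg a b s \<in> U})"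
proof -
  have "(\<forall>e\<in>edges T. openin (top_of_set (cell e)) (U \<inter> cell e)) \<longleftrightarrow>
     (\<forall>a b. {a, b} \<in> edges T \<longrightarrow> openin (top_of_set {0..1}) {s \<in> {0..1}. seg a b s \<in> U})" (is "?L \<longleftrightarrow> ?R")
  proof
    assume L: ?L
    show ?R
    proof (intro allI impI)
      fix a b assume ab: "{a, b} \<in> edges T"
      then show "openin (top_of_set {0..1}) {s \<in> {0..1}. seg a b s \<in> U}"
        using L cell_open_iff[of a b U] edge_verts[OF ab] by blast
    qed
  next
    assume R: ?R
    show ?L
    proof
      fix e assume e: "e \<in> edges T"
      then obtain a b where "a \<noteq> b" "e = {a, b}" using edgeE by metis
      then show "openin (top_of_set (cell e)) (U \<inter> cell e)" using R e cell_open_iff[of a b U] by simp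
    qed
  qed
  then show ?thesis unfolding weakly_open_def by simp
qed

end

section \<open>Equivalence of free splittings\<close>

context
  fixes G :: "('a, 'm) monoid_scheme"
  assumes G: "group G"
begin

lemma equivariant_map_comp:
  "equivariant_map G S T f \<Longrightarrow> equivariant_map G T U h \<Longrightarrow> equivariant_map G S U (h \<circ> f)"
  unfolding equivariant_map_def by (auto simp: image_subset_iff)

lemma equivalent_refl: "equivalent_splittings G S S"
  unfolding equivalent_splittings_def
  by (rule exI[of _ id]) (simp add: equivariant_map_def)

lemma equivalent_trans:
  "equivalent_splittings G S T \<Longrightarrow> equivalent_splittings G T U \<Longrightarrow> equivalent_splittings G S U"
  unfolding equivalent_splittings_def using homeomorphic_map_compose equivariant_map_comp by blast

lemma equivalent_sym:
  assumes S: "free_splitting G S" and eq: "equivalent_splittings G S T"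
  shows "equivalent_splittings G T S"
proof -
  interpret S: splitting G S using S G by (simp add: splitting_def splitting_axioms_def)
  obtain f where f: "homeomorphic_map (tree_topology S) (tree_topology T) f" "equivariant_map G S T f"
    using eq unfolding equivalent_splittings_def by blast
  then obtain h where h: "homeomorphic_maps (tree_topology S) (tree_topology T) f h"
    unfolding homeomorphic_map_maps by blast
  then have hh: "homeomorphic_map (tree_topology T) (tree_topology S) h"
    and hf: "\<And>x. x \<in> realization S \<Longrightarrow> h (f x) = x" and fh: "\<And>y. y \<in> realization T \<Longrightarrow> f (h y) = y"
    unfolding homeomorphic_maps_map topspace_tree_topology by auto
  have him: "h ` realization T = realization S"
    using hh unfolding homeomorphic_map_def quotient_map_def topspace_tree_topology by blast
  have "equivariant_map G T S h"
    unfolding equivariant_map_def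
  proof (intro conjI ballI)
    fix g y assume g: "g \<in> carrier G" and y: "y \<in> realization T"
    have hy: "h y \<in> realization S" using him y by blast
    have "f (point_act G S g (h y)) = point_act G T g y"
      using f(2) g hy fh[OF y] unfolding equivariant_map_def by simp
    then show "h (point_act G T g y) = point_act G S g (h y)"
      using hf[OF S.point_act_realization[OF g hy]] by simp
  qed (use him in simp)
  with hh show ?thesis unfolding equivalent_splittings_def by blast
qed

text \<open>Two quotient maps with the same fibres differ by a homeomorphism of the quotients.\<close>

lemma collapse_unique:
  assumes S: "free_splitting G S"
    and f: "collapse_map_along G S T F f" and f': "collapse_map_along G S T' F f'"
  shows "equivalent_splittings G T T'"
proof -
  interpret S: splitting G S using S G by (simp add: splitting_def splitting_axioms_def)
  define h where "h y = f' (SOME x. x \<in> realization S \<and> f x = y)" for y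
  have q: "quotient_map (tree_topology S) (tree_topology T) f" "quotient_map (tree_topology S) (tree_topology T') f'"
    and e: "equivariant_map G S T f" "equivariant_map G S T' f'"
    and fib: "\<And>x y. x \<in> realization S \<Longrightarrow> y \<in> realization S \<Longrightarrow> f x = f y \<longleftrightarrow> f' x = f' y"
    using f f' unfolding collapse_map_along_def by auto
  have im: "f ` realization S = realization T" "f' ` realization S = realization T'"
    using q unfolding quotient_map_def topspace_tree_topology by auto
  have hf: "h (f x) = f' x" if x: "x \<in> realization S" for x
  proof -
    define x' where "x' = (SOME x'. x' \<in> realization S \<and> f x' = f x)"
    have "x' \<in> realization S \<and> f x' = f x" unfolding x'_def by (rule someI[of _ x]) (use x in simp)
    then show ?thesis using fib x unfolding h_def x'_def by blast
  qed
  have "quotient_map (tree_topology S) (tree_topology T') (h \<circ> f)"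
    by (rule quotient_map_eq[OF q(2)]) (simp add: topspace_tree_topology hf)
  then have "quotient_map (tree_topology T) (tree_topology T') h" using quotient_map_compose_eq[OF q(1)] by blast
  moreover have "inj_on h (realization T)"
    unfolding im(1)[symmetric] by (rule inj_onI) (use hf fib in auto)
  ultimately have "homeomorphic_map (tree_topology T) (tree_topology T') h"
    unfolding homeomorphic_map_def topspace_tree_topology by blast
  moreover have "equivariant_map G T T' h"
    unfolding equivariant_map_def
  proof (intro conjI ballI)
    show "h ` realization T \<subseteq> realization T'" unfolding im[symmetric] using hf by auto
    fix g y assume g: "g \<in> carrier G" and y: "y \<in> realization T"
    then obtain x where x: "x \<in> realization S" "y = f x" using im by blast
    have "h (point_act G T g y) = h (f (point_act G S g x))" using e(1) g x unfolding equivariant_map_def by simp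
    also have "\<dots> = point_act G T' g (f' x)" using hf[OF S.point_act_realization[OF g x(1)]] e(2) g x
      unfolding equivariant_map_def by simp
    finally show "h (point_act G T g y) = point_act G T' g (h y)" using hf x by simp
  qed
  ultimately show ?thesis unfolding equivalent_splittings_def by blast
qed

end

section \<open>Realizing collapses\<close>

locale collapse = S: splitting G S + T: splitting G T
  for G :: "('a, 'm) monoid_scheme" (structure) and S :: "('a, 'v) gtree" and T :: "('a, 'w) gtree" +
  fixes q
  assumes collapse: "simplicial_collapse G S T q"
begin

definition forest where "forest = {e \<in> edges S. collapsed q e}"

lemma forest_sub: "forest \<subseteq> edges S" by (auto simp: forest_def)

lemma q_verts: "q ` verts S = verts T" and q_act: "g \<in> carrier G \<Longrightarrow> v \<in> verts S \<Longrightarrow> q (act S g v) = act T g (q v)"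
  and T_edges: "edges T = {q ` e | e. e \<in> edges S \<and> \<not> collapsed q e}"
  and q_fibre: "u \<in> verts S \<Longrightarrow> v \<in> verts S \<Longrightarrow> q u = q v \<Longrightarrow> sep S u v \<subseteq> forest"
  using collapse unfolding simplicial_collapse_def forest_def by auto

lemma forest_inv: "g \<in> carrier G \<Longrightarrow> e \<in> forest \<Longrightarrow> act S g ` e \<in> forest"
proof -
  assume g: "g \<in> carrier G" and e: "e \<in> forest"
  have "e \<in> edges S" using e forest_sub by blast
  then obtain a b where ab: "a \<in> verts S" "b \<in> verts S" "e = {a, b}" using S.edgeE by metis
  then show ?thesis using g e S.act_edge[OF g] q_act by (auto simp: forest_def)
qed

lemma q_joined: "u \<in> verts S \<Longrightarrow> v \<in> verts S \<Longrightarrow> q u = q v \<longleftrightarrow> (u, v) \<in> joined forest"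
proof
  assume "u \<in> verts S" "v \<in> verts S" "(u, v) \<in> joined forest"
  from this(3) show "q u = q v" unfolding joined_def
    by (induction rule: rtrancl_induct) (auto simp: forest_def)
qed (use q_fibre S.joined_iff_sep[OF forest_sub] in blast)

lemma forest_proper: "forest \<subset> edges S"
proof -
  obtain e' where "e' \<in> edges T" using T.edges_nonempty by blast
  then obtain e where "e \<in> edges S" "\<not> collapsed q e" unfolding T_edges mem_Collect_eq by auto
  then have "e \<in> edges S" "e \<notin> forest" by (auto simp: forest_def)
  then show ?thesis using forest_sub by blast
qed

lemma q_edge: "{a, b} \<in> edges S \<Longrightarrow> q a \<noteq> q b \<Longrightarrow> {q a, q b} \<in> edges T"
  unfolding T_edges mem_Collect_eq by (rule exI[of _ "{a, b}"]) simp

lemma T_edgeE: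
  assumes "e' \<in> edges T"
  obtains a b where "{a, b} \<in> edges S" "q a \<noteq> q b" "e' = {q a, q b}"
proof -
  obtain e where e: "e \<in> edges S" "\<not> collapsed q e" "e' = q ` e"
    using assms unfolding T_edges mem_Collect_eq by auto
  then obtain a b where "e = {a, b}" using S.edgeE by metis
  then show thesis using that e by simp
qed

lemma realize_in: "x \<in> realization S \<Longrightarrow> realize q x \<in> realization T"
proof (erule S.realizationE)
  fix a b s assume A: "a \<in> verts S" "b \<in> verts S" "a \<noteq> b" "{a, b} \<in> edges S" "0 \<le> s" "s \<le> 1" "x = seg a b s"
  have "q a \<in> verts T" using A q_verts by blast
  then show ?thesis
    using A q_edge[of a b] T.seg_realization T.vertex_point_realization by (cases "q a = q b") (auto simp: realize_seg)
qed

lemma realize_surj: "realize q ` realization S = realization T"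
proof
  show "realize q ` realization S \<subseteq> realization T" using realize_in by blast
  show "realization T \<subseteq> realize q ` realization S"
  proof
    fix y assume "y \<in> realization T"
    then obtain c d s where A: "c \<noteq> d" "{c, d} \<in> edges T" "0 \<le> s" "s \<le> 1" "y = seg c d s" using T.realizationE by metis
    obtain a b where ab: "{a, b} \<in> edges S" "{c, d} = {q a, q b}" using T_edgeE A(2) by metis
    have "\<exists>a b. {a, b} \<in> edges S \<and> c = q a \<and> d = q b"
      using ab by (auto simp: doubleton_eq_iff) (metis insert_commute)
    then obtain a b where ab: "{a, b} \<in> edges S" "c = q a" "d = q b" by blast
    moreover have "a \<noteq> b" using ab A(1) by auto
    ultimately have "realize q (seg a b s) = y" using A by (simp add: realize_seg)
    then show "y \<in> realize q ` realization S" using S.seg_realization ab A by blast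
  qed
qed

lemma realize_equivariant: "equivariant_map G S T (realize q)"
  unfolding equivariant_map_def
proof (intro conjI ballI)
  show "realize q ` realization S \<subseteq> realization T" using realize_in by blast
  fix g x assume g: "g \<in> carrier G" and "x \<in> realization S"
  then obtain a b s where A: "a \<in> verts S" "b \<in> verts S" "a \<noteq> b" "x = seg a b s" using S.realizationE by metis
  moreover have "act S g a \<noteq> act S g b" "q a \<in> verts T" "q b \<in> verts T" using S.act_inj g A q_verts by auto
  ultimately show "realize q (point_act G S g x) = point_act G T g (realize q x)"
    using g by (simp add: S.point_act_seg T.point_act_seg realize_seg q_act)
qed

text \<open>Openness is tested on edges, where the map is constant or a parametrization-preserving bijection.\<close>

lemma realize_quotient: "quotient_map (tree_topology S) (tree_topology T) (realize q)"
  unfolding quotient_map_def topspace_tree_topology openin_tree_topology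
proof (intro conjI allI impI realize_surj)
  fix U assume U: "U \<subseteq> realization T"
  let ?V = "{x \<in> realization S. realize q x \<in> U}"
  have pre: "{s \<in> {0..1}. seg a b s \<in> ?V} = {s \<in> {0..1}. seg (q a) (q b) s \<in> U}" if "{a, b} \<in> edges S" for a b
    using that S.seg_realization S.edge_verts by (auto simp: realize_seg)
  show "weakly_open S ?V \<longleftrightarrow> weakly_open T U"
    unfolding S.weakly_open_iff T.weakly_open_iff
  proof (intro iffI conjI allI impI)
    fix a b
    assume "U \<subseteq> realization T \<and>
       (\<forall>a b. {a, b} \<in> edges T \<longrightarrow> openin (top_of_set {0..1}) {s \<in> {0..1}. seg a b s \<in> U})"
      and ab: "{a, b} \<in> edges S"
    then show "openin (top_of_set {0..1}) {s \<in> {0..1}. seg a b s \<in> ?V}"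
      unfolding pre[OF ab]
    proof (cases "q a = q b")
      case True
      then have "{s \<in> {0..1}. seg (q a) (q b) s \<in> U} = (if vertex_point (q a) \<in> U then {0..1} else {})" by auto
      then show "openin (top_of_set {0..1}) {s \<in> {0..1}. seg (q a) (q b) s \<in> U}" by simp
    qed (use q_edge[OF ab] in blast)
  next
    fix c d
    assume "?V \<subseteq> realization S \<and>
       (\<forall>a b. {a, b} \<in> edges S \<longrightarrow> openin (top_of_set {0..1}) {s \<in> {0..1}. seg a b s \<in> ?V})"
    then have V: "\<And>a b. {a, b} \<in> edges S \<Longrightarrow> openin (top_of_set {0..1}) {s \<in> {0..1}. seg (q a) (q b) s \<in> U}"
      using pre by simp
    assume "{c, d} \<in> edges T"
    then obtain a b where ab: "{a, b} \<in> edges S" "{c, d} = {q a, q b}" using T_edgeE by metis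
    have "\<exists>a b. {a, b} \<in> edges S \<and> c = q a \<and> d = q b"
      using ab by (auto simp: doubleton_eq_iff) (metis insert_commute)
    then show "openin (top_of_set {0..1}) {s \<in> {0..1}. seg c d s \<in> U}" using V by blast
  qed (use U in auto)
qed

text \<open>The components of the forest, seen by their edges and by their vertices.\<close>

lemma adjacent_chain:
  assumes "v \<in> e" "e \<in> forest" "w \<in> e'" "e' \<in> forest"
  shows "q v = q w \<longleftrightarrow> (e, e') \<in> {(d, d'). d \<in> forest \<and> d' \<in> forest \<and> d \<inter> d' \<noteq> {}}\<^sup>*" (is "_ \<longleftrightarrow> _ \<in> ?R\<^sup>*")
proof
  have const: "q x = q y" if "d \<in> forest" "x \<in> d" "y \<in> d" for d x y
  proof -
    have "d \<in> edges S" using \<open>d \<in> forest\<close> forest_sub by blast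
    then obtain a b where "d = {a, b}" using S.edgeE by metis
    then show ?thesis using that by (auto simp: forest_def)
  qed
  assume "(e, e') \<in> ?R\<^sup>*"
  then have "\<forall>w\<in>e'. q v = q w"
  proof (induction rule: rtrancl_induct)
    case base
    then show ?case using const assms by blast
  next
    case (step d d')
    then obtain z where z: "z \<in> d" "z \<in> d'" and dF: "d' \<in> forest" by blast
    show ?case
    proof
      fix w assume "w \<in> d'"
      then have "q z = q w" using const[OF dF] z by blast
      then show "q v = q w" using step.IH z by simp
    qed
  qed
  then show "q v = q w" using assms by blast
next
  assume "q v = q w"
  moreover have "v \<in> verts S" "w \<in> verts S" using assms forest_sub S.edge_sub by blast+
  ultimately have "(v, w) \<in> joined forest" using q_joined by simp
  then have "\<forall>e'\<in>forest. w \<in> e' \<longrightarrow> (e, e') \<in> ?R\<^sup>*"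
    unfolding joined_def
  proof (induction rule: rtrancl_induct)
    case base
    then show ?case using assms by blast
  next
    case (step y z)
    then have "(e, {y, z}) \<in> ?R\<^sup>*" "{y, z} \<in> forest" by auto
    then show ?case by (auto intro: rtrancl_into_rtrancl)
  qed
  then show "(e, e') \<in> ?R\<^sup>*" using assms by blast
qed

lemma realize_vertex:
  assumes "x \<in> realization S" "realize q x = vertex_point w"
  obtains v where "v \<in> verts S" "q v = w" "x = vertex_point v \<or> (\<exists>e\<in>forest. x \<in> cell e \<and> v \<in> e)"
proof -
  obtain a b s where A: "a \<in> verts S" "b \<in> verts S" "a \<noteq> b" "{a, b} \<in> edges S" "0 \<le> s" "s \<le> 1" "x = seg a b s"
    using S.realizationE assms(1) by metis
  show thesis
  proof (cases "q a = q b")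
    case True
    then have "q a = w" using A assms(2) by (simp add: realize_seg)
    moreover have "{a, b} \<in> forest" using True A by (simp add: forest_def)
    moreover have "x \<in> cell {a, b}" using seg_in_cell A by simp
    ultimately show thesis using that[of a] A by blast
  next
    case False
    then have "s = 0 \<and> w = q a \<or> s = 1 \<and> w = q b"
      using A assms(2) seg_eq_vertex_point[OF False] by (simp add: realize_seg)
    then show thesis using that[of a] that[of b] A by auto
  qed
qed

lemma forest_edge_at:
  assumes "u \<in> verts S" "v \<in> verts S" "q u = q v" "u \<noteq> v"
  obtains e where "e \<in> forest" "u \<in> e"
proof -
  have "(u, v) \<in> joined forest" using q_joined assms by simp
  then obtain w where "{u, w} \<in> forest" using assms(4) unfolding joined_def by (auto elim: converse_rtranclE)
  then show thesis using that by blast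
qed

lemma realize_fibre:
  assumes x: "x \<in> realization S" and y: "y \<in> realization S"
  shows "realize q x = realize q y \<longleftrightarrow> x = y \<or> same_component forest x y"
proof
  assume "x = y \<or> same_component forest x y"
  then show "realize q x = realize q y"
  proof
    assume "same_component forest x y"
    then obtain e e' where e: "e \<in> forest" "e' \<in> forest" "x \<in> cell e" "y \<in> cell e'"
      "(e, e') \<in> {(d, d'). d \<in> forest \<and> d' \<in> forest \<and> d \<inter> d' \<noteq> {}}\<^sup>*" unfolding same_component_def by blast
    have r: "\<exists>v\<in>d. realize q z = vertex_point (q v)" if "d \<in> forest" "z \<in> cell d" for d z
    proof -
      have "d \<in> edges S" using that forest_sub by blast
      then obtain a b s where "a \<noteq> b" "d = {a, b}" "z = seg a b s" using S.cellE \<open>z \<in> cell d\<close> by metis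
      moreover from this have "q a = q b" using that by (simp add: forest_def)
      ultimately show ?thesis by (auto simp: realize_seg)
    qed
    obtain v w where "v \<in> e" "w \<in> e'" "realize q x = vertex_point (q v)" "realize q y = vertex_point (q w)"
      using r e by metis
    then show ?thesis using adjacent_chain[of v e w e'] e by simp
  qed simp
next
  assume eq: "realize q x = realize q y"
  show "x = y \<or> same_component forest x y"
  proof (cases "\<exists>w. realize q x = vertex_point w")
    case True
    then obtain w where w: "realize q x = vertex_point w" "realize q y = vertex_point w" using eq by auto
    obtain u where u: "u \<in> verts S" "q u = w" "x = vertex_point u \<or> (\<exists>e\<in>forest. x \<in> cell e \<and> u \<in> e)"
      by (rule realize_vertex[OF x w(1)])
    obtain v where v: "v \<in> verts S" "q v = w" "y = vertex_point v \<or> (\<exists>e\<in>forest. y \<in> cell e \<and> v \<in> e)"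
      by (rule realize_vertex[OF y w(2)])
    have vp: "vertex_point z \<in> cell e" if "e \<in> forest" "z \<in> e" for z e
    proof -
      have "e \<in> edges S" using that(1) forest_sub by blast
      then obtain a b where "e = {a, b}" using S.edgeE by metis
      then show ?thesis using vertex_point_in_cell_iff[of e z] that by simp
    qed
    show ?thesis
    proof (cases "(\<exists>e\<in>forest. u \<in> e) \<and> (\<exists>e\<in>forest. v \<in> e)")
      case True
      obtain e where e: "e \<in> forest" "u \<in> e" "x \<in> cell e" using u(3) True vp by blast
      obtain e' where e': "e' \<in> forest" "v \<in> e'" "y \<in> cell e'" using v(3) True vp by blast
      have "q u = q v" using u v by simp
      then show ?thesis using adjacent_chain[of u e v e'] e e' unfolding same_component_def by blast
    next
      case False
      have "u = v"
      proof (rule ccontr)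
        assume "u \<noteq> v"
        then show False using False forest_edge_at[of u v] forest_edge_at[of v u] u v by metis
      qed
      then show ?thesis using False u v by blast
    qed
  next
    case False
    obtain a b s where A: "a \<in> verts S" "b \<in> verts S" "a \<noteq> b" "{a, b} \<in> edges S" "0 \<le> s" "s \<le> 1" "x = seg a b s"
      using S.realizationE x by metis
    obtain c d t where B: "c \<in> verts S" "d \<in> verts S" "c \<noteq> d" "{c, d} \<in> edges S" "0 \<le> t" "t \<le> 1" "y = seg c d t"
      using S.realizationE y by metis
    have rx: "realize q x = seg (q a) (q b) s" and ry: "realize q y = seg (q c) (q d) t"
      using A B by (auto simp: realize_seg)
    have ne: "q a \<noteq> q b" "q c \<noteq> q d" using False rx ry eq seg_self by metis+
    have st: "s \<noteq> 0" "s \<noteq> 1" "t \<noteq> 0" "t \<noteq> 1" using False rx ry eq seg_0 seg_1 by metis+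
    have "{w. seg (q a) (q b) s w \<noteq> 0} = {q a, q b}" "{w. seg (q c) (q d) t w \<noteq> 0} = {q c, q d}"
      using ne st by (auto simp: seg_def split: if_splits)
    then have "q ` {a, b} = q ` {c, d}" using eq rx ry by simp
    moreover have "{a, b} \<notin> forest" using ne by (simp add: forest_def)
    ultimately have "{a, b} = {c, d}" using S.q_inj_edges[OF forest_sub forest_inv q_joined A(4) B(4)] by blast
    then have "\<exists>t'. y = seg a b t'" using B(7) seg_swap[of c d] by (auto simp: doubleton_eq_iff)
    then obtain t' where t': "y = seg a b t'" by blast
    then have "seg (q a) (q b) s = seg (q a) (q b) t'" using rx eq A(3) by (simp add: realize_seg)
    then show ?thesis using seg_eq_iff[OF ne(1)] t' A by simp
  qed
qed

lemma collapse_map_realize: "collapse_map_along G S T forest (realize q)"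
  unfolding collapse_map_along_def
  using forest_proper forest_inv realize_equivariant realize_quotient realize_fibre by (auto simp: translate_def)

end

text \<open>Because of this factorization the collapses along increasing forests span a simplex.\<close>

lemma (in splitting) collapse_factor:
  assumes F: "F \<subseteq> edges T" "\<And>g e. g \<in> carrier G \<Longrightarrow> e \<in> F \<Longrightarrow> act T g ` e \<in> F"
    and q: "\<And>u v. u \<in> verts T \<Longrightarrow> v \<in> verts T \<Longrightarrow> q u = q v \<longleftrightarrow> (u, v) \<in> joined F"
    and F': "F' \<subseteq> edges T" "\<And>g e. g \<in> carrier G \<Longrightarrow> e \<in> F' \<Longrightarrow> act T g ` e \<in> F'"
    and q': "\<And>u v. u \<in> verts T \<Longrightarrow> v \<in> verts T \<Longrightarrow> q' u = q' v \<longleftrightarrow> (u, v) \<in> joined F'"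
    and FF': "F \<subseteq> F'"
  obtains r where "simplicial_collapse G (collapse_tree T q) (collapse_tree T q') r"
proof -
  note A = F q and B = F' q'
  define r where "r w = q' (SOME v. v \<in> verts T \<and> q v = w)" for w
  have r: "r (q v) = q' v" if v: "v \<in> verts T" for v
  proof -
    define u where "u = (SOME u. u \<in> verts T \<and> q u = q v)"
    have "u \<in> verts T \<and> q u = q v" unfolding u_def by (rule someI[of _ v]) (use v in simp)
    then show ?thesis using q q' v joined_mono[OF FF'] unfolding r_def u_def by blast
  qed
  have rim: "r ` q ` e = q' ` e" if "e \<in> edges T" for e
    unfolding image_image by (rule image_cong) (use r edge_sub that in auto)
  have col: "collapsed r (q ` e) \<longleftrightarrow> e \<in> F'" if "e \<in> edges T" for e
    using rim[OF that] collapsed_iff[OF B that] unfolding collapsed_def by simp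
  have "simplicial_collapse G (collapse_tree T q) (collapse_tree T q') r"
    unfolding simplicial_collapse_def
  proof (intro conjI ballI impI)
    show "r ` verts (collapse_tree T q) = verts (collapse_tree T q')"
      unfolding collapse_tree_def gtree.simps image_image by (rule image_cong) (use r in auto)
    show "r (act (collapse_tree T q) g w) = act (collapse_tree T q') g (r w)"
      if g: "g \<in> carrier G" and w: "w \<in> verts (collapse_tree T q)" for g w
    proof -
      obtain v where "v \<in> verts T" "w = q v" using w by (auto simp: collapse_tree_def)
      then show ?thesis using act'[OF A g] act'[OF B g] r act_verts g by simp
    qed
    show "edges (collapse_tree T q') = {r ` e |e. e \<in> edges (collapse_tree T q) \<and> \<not> collapsed r e}" (is "?L = ?R")
    proof
      show "?L \<subseteq> ?R"
      proof
        fix d assume "d \<in> ?L"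
        then obtain e where e: "e \<in> edges T" "e \<notin> F'" "d = q' ` e" using edges'E[OF B] by metis
        then have "q ` e \<in> edges (collapse_tree T q)" "\<not> collapsed r (q ` e)" "d = r ` q ` e"
          using edges'I[OF A] FF' col rim by auto
        then show "d \<in> ?R" by blast
      qed
      show "?R \<subseteq> ?L"
      proof
        fix d assume "d \<in> ?R"
        then obtain e1 where e1: "d = r ` e1" "e1 \<in> edges (collapse_tree T q)" "\<not> collapsed r e1" by blast
        then obtain e where e: "e \<in> edges T" "e \<notin> F" "e1 = q ` e" using edges'E[OF A] by metis
        then have "e \<notin> F'" "d = q' ` e" using col rim e1 by auto
        then show "d \<in> ?L" using edges'I[OF B] e by simp
      qed
    qed
    fix x y assume "x \<in> verts (collapse_tree T q)" "y \<in> verts (collapse_tree T q)" and eq: "r x = r y"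
    then obtain u v where uv: "u \<in> verts T" "v \<in> verts T" "x = q u" "y = q v" by (auto simp: collapse_tree_def)
    interpret T': tree "collapse_tree T q" by unfold_locales (rule tree_collapse[OF A])
    have sub: "sep T u v \<subseteq> F'" using eq uv r q_eq_iff[OF B] by simp
    show "sep (collapse_tree T q) x y \<subseteq> {e \<in> edges (collapse_tree T q). collapsed r e}"
    proof
      fix d assume d: "d \<in> sep (collapse_tree T q) x y"
      then have dE: "d \<in> edges (collapse_tree T q)"
        using T'.sep_edges[of x y] uv by (auto simp: collapse_tree_def)
      then obtain e where e: "e \<in> edges T" "e \<notin> F" "d = q ` e" using edges'E[OF A] by metis
      then have "e \<in> sep T u v" using sep_collapse[OF A e(1,2)] d uv by simp
      then show "d \<in> {e \<in> edges (collapse_tree T q). collapsed r e}" using sub col e dE by auto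
    qed
  qed
  then show thesis using that by blast
qed

section \<open>Natural edges\<close>

context splitting
begin

lemma nonnatural_stab:
  "v \<in> verts T \<Longrightarrow> \<not> natural_vertex G T v \<Longrightarrow> g \<in> carrier G \<Longrightarrow> act T g v = v \<Longrightarrow> g = \<one>"
  unfolding natural_vertex_def stabilizer_def by auto

lemma nonnatural_two:
  assumes "v \<in> verts T" "\<not> natural_vertex G T v"
    and e: "{v, a} \<in> edges T" "{v, b} \<in> edges T" "{v, c} \<in> edges T" "a \<noteq> b"
  shows "c = a \<or> c = b"
proof (rule ccontr)
  assume "\<not> (c = a \<or> c = b)"
  then have "card {{v, a}, {v, b}, {v, c}} = 3" using e edge_verts by (auto simp: doubleton_eq_iff)
  moreover have "{{v, a}, {v, b}, {v, c}} \<subseteq> {e \<in> edges T. v \<in> e}" using e by auto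
  ultimately have "infinite {e \<in> edges T. v \<in> e} \<or> 3 \<le> card {e \<in> edges T. v \<in> e}" by (metis card_mono)
  then show False using assms(1,2) unfolding natural_vertex_def by blast
qed

lemma conj_cancel:
  assumes "g \<in> carrier G" "h \<in> carrier G"
  shows "g \<otimes> (inv g \<otimes> h \<otimes> g) \<otimes> inv g = h"
proof -
  have "g \<otimes> (inv g \<otimes> h \<otimes> g) \<otimes> inv g = (g \<otimes> inv g) \<otimes> h \<otimes> (g \<otimes> inv g)"
    using assms by (simp only: m_assoc m_closed inv_closed)
  then show ?thesis using assms by simp
qed

lemma stabilizer_act:
  assumes g: "g \<in> carrier G" and v: "v \<in> verts T"
  shows "stabilizer G (act T) (act T g v) = g <# stabilizer G (act T) v #> inv g"
proof
  show "stabilizer G (act T) (act T g v) \<subseteq> g <# stabilizer G (act T) v #> inv g"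
  proof
    fix h assume "h \<in> stabilizer G (act T) (act T g v)"
    then have h: "h \<in> carrier G" "act T h (act T g v) = act T g v" by (auto simp: stabilizer_def)
    define k where "k = inv g \<otimes> h \<otimes> g"
    have k: "k \<in> carrier G" using g h by (simp add: k_def)
    have "act T k v = v" using g h v act_mult act_inv act_verts by (simp add: k_def)
    moreover have "h = g \<otimes> k \<otimes> inv g" using conj_cancel[OF g h(1)] by (simp add: k_def)
    ultimately show "h \<in> g <# stabilizer G (act T) v #> inv g"
      unfolding l_coset_def r_coset_def stabilizer_def using k by blast
  qed
  show "g <# stabilizer G (act T) v #> inv g \<subseteq> stabilizer G (act T) (act T g v)"
  proof
    fix h assume "h \<in> g <# stabilizer G (act T) v #> inv g"
    then obtain k where k: "k \<in> carrier G" "act T k v = v" "h = g \<otimes> k \<otimes> inv g"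
      unfolding l_coset_def r_coset_def stabilizer_def by blast
    have "act T h (act T g v) = act T (g \<otimes> k) (act T (inv g) (act T g v))"
      unfolding k(3) using g k v act_verts by (intro act_mult) simp_all
    also have "\<dots> = act T g v" using g k v act_mult[of g k v] act_inv by simp
    finally show "h \<in> stabilizer G (act T) (act T g v)" using g k by (simp add: stabilizer_def)
  qed
qed

lemma natural_vertex_act:
  assumes g: "g \<in> carrier G" and v: "v \<in> verts T"
  shows "natural_vertex G T (act T g v) \<longleftrightarrow> natural_vertex G T v"
proof -
  have *: "natural_vertex G T (act T g v)" if g: "g \<in> carrier G" and v: "v \<in> verts T" and n: "natural_vertex G T v" for g v
  proof -
    have inj: "inj_on ((`) (act T g)) {e \<in> edges T. v \<in> e}"
      using gset_inj_on[OF gset_edges g] by (rule inj_on_subset) auto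
    have sub: "(`) (act T g) ` {e \<in> edges T. v \<in> e} \<subseteq> {e \<in> edges T. act T g v \<in> e}"
      using act_edge_set[OF g] by auto
    have st: "stabilizer G (act T) (act T g v) \<noteq> {\<one>}" if ntr: "stabilizer G (act T) v \<noteq> {\<one>}"
    proof
      assume t: "stabilizer G (act T) (act T g v) = {\<one>}"
      have "\<one> \<in> stabilizer G (act T) v" using v act_one by (simp add: stabilizer_def)
      then obtain k where k: "k \<in> stabilizer G (act T) v" "k \<noteq> \<one>" using ntr by blast
      then have kc: "k \<in> carrier G" by (simp add: stabilizer_def)
      have "g \<otimes> k \<otimes> inv g \<in> g <# stabilizer G (act T) v #> inv g"
        unfolding l_coset_def r_coset_def using k(1) by auto
      then have "g \<otimes> k \<otimes> inv g \<in> {\<one>}" unfolding stabilizer_act[OF g v, symmetric] t .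
      then have h1: "g \<otimes> k \<otimes> inv g = \<one>" by simp
      have "inv g \<otimes> (g \<otimes> k \<otimes> inv g) \<otimes> g = k"
        using conj_cancel[of "inv g" k] g kc by simp
      then have "inv g \<otimes> \<one> \<otimes> g = k" unfolding h1 .
      then show False using g k(2) by simp
    qed
    show ?thesis
    proof (cases "stabilizer G (act T) v \<noteq> {\<one>}")
      case True
      then show ?thesis using st act_verts[OF g v] by (simp add: natural_vertex_def)
    next
      case False
      then consider "infinite {e \<in> edges T. v \<in> e}" | "3 \<le> card {e \<in> edges T. v \<in> e}"
        using n by (auto simp: natural_vertex_def)
      then have "infinite {e \<in> edges T. act T g v \<in> e} \<or> 3 \<le> card {e \<in> edges T. act T g v \<in> e}"
      proof cases
        case 1
        then have "infinite ((`) (act T g) ` {e \<in> edges T. v \<in> e})" using inj finite_imageD by blast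
        then show ?thesis using infinite_super[OF sub] by blast
      next
        case 2
        have "card {e \<in> edges T. v \<in> e} \<le> card {e \<in> edges T. act T g v \<in> e}"
          if "finite {e \<in> edges T. act T g v \<in> e}"
          using card_mono[OF that sub] card_image[OF inj] by simp
        then show ?thesis using 2 by linarith
      qed
      then show ?thesis using act_verts[OF g v] by (simp add: natural_vertex_def)
    qed
  qed
  show ?thesis using *[OF g v] *[of "inv g" "act T g v"] g v act_inv act_verts by auto
qed

abbreviation link where "link \<equiv> natural_link G T"

lemma link_sym: "sym (link\<^sup>*)"
  by (rule sym_rtrancl) (auto simp: natural_link_def sym_def)

lemma linkI: "e \<in> edges T \<Longrightarrow> e' \<in> edges T \<Longrightarrow> v \<in> e \<Longrightarrow> v \<in> e' \<Longrightarrow> \<not> natural_vertex G T v \<Longrightarrow> (e, e') \<in> link"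
  unfolding natural_link_def by blast

lemma link_edges: "(e, d) \<in> link\<^sup>* \<Longrightarrow> e \<in> edges T \<Longrightarrow> d \<in> edges T"
  by (induction rule: rtrancl_induct) (auto simp: natural_link_def)

lemma natural_edge_class: "E \<in> natural_edges G T \<Longrightarrow> e \<in> E \<Longrightarrow> E = link\<^sup>* `` {e}"
proof -
  assume E: "E \<in> natural_edges G T" and e: "e \<in> E"
  then obtain d where d: "E = link\<^sup>* `` {d}" unfolding natural_edges_def by auto
  then have "(d, e) \<in> link\<^sup>*" "(e, d) \<in> link\<^sup>*" using e link_sym by (auto dest: symD)
  then show ?thesis unfolding d by (auto intro: rtrancl_trans)
qed

lemma natural_edge_sub: "E \<in> natural_edges G T \<Longrightarrow> E \<subseteq> edges T"
  unfolding natural_edges_def using link_edges by auto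

lemma natural_edge_nonempty: "E \<in> natural_edges G T \<Longrightarrow> E \<noteq> {}"
  unfolding natural_edges_def by auto

lemma natural_edge_of: "e \<in> edges T \<Longrightarrow> link\<^sup>* `` {e} \<in> natural_edges G T"
  unfolding natural_edges_def by auto

lemma link_act:
  assumes g: "g \<in> carrier G" and "(e, d) \<in> link\<^sup>*"
  shows "(act T g ` e, act T g ` d) \<in> link\<^sup>*"
  using assms(2)
proof (induction rule: rtrancl_induct)
  case (step d d')
  then obtain v where v: "d \<in> edges T" "d' \<in> edges T" "v \<in> d" "v \<in> d'" "\<not> natural_vertex G T v"
    unfolding natural_link_def by blast
  then have "v \<in> verts T" using edge_sub by blast
  then have "(act T g ` d, act T g ` d') \<in> link"
    using linkI[of "act T g ` d" "act T g ` d'" "act T g v"] act_edge_set[OF g] natural_vertex_act[OF g] v by simp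
  then show ?case using step.IH by (rule rtrancl_into_rtrancl[rotated])
qed auto

lemma translate_natural:
  assumes g: "g \<in> carrier G" and e: "e \<in> edges T"
  shows "translate T g (link\<^sup>* `` {e}) = link\<^sup>* `` {act T g ` e}"
proof
  show "translate T g (link\<^sup>* `` {e}) \<subseteq> link\<^sup>* `` {act T g ` e}"
    unfolding translate_def using link_act[OF g] by auto
  show "link\<^sup>* `` {act T g ` e} \<subseteq> translate T g (link\<^sup>* `` {e})"
  proof
    fix d assume "d \<in> link\<^sup>* `` {act T g ` e}"
    then have d: "(act T g ` e, d) \<in> link\<^sup>*" by simp
    have ig: "inv g \<in> carrier G" using g by simp
    have "(e, act T (inv g) ` d) \<in> link\<^sup>*" using link_act[OF ig d] gset_inv[OF gset_edges g e] by simp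
    moreover have "d \<in> edges T" using link_edges[OF d] act_edge_set[OF g e] by simp
    then have "d = act T g ` act T (inv g) ` d" using gset_inv'[OF gset_edges g] by simp
    ultimately show "d \<in> translate T g (link\<^sup>* `` {e})" unfolding translate_def by blast
  qed
qed

lemma gset_natural: "gset G (natural_edges G T) (translate T)"
  unfolding gset_def
proof (intro conjI ballI)
  show "translate T g E \<in> natural_edges G T" if g: "g \<in> carrier G" and E: "E \<in> natural_edges G T" for g E
  proof -
    obtain e where "e \<in> edges T" "E = link\<^sup>* `` {e}" using E unfolding natural_edges_def by blast
    then show ?thesis using translate_natural[OF g] natural_edge_of act_edge_set[OF g] by simp
  qed
  fix E assume "E \<in> natural_edges G T"
  then have E: "E \<subseteq> edges T" by (rule natural_edge_sub)
  have "(`) (act T \<one>) ` E = (\<lambda>e. e) ` E"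
    by (rule image_cong) (use gset_one[OF gset_edges] E in blast)+
  then show "translate T \<one> E = E" by (simp add: translate_def)
  fix g h assume gh: "g \<in> carrier G" "h \<in> carrier G"
  have "(`) (act T (g \<otimes> h)) ` E = (\<lambda>e. act T g ` act T h ` e) ` E"
    by (rule image_cong) (use gset_mult[OF gset_edges gh] E in blast)+
  then show "translate T (g \<otimes> h) E = translate T g (translate T h E)"
    by (simp add: translate_def image_image)
qed

lemma act_image_natural:
  assumes "E \<in> natural_edges G T" "E' \<in> natural_edges G T" "g \<in> carrier G" "e \<in> E" "act T g ` e \<in> E'"
  shows "translate T g E = E'"
proof -
  have "e \<in> edges T" using assms natural_edge_sub by blast
  then show ?thesis
    using natural_edge_class[OF assms(1,4)] natural_edge_class[OF assms(2,5)] translate_natural[OF assms(3)] by simp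
qed

text \<open>The paths that stay inside one natural edge.\<close>

definition thin :: "'v list \<Rightarrow> bool" where
  "thin p \<longleftrightarrow> edge_path T p \<and> (\<forall>i. 0 < i \<and> Suc i < length p \<longrightarrow> \<not> natural_vertex G T (p ! i))"

lemma thin_props:
  assumes "thin p"
  shows "i < length p \<Longrightarrow> p ! i \<in> verts T" "Suc i < length p \<Longrightarrow> {p ! i, p ! Suc i} \<in> edges T"
    "0 < i \<Longrightarrow> Suc i < length p \<Longrightarrow> \<not> natural_vertex G T (p ! i)"
    "i < length p \<Longrightarrow> j < length p \<Longrightarrow> p ! i = p ! j \<longleftrightarrow> i = j"
  using assms edge_path_distinct nth_eq_iff_index_eq unfolding thin_def edge_path_iff_nth
  by (auto simp: nth_eq_iff_index_eq dest: edge_path_distinct)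

text \<open>Translates of the interior of a thin path that is shifted along itself form a set of vertices
  closed under adjacency, hence all vertices are not natural.\<close>

lemma thin_shift:
  assumes p: "thin p" and ij: "i < j" "Suc j < length p" and g: "g \<in> carrier G"
    and gi: "act T g (p ! i) = p ! j" "act T g (p ! Suc i) = p ! Suc j" and v: "v \<in> verts T"
  shows "\<not> natural_vertex G T v"
proof -
  define W where "W = {act T h (p ! m) | h m. h \<in> carrier G \<and> i < m \<and> m \<le> j}"
  have WI: "act T h (p ! m) \<in> W" if "h \<in> carrier G" "i < m" "m \<le> j" for h m
    unfolding W_def using that by blast
  have pW: "p ! m \<in> W" if "i < m" "m \<le> j" for m
    using WI[of \<one> m] act_one thin_props(1)[OF p, of m] that ij by simp
  have Wact: "act T h w \<in> W" if w: "w \<in> W" and h: "h \<in> carrier G" for w h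
  proof -
    obtain k m where "w = act T k (p ! m)" "k \<in> carrier G" "i < m" "m \<le> j" using w unfolding W_def by blast
    then show ?thesis using WI[of "h \<otimes> k" m] act_mult[of h k "p ! m"] thin_props(1)[OF p, of m] h ij by simp
  qed
  have nat: "\<not> natural_vertex G T w" if w: "w \<in> W" for w
  proof -
    obtain h m where h: "w = act T h (p ! m)" "h \<in> carrier G" "i < m" "m \<le> j" using w unfolding W_def by blast
    then show ?thesis using natural_vertex_act[OF h(2), of "p ! m"] thin_props(1,3)[OF p, of m] ij by simp
  qed
  have pi: "p ! i \<in> W"
  proof -
    have "act T (inv g) (act T g (p ! i)) = p ! i" using thin_props(1)[OF p, of i] ij by (intro act_inv[OF g]) simp
    then have "act T (inv g) (p ! j) = p ! i" unfolding gi(1) .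
    then show ?thesis using Wact[OF pW[of j], of "inv g"] ij g by simp
  qed
  have pj: "p ! Suc j \<in> W" using Wact[OF pW[of "Suc i"] g] gi ij by simp
  have nb: "c \<in> W" if m: "i < m" "m \<le> j" and c: "{p ! m, c} \<in> edges T" for m c
  proof -
    obtain l where l: "m = Suc l" using m by (cases m) auto
    have "c = p ! l \<or> c = p ! Suc m"
    proof (rule nonnatural_two[OF _ _ _ _ c])
      show "p ! m \<in> verts T" "\<not> natural_vertex G T (p ! m)" using thin_props(1,3)[OF p] m ij by auto
      show "{p ! m, p ! l} \<in> edges T" "{p ! m, p ! Suc m} \<in> edges T"
        using thin_props(2)[OF p, of l] thin_props(2)[OF p, of m] m ij l by (auto simp: insert_commute)
      show "p ! l \<noteq> p ! Suc m" using thin_props(4)[OF p, of l "Suc m"] m ij l by simp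
    qed
    moreover have "p ! l \<in> W" using pi pW[of l] l m by (cases "l = i") auto
    moreover have "p ! Suc m \<in> W" using pj pW[of "Suc m"] m by (cases "m = j") auto
    ultimately show ?thesis by blast
  qed
  have "p ! j \<in> verts T" using thin_props(1)[OF p, of j] ij by simp
  then have "v \<in> W" using v
  proof (induction rule: walk_induct)
    case (step x y)
    then obtain h m where h: "x = act T h (p ! m)" "h \<in> carrier G" "i < m" "m \<le> j" unfolding W_def by blast
    have pm: "p ! m \<in> verts T" using thin_props(1)[OF p, of m] h ij by simp
    have "{p ! m, act T (inv h) y} \<in> edges T"
      using act_edge[of "inv h" x y] act_inv[OF h(2) pm] step h by simp
    then have "act T (inv h) y \<in> W" using nb h by blast
    then have "act T h (act T (inv h) y) \<in> W" using Wact h by blast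
    then show ?case using act_inv'[OF h(2)] step by simp
  qed (use ij pW in auto)
  then show ?thesis by (rule nat)
qed

text \<open>A thin path is not reversed onto itself either, since the midpoint would be an inverted edge or
  an interior vertex with nontrivial stabilizer.\<close>

lemma thin_no_flip:
  assumes p: "thin p" and g: "g \<in> carrier G"
  shows "i \<le> j \<Longrightarrow> Suc j < length p \<Longrightarrow> act T g (p ! i) = p ! Suc j \<Longrightarrow> act T g (p ! Suc i) = p ! j \<Longrightarrow> False"
proof (induction "j - i" arbitrary: i j rule: less_induct)
  case less
  have V: "p ! i \<in> verts T" "p ! Suc i \<in> verts T" using thin_props(1)[OF p] less.prems by auto
  consider "i = j" | "j = Suc i" | "Suc (Suc i) \<le> j" using less.prems(1) by linarith
  then show False
  proof cases
    case 1
    have e: "{p ! i, p ! Suc i} \<in> edges T" using thin_props(2)[OF p, of i] less.prems by simp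
    have "act T g ` {p ! i, p ! Suc i} = {p ! i, p ! Suc i}" using 1 less.prems by auto
    then have "g = \<one>" using edge_stab[OF g e] by simp
    then have "p ! i = p ! Suc i" using act_one[OF V(1)] 1 less.prems by simp
    then show False using thin_props(4)[OF p, of i "Suc i"] less.prems by simp
  next
    case 2
    then have "act T g (p ! Suc i) = p ! Suc i" using less.prems by simp
    then have "g = \<one>" using nonnatural_stab[OF V(2) _ g] thin_props(3)[OF p, of "Suc i"] 2 less.prems by simp
    then have "p ! i = p ! Suc j" using act_one[OF V(1)] less.prems by simp
    then show False using thin_props(4)[OF p, of i "Suc j"] less.prems by simp
  next
    case 3
    then obtain k where k: "j = Suc k" "Suc i \<le> k" by (cases j) auto
    have V2: "p ! Suc (Suc i) \<in> verts T" using thin_props(1)[OF p] 3 less.prems by auto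
    have "{act T g (p ! Suc i), act T g (p ! Suc (Suc i))} \<in> edges T"
      by (rule act_edge[OF g]) (use thin_props(2)[OF p, of "Suc i"] 3 less.prems in simp)
    then have e: "{p ! j, act T g (p ! Suc (Suc i))} \<in> edges T" using less.prems by simp
    have "act T g (p ! Suc (Suc i)) = p ! k \<or> act T g (p ! Suc (Suc i)) = p ! Suc j"
    proof (rule nonnatural_two[OF _ _ _ _ e])
      show "p ! j \<in> verts T" "\<not> natural_vertex G T (p ! j)" using thin_props(1,3)[OF p] 3 less.prems by auto
      show "{p ! j, p ! k} \<in> edges T" "{p ! j, p ! Suc j} \<in> edges T"
        using thin_props(2)[OF p, of k] thin_props(2)[OF p, of j] less.prems k by (auto simp: insert_commute)
      show "p ! k \<noteq> p ! Suc j" using thin_props(4)[OF p, of k "Suc j"] less.prems k by simp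
    qed
    moreover have "act T g (p ! Suc (Suc i)) \<noteq> p ! Suc j"
    proof
      assume "act T g (p ! Suc (Suc i)) = p ! Suc j"
      then have "p ! Suc (Suc i) = p ! i" using act_inj[OF g V2 V(1)] less.prems by simp
      then show False using thin_props(4)[OF p, of "Suc (Suc i)" i] 3 less.prems by simp
    qed
    ultimately have "act T g (p ! Suc (Suc i)) = p ! k" by blast
    moreover have "k - Suc i < j - i" using k by linarith
    ultimately show False using less.hyps[of k "Suc i"] k less.prems by simp
  qed
qed

context
  assumes natural: "\<exists>v\<in>verts T. natural_vertex G T v"
begin

text \<open>The two preceding lemmas treat the two ways in which the ends of the edges can correspond.\<close>

lemma thin_inequivalent:
  assumes p: "thin p" and ij: "Suc i < length p" "Suc j < length p" and g: "g \<in> carrier G"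
    and eq: "act T g ` {p ! i, p ! Suc i} = {p ! j, p ! Suc j}"
  shows "i = j"
proof -
  have le: False if ij: "i < j" "Suc j < length p" and g: "g \<in> carrier G"
    and eq: "act T g ` {p ! i, p ! Suc i} = {p ! j, p ! Suc j}" for i j g
  proof -
    have "act T g (p ! i) = p ! j \<and> act T g (p ! Suc i) = p ! Suc j \<or>
          act T g (p ! i) = p ! Suc j \<and> act T g (p ! Suc i) = p ! j"
      using eq by (auto simp: doubleton_eq_iff)
    then show False
      using thin_shift[OF p ij g] thin_no_flip[OF p g, of i j] ij natural by auto
  qed
  have e: "{p ! i, p ! Suc i} \<in> edges T" using thin_props(2)[OF p] ij by blast
  have "act T (inv g) ` {p ! j, p ! Suc j} = {p ! i, p ! Suc i}"
    using gset_inv[OF gset_edges g e] unfolding eq .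
  then show ?thesis using le[of i j g] le[of j i "inv g"] ij g eq by (metis inv_closed linorder_neqE_nat)
qed

lemma thin_bounded:
  assumes "thin p"
  shows "length p \<le> Suc (card (orbits G (edges T) (\<lambda>g. (`) (act T g))))"
proof -
  let ?a = "\<lambda>g. (`) (act T g)"
  define f where "f i = orbit G ?a {p ! i, p ! Suc i}" for i
  have "inj_on f {..<length p - 1}"
  proof (rule inj_onI)
    fix i j assume ij: "i \<in> {..<length p - 1}" "j \<in> {..<length p - 1}" "f i = f j"
    then have e: "{p ! i, p ! Suc i} \<in> edges T" "{p ! j, p ! Suc j} \<in> edges T" using thin_props(2)[OF assms] by auto
    then have "{p ! j, p ! Suc j} \<in> orbit G ?a {p ! i, p ! Suc i}"
      using gset_orbit_refl[OF gset_edges e(2)] ij unfolding f_def by simp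
    then obtain g where "g \<in> carrier G" "act T g ` {p ! i, p ! Suc i} = {p ! j, p ! Suc j}"
      unfolding orbit_def by auto
    then show "i = j" using thin_inequivalent[OF assms] ij by simp
  qed
  moreover have "f ` {..<length p - 1} \<subseteq> orbits G (edges T) ?a"
    unfolding f_def orbits_def using thin_props(2)[OF assms] by auto
  ultimately have "card {..<length p - 1} \<le> card (orbits G (edges T) ?a)"
    using card_inj_on_le finite_edge_orbits by blast
  then show ?thesis by simp
qed

lemma thin_rev: "thin p \<Longrightarrow> thin (rev p)"
  unfolding thin_def by (auto simp: edge_path_rev rev_nth)

text \<open>A natural edge is the edge set of a longest thin path: at a non-natural end such a path could be
  extended.\<close>

lemma natural_edge_thin:
  assumes E: "E \<in> natural_edges G T"
  obtains p where "thin p" "E = path_edges p"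
proof -
  obtain e where e: "e \<in> edges T" "E = link\<^sup>* `` {e}" using E unfolding natural_edges_def by blast
  obtain a b where ab: "a \<in> verts T" "b \<in> verts T" "a \<noteq> b" "e = {a, b}" using edgeE[OF e(1)] by metis
  have bnd: "\<forall>p. thin p \<and> e \<in> path_edges p \<longrightarrow> length p < Suc (Suc (card (orbits G (edges T) (\<lambda>g. (`) (act T g)))))"
    using thin_bounded by (simp add: less_Suc_eq_le)
  have "thin [a, b] \<and> e \<in> path_edges [a, b]"
    using ab e by (auto simp: thin_def edge_path_def path_edges_Cons less_Suc_eq)
  then have "\<exists>p. (thin p \<and> e \<in> path_edges p) \<and> (\<forall>p'. thin p' \<and> e \<in> path_edges p' \<longrightarrow> length p' \<le> length p)"
    by (rule ex_has_greatest_nat[OF _ bnd])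
  then obtain p where p: "thin p" "e \<in> path_edges p"
    and max: "\<And>p'. thin p' \<Longrightarrow> e \<in> path_edges p' \<Longrightarrow> length p' \<le> length p" by blast
  have ext: "c = p' ! (length p' - 2)"
    if p': "thin p'" "e \<in> path_edges p'" "length p' = length p"
      and c: "{last p', c} \<in> edges T" "\<not> natural_vertex G T (last p')" for p' c
  proof (rule ccontr)
    assume ne: "c \<noteq> p' ! (length p' - 2)"
    have p'0: "p' \<noteq> []" using p'(1) by (auto simp: thin_def edge_path_def)
    have "edge_path T (p' @ [c])"
      by (rule edge_path_snoc) (use p' c ne edge_verts in \<open>auto simp: thin_def\<close>)
    moreover have "\<not> natural_vertex G T ((p' @ [c]) ! i)" if "0 < i" "Suc i < length (p' @ [c])" for i
    proof (cases "Suc i < length p'")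
      case True
      then show ?thesis using p' that by (simp add: thin_def nth_append)
    next
      case False
      then have "i = length p' - 1" using that by simp
      then show ?thesis using c(2) p'0 by (simp add: nth_append last_conv_nth)
    qed
    ultimately have "thin (p' @ [c])" by (simp add: thin_def)
    moreover have "e \<in> path_edges (p' @ [c])" using p' p'0 by (simp add: path_edges_append)
    ultimately have "length (p' @ [c]) \<le> length p" using max by blast
    then show False using p' by simp
  qed
  have p0: "p \<noteq> []" using p(1) by (auto simp: thin_def edge_path_def)
  have closed: "d' \<in> path_edges p" if d: "d \<in> path_edges p" "(d, d') \<in> link" for d d'
  proof -
    obtain v where v: "v \<in> d" "v \<in> d'" "\<not> natural_vertex G T v" "d' \<in> edges T"
      using d unfolding natural_link_def by blast
    obtain a b where "d' = {a, b}" using edgeE[OF v(4)] by metis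
    then have "d' = {v, if v = a then b else a}" using v(2) by auto
    then obtain c where c: "d' = {v, c}" "{v, c} \<in> edges T" using v(4) by metis
    have "v \<in> set p" using path_edges_mem[OF d(1) v(1)] .
    then obtain k where k: "k < length p" "v = p ! k" by (metis in_set_conv_nth)
    have l2: "length p \<ge> 2" using d by (auto simp: path_edges_def)
    consider "k = 0" | "Suc k = length p" | "0 < k" "Suc k < length p" using k by linarith
    then show ?thesis
    proof cases
      case 1
      have "c = rev p ! (length (rev p) - 2)"
        by (rule ext[OF thin_rev[OF p(1)]])
          (use p(2) c(2) v(3) k 1 p0 in \<open>auto simp: path_edges_rev last_rev hd_conv_nth\<close>)
      then have "c = p ! Suc 0" using l2 by (simp add: rev_nth)
      then show ?thesis using c k 1 l2 unfolding path_edges_def by auto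
    next
      case 2
      have "last p = v" using k 2 p0 by (metis diff_Suc_1 last_conv_nth)
      then have "c = p ! (length p - 2)" using ext[OF p] c v by simp
      moreover have "Suc (length p - 2) = k" using 2 l2 by simp
      ultimately show ?thesis using c k 2 unfolding path_edges_def by (auto simp: insert_commute)
    next
      case 3
      then obtain l where l: "k = Suc l" by (cases k) auto
      have "c = p ! l \<or> c = p ! Suc k"
      proof (rule nonnatural_two[OF _ v(3) _ _ c(2)])
        show "v \<in> verts T" using k thin_props(1)[OF p(1)] by simp
        show "{v, p ! l} \<in> edges T" "{v, p ! Suc k} \<in> edges T"
          using thin_props(2)[OF p(1), of l] thin_props(2)[OF p(1), of k] k l 3 by (auto simp: insert_commute)
        show "p ! l \<noteq> p ! Suc k" using thin_props(4)[OF p(1), of l "Suc k"] l 3 by simp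
      qed
      then show ?thesis using c k l 3 unfolding path_edges_def by (auto simp: insert_commute)
    qed
  qed
  have "E \<subseteq> path_edges p"
  proof
    fix d assume "d \<in> E"
    then have "(e, d) \<in> link\<^sup>*" using e by simp
    then show "d \<in> path_edges p" by (induction rule: rtrancl_induct) (use p closed in auto)
  qed
  moreover have "path_edges p \<subseteq> E"
  proof -
    have chain: "({p ! 0, p ! Suc 0}, {p ! i, p ! Suc i}) \<in> link\<^sup>*" if "Suc i < length p" for i
      using that
    proof (induction i)
      case (Suc i)
      then have "({p ! i, p ! Suc i}, {p ! Suc i, p ! Suc (Suc i)}) \<in> link"
        using thin_props[OF p(1)] by (intro linkI[of _ _ "p ! Suc i"]) auto
      then show ?case using Suc by (auto intro: rtrancl_into_rtrancl)
    qed simp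
    obtain m where m: "Suc m < length p" "e = {p ! m, p ! Suc m}" using p(2) by (auto simp: path_edges_def)
    have "(e, {p ! i, p ! Suc i}) \<in> link\<^sup>*" if "Suc i < length p" for i
      using chain[OF m(1)] chain[OF that] m(2) link_sym by (metis rtrancl_trans symD)
    then show ?thesis unfolding e(2) path_edges_def by auto
  qed
  ultimately show thesis using that p(1) by blast
qed

lemma finite_natural_edge: "E \<in> natural_edges G T \<Longrightarrow> finite E"
  using natural_edge_thin finite_path_edges by metis

lemma natural_edge_inequivalent:
  assumes "E \<in> natural_edges G T" "e \<in> E" "d \<in> E" "g \<in> carrier G" "act T g ` e = d"
  shows "e = d"
proof -
  obtain p where p: "thin p" "E = path_edges p" using natural_edge_thin[OF assms(1)] by blast
  then obtain i j where "Suc i < length p" "e = {p ! i, p ! Suc i}" "Suc j < length p" "d = {p ! j, p ! Suc j}"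
    using assms unfolding path_edges_def by blast
  then show ?thesis using thin_inequivalent[OF p(1), of i j g] assms by blast
qed

end

lemma natural_edges_trivial:
  assumes no: "\<And>v. v \<in> verts T \<Longrightarrow> \<not> natural_vertex G T v"
  shows "natural_edges G T \<subseteq> {edges T}"
proof
  fix E assume "E \<in> natural_edges G T"
  then obtain e where e: "e \<in> edges T" "E = link\<^sup>* `` {e}" unfolding natural_edges_def by blast
  obtain a b where ab: "a \<in> verts T" "b \<in> verts T" "e = {a, b}" using edgeE[OF e(1)] by metis
  have "\<forall>d\<in>edges T. v \<in> d \<longrightarrow> (e, d) \<in> link\<^sup>*" if "v \<in> verts T" for v
    using ab(1) that
  proof (induction rule: walk_induct)
    case start
    then show ?case using linkI[OF e(1), of _ a] no ab by blast
  next
    case (step v w)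
    show ?case
    proof (intro ballI impI)
      fix d assume d: "d \<in> edges T" "w \<in> d"
      have "(e, {v, w}) \<in> link\<^sup>*" using step by blast
      moreover have "({v, w}, d) \<in> link" using linkI[of "{v, w}" d w] step d no by blast
      ultimately show "(e, d) \<in> link\<^sup>*" by (rule rtrancl_into_rtrancl)
    qed
  qed
  then have "edges T \<subseteq> E" unfolding e(2) using edgeE by (metis Image_singleton_iff insertI1 subsetI)
  then show "E \<in> {edges T}" using natural_edge_sub[OF \<open>E \<in> _\<close>] by blast
qed

text \<open>If \<open>v\<close> were a leaf, its only edge would separate two translates of its neighbour \<open>w\<close>; one of them is \<open>v\<close>,
  and the element carrying \<open>w\<close> to \<open>v\<close> would invert the edge.\<close>

lemma no_leaf:
  assumes vw: "{v, w} \<in> edges T"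
  obtains x where "{v, x} \<in> edges T" "x \<noteq> w"
proof (rule ccontr)
  assume "\<not> thesis"
  with that have only: "\<And>x. {v, x} \<in> edges T \<Longrightarrow> x = w" by blast
  have V: "v \<in> verts T" "w \<in> verts T" "v \<noteq> w" using edge_verts vw by auto
  have side: "{v, w} \<in> sep T v x" if x: "x \<in> verts T" "x \<noteq> v" for x
  proof -
    note p = geodesic_props[OF V(1) x(1)]
    obtain r where r: "tree_geodesic T v x = v # r" using p by (metis list.collapse)
    then obtain y s where "r = y # s" using p x by (cases r) auto
    then show ?thesis using p r only unfolding sep_def by (auto simp: edge_path_Cons path_edges_Cons)
  qed
  obtain g h where gh: "g \<in> carrier G" "h \<in> carrier G" "{v, w} \<in> sep T (act T g w) (act T h w)"
    using minimal_sep[OF V(2) vw] by metis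
  have gw: "act T g w \<in> verts T" "act T h w \<in> verts T" using act_verts gh V by auto
  have "({v, w} \<in> sep T v (act T g w)) \<noteq> ({v, w} \<in> sep T v (act T h w))"
    using sep_xor[OF gw(1) V(1) gw(2)] sep_commute[OF V(1) gw(1)] gh(3) by auto
  then obtain k where k: "k \<in> carrier G" "act T k w = v" using side gw gh by metis
  have "{act T k v, act T k w} \<in> edges T" using act_edge[OF k(1) vw] .
  then have "act T k v = w" using only k by (simp add: insert_commute)
  then have "act T k ` {v, w} = {v, w}" using k by auto
  then have "k = \<one>" using edge_stab[OF k(1) vw] by simp
  then show False using k V act_one by simp
qed

lemma infinite_edges: "infinite (edges T)"
proof
  assume fin: "finite (edges T)"
  have "verts T \<subseteq> \<Union> (edges T)" using incident_edge by blast
  moreover have "finite (\<Union> (edges T))" using fin edgeE by (metis finite.emptyI finite.insertI finite_Union)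
  ultimately have finV: "finite (verts T)" by (rule finite_subset)
  have "\<exists>p. edge_path T p \<and> length p = Suc n" for n
  proof (induction n)
    case 0
    obtain v where "v \<in> verts T" using verts_nonempty by blast
    then have "edge_path T [v]" by (simp add: edge_path_def)
    then show ?case by (intro exI[of _ "[v]"]) simp
  next
    case (Suc n)
    then obtain p where p: "edge_path T p" "length p = Suc n" by blast
    then have p0: "p \<noteq> []" by auto
    show ?case
    proof (cases n)
      case 0
      have "last p \<in> verts T" using p p0 by (meson edge_path_def last_in_set subsetD)
      then obtain w where w: "{last p, w} \<in> edges T" using incident_edge by blast
      have "edge_path T (p @ [w])"
        by (rule edge_path_snoc) (use p w edge_verts[OF w] 0 in auto)
      then show ?thesis using p by (intro exI[of _ "p @ [w]"]) simp
    next
      case (Suc m)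
      have "{p ! m, p ! Suc m} \<in> edges T" using p Suc by (simp add: edge_path_iff_nth)
      moreover have "last p = p ! Suc m" using p p0 Suc by (simp add: last_conv_nth)
      ultimately obtain w where w: "{last p, w} \<in> edges T" "w \<noteq> p ! m" using no_leaf[of "last p" "p ! m"]
        by (metis insert_commute)
      have "edge_path T (p @ [w])"
        by (rule edge_path_snoc) (use p w edge_verts[OF w(1)] Suc in auto)
      then show ?thesis using p by (intro exI[of _ "p @ [w]"]) simp
    qed
  qed
  then obtain p where p: "edge_path T p" "length p = Suc (card (verts T))" by blast
  have "card (set p) = length p" using edge_path_distinct[OF p(1)] by (rule distinct_card)
  moreover have "card (set p) \<le> card (verts T)" using p finV by (intro card_mono) (auto simp: edge_path_def)
  ultimately show False using p by simp
qed

end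

section \<open>Volume\<close>

lemma sum_UN_le:
  fixes w :: "'x \<Rightarrow> real"
  assumes "finite I" "\<And>i. i \<in> I \<Longrightarrow> finite (A i)" "\<And>i x. i \<in> I \<Longrightarrow> x \<in> A i \<Longrightarrow> 0 \<le> w x"
  shows "sum w (\<Union>i\<in>I. A i) \<le> (\<Sum>i\<in>I. sum w (A i))"
  using assms
proof (induction rule: finite_induct)
  case (insert i I)
  have "sum w (A i \<union> (\<Union>i\<in>I. A i)) + sum w (A i \<inter> (\<Union>i\<in>I. A i)) = sum w (A i) + sum w (\<Union>i\<in>I. A i)"
    by (rule sum.union_inter) (use insert in auto)
  moreover have "0 \<le> sum w (A i \<inter> (\<Union>i\<in>I. A i))" by (rule sum_nonneg) (use insert in auto)
  moreover have "sum w (\<Union>i\<in>I. A i) \<le> (\<Sum>i\<in>I. sum w (A i))" using insert by auto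
  ultimately show ?case using insert by simp
qed simp

context splitting
begin

lemma edge_transversal: "\<exists>R. transversal G (edges T) (\<lambda>g. (`) (act T g)) R"
  using transversal_some[OF gset_edges finite_edge_orbits] by blast

definition nat_reps where
  "nat_reps = (\<lambda>\<O>. SOME E. E \<in> \<O>) ` natural_edge_orbits G T"

context
  fixes len
  assumes len: "invariant_lengths G T len" and norm: "normalized G T len"
begin

lemma len_pos: "e \<in> edges T \<Longrightarrow> 0 < len e" and len_act: "e \<in> edges T \<Longrightarrow> g \<in> carrier G \<Longrightarrow> len (act T g ` e) = len e"
  using len by (auto simp: invariant_lengths_def)

lemma nat_reps_natural: "nat_reps \<subseteq> natural_edges G T"
  unfolding nat_reps_def natural_edge_orbits_def using orbits_someE[OF gset_natural] by blast

lemma nat_reps_sum: "(\<Sum>E\<in>nat_reps. natural_length len E) = 1"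
  using norm sum_orbits_some[OF gset_natural, of "natural_length len"]
  by (simp add: normalized_def nat_reps_def natural_edge_orbits_def)

lemma finite_nat_reps: "finite nat_reps"
  using nat_reps_sum by (metis sum.infinite zero_neq_one)

lemma finite_natural_orbits: "finite (natural_edge_orbits G T)"
proof -
  have "inj_on (\<lambda>\<O>. SOME E. E \<in> \<O>) (natural_edge_orbits G T)"
    unfolding natural_edge_orbits_def by (rule inj_onI) (metis orbits_someE[OF gset_natural])
  then show ?thesis using finite_nat_reps unfolding nat_reps_def by (simp add: finite_image_iff)
qed

lemma nat_reps_transversal: "transversal G (natural_edges G T) (translate T) nat_reps"
  using transversal_some[OF gset_natural] finite_natural_orbits
  unfolding nat_reps_def natural_edge_orbits_def by blast

text \<open>Without natural vertices the tree is a line forming a single natural edge; being infinite it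
  has length \<open>0\<close> by the convention for sums over infinite sets.\<close>

lemma natural_vertex_exists: "\<exists>v\<in>verts T. natural_vertex G T v"
proof (rule ccontr)
  assume "\<not> ?thesis"
  then have "nat_reps \<subseteq> {edges T}" using natural_edges_trivial nat_reps_natural by blast
  then have "natural_length len E = 0" if "E \<in> nat_reps" for E
    using that infinite_edges by (auto simp: natural_length_def)
  then show False using nat_reps_sum by simp
qed

lemma nat_reps_disjoint:
  assumes "E \<in> nat_reps" "E' \<in> nat_reps" "g \<in> carrier G" "g' \<in> carrier G"
    "e \<in> translate T g E" "e \<in> translate T g' E'"
  shows "E = E'"
proof -
  have N: "E \<in> natural_edges G T" "E' \<in> natural_edges G T" using assms nat_reps_natural by auto
  have N': "translate T g E \<in> natural_edges G T" "translate T g' E' \<in> natural_edges G T"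
    using gset_closed[OF gset_natural] N assms by auto
  have "translate T g E = translate T g' E'"
    using natural_edge_class[OF N'(1) assms(5)] natural_edge_class[OF N'(2) assms(6)] by simp
  then have "orbit G (translate T) E = orbit G (translate T) E'"
    using gset_orbit_act[OF gset_natural] N assms by metis
  then have "E \<in> orbit G (translate T) E" "E' \<in> orbit G (translate T) E"
    using gset_orbit_refl[OF gset_natural] N by auto
  then show ?thesis using nat_reps_transversal N(1) assms(1,2) unfolding transversal_def by blast
qed

lemma sum_nat_reps_Un: "sum len (\<Union> nat_reps) = 1"
proof -
  have "\<forall>A\<in>nat_reps. finite A" using nat_reps_natural finite_natural_edge[OF natural_vertex_exists] by blast
  moreover have "\<forall>A\<in>nat_reps. \<forall>B\<in>nat_reps. A \<noteq> B \<longrightarrow> A \<inter> B = {}"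
  proof (intro ballI impI)
    fix A B assume A: "A \<in> nat_reps" "B \<in> nat_reps" "A \<noteq> B"
    then have "A \<in> natural_edges G T" "B \<in> natural_edges G T" using nat_reps_natural by auto
    then show "A \<inter> B = {}"
      using nat_reps_disjoint[OF A(1,2) one_closed one_closed] gset_one[OF gset_natural] A(3) by auto
  qed
  ultimately show ?thesis using nat_reps_sum by (simp add: natural_length_def sum.Union_disjoint)
qed

lemma nat_reps_edges: "\<Union> nat_reps \<subseteq> edges T" "finite (\<Union> nat_reps)"
  using nat_reps_natural natural_edge_sub finite_nat_reps finite_natural_edge[OF natural_vertex_exists] by blast+

text \<open>The edges of representatives of the natural edges represent every orbit of edges exactly once,
  so normalization says that the quotient graph has volume \<open>1\<close>.\<close>

lemma volume:
  assumes R: "transversal G (edges T) (\<lambda>g. (`) (act T g)) R"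
  shows "sum len R = 1"
proof (rule antisym)
  let ?a = "\<lambda>g. (`) (act T g)"
  have "sum len R \<le> sum len (\<Union> nat_reps)"
  proof (rule transversal_sum_le[OF gset_edges R])
    fix e assume e: "e \<in> edges T"
    let ?E = "link\<^sup>* `` {e}"
    have "?E \<in> natural_edges G T" using natural_edge_of[OF e] .
    then obtain E where E: "E \<in> nat_reps" "E \<in> orbit G (translate T) ?E"
      using nat_reps_transversal unfolding transversal_def by blast
    then obtain g where g: "g \<in> carrier G" "E = translate T g ?E" unfolding orbit_def by blast
    then have "act T g ` e \<in> E" unfolding translate_def by blast
    then show "\<exists>d\<in>\<Union> nat_reps. d \<in> orbit G ?a e" using E(1) g(1) unfolding orbit_def by blast
  qed (use nat_reps_edges len_pos len_act in \<open>auto intro: less_imp_le\<close>)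
  then show "sum len R \<le> 1" using sum_nat_reps_Un by simp
  have "sum len (\<Union> nat_reps) \<le> sum len R"
  proof (rule transversal_sum_ge[OF gset_edges R])
    fix e d assume e: "e \<in> \<Union> nat_reps" "d \<in> \<Union> nat_reps" "d \<in> orbit G ?a e"
    then obtain E D g where E: "E \<in> nat_reps" "e \<in> E" "D \<in> nat_reps" "d \<in> D" "g \<in> carrier G" "d = act T g ` e"
      unfolding orbit_def by blast
    then have N: "E \<in> natural_edges G T" "D \<in> natural_edges G T" using nat_reps_natural by auto
    have "d \<in> translate T g E" "d \<in> translate T \<one> D"
      using E gset_one[OF gset_natural N(2)] by (auto simp: translate_def)
    then have "E = D" using nat_reps_disjoint E by blast
    then show "e = d" using natural_edge_inequivalent[OF natural_vertex_exists N(1)] E by blast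
  qed (use nat_reps_edges len_pos len_act in \<open>auto intro: less_imp_le\<close>)
  then show "1 \<le> sum len R" using sum_nat_reps_Un by simp
qed

text \<open>Translates of inequivalent natural edges are disjoint, so the length is at least the sum of the lengths
  of the natural edges.\<close>

lemma full_subpath_length:
  assumes Q: "finite Q" "Q \<subseteq> edges T"
    and full: "\<forall>E\<in>natural_edges G T. \<exists>g\<in>carrier G. translate T g E \<subseteq> Q"
  shows "1 \<le> sum len Q"
proof -
  have "\<forall>E\<in>nat_reps. \<exists>g\<in>carrier G. translate T g E \<subseteq> Q" using full nat_reps_natural by blast
  then obtain g where g: "\<And>E. E \<in> nat_reps \<Longrightarrow> g E \<in> carrier G \<and> translate T (g E) E \<subseteq> Q" by metis
  have "natural_length len E = sum len (translate T (g E) E)" if E: "E \<in> nat_reps" for E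
  proof -
    have sub: "E \<subseteq> edges T" using E nat_reps_natural natural_edge_sub by blast
    then have "inj_on ((`) (act T (g E))) E"
      using inj_on_subset[OF gset_inj_on[OF gset_edges]] g[OF E] by blast
    then have "sum len (translate T (g E) E) = (\<Sum>e\<in>E. len (act T (g E) ` e))"
      unfolding translate_def by (simp add: sum.reindex)
    also have "\<dots> = natural_length len E"
      unfolding natural_length_def by (rule sum.cong) (use len_act g[OF E] sub in auto)
    finally show ?thesis by simp
  qed
  then have "1 = (\<Sum>E\<in>nat_reps. sum len (translate T (g E) E))" using nat_reps_sum by simp
  also have "\<dots> = sum len (\<Union>E\<in>nat_reps. translate T (g E) E)"
  proof (rule sum.UNION_disjoint[symmetric])
    show "\<forall>i\<in>nat_reps. finite (translate T (g i) i)" using g Q finite_subset by blast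
    show "\<forall>i\<in>nat_reps. \<forall>j\<in>nat_reps. i \<noteq> j \<longrightarrow> translate T (g i) i \<inter> translate T (g j) j = {}"
      using nat_reps_disjoint g by blast
  qed (rule finite_nat_reps)
  also have "\<dots> \<le> sum len Q"
  proof (rule sum_mono2)
    show "0 \<le> len e" if "e \<in> Q - (\<Union>E\<in>nat_reps. translate T (g E) E)" for e
      using len_pos[of e] that Q(2) by (meson DiffD1 less_imp_le subsetD)
  qed (use Q g in blast)+
  finally show ?thesis .
qed

lemma contains_full_subpaths_length:
  assumes P: "finite P" "P \<subseteq> edges T" and full: "contains_full_subpaths G T P n"
  shows "real n \<le> sum len P"
proof -
  obtain Q where Q: "\<And>j. j < n \<Longrightarrow> (\<exists>p. edge_path T p \<and> Q j = path_edges p) \<and> Q j \<subseteq> P \<and>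
                  (\<forall>E'\<in>natural_edges G T. \<exists>g\<in>carrier G. translate T g E' \<subseteq> Q j)"
    and disj: "disjoint_family_on Q {..<n}" using full unfolding contains_full_subpaths_def by blast
  have fin: "finite (Q j)" if "j < n" for j using Q[OF that] P finite_subset by blast
  have one: "1 \<le> sum len (Q j)" if "j < n" for j
    using full_subpath_length[OF fin[OF that]] Q[OF that] P(2) by (meson order_trans)
  have nonneg: "0 \<le> len e" if "e \<in> P" for e
    using len_pos[of e] that P(2) by (meson less_imp_le subsetD)
  have "real n = (\<Sum>j<n. 1)" by simp
  also have "\<dots> \<le> (\<Sum>j<n. sum len (Q j))"
    by (rule sum_mono) (use one in simp)
  also have "\<dots> = sum len (\<Union>j<n. Q j)"
    by (rule sum.UNION_disjoint[symmetric]) (use fin disj in \<open>auto simp: disjoint_family_on_def\<close>)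
  also have "\<dots> \<le> sum len P"
  proof (rule sum_mono2[OF P(1)])
    have "Q j \<subseteq> P" if "j < n" for j using Q[OF that] by (rule conjE) (erule conjE)
    then show "(\<Union>j<n. Q j) \<subseteq> P" by auto
  qed (use nonneg in auto)
  finally show ?thesis .
qed

end

end

section \<open>Equivariant vertex maps\<close>

locale vertex_map = S: splitting G S + T: splitting G T
  for G :: "('a, 'm) monoid_scheme" (structure) and S :: "('a, 'v) gtree" and T :: "('a, 'w) gtree" +
  fixes k :: "'v \<Rightarrow> 'w"
  assumes k_verts: "v \<in> verts S \<Longrightarrow> k v \<in> verts T"
    and k_act: "g \<in> carrier G \<Longrightarrow> v \<in> verts S \<Longrightarrow> k (act S g v) = act T g (k v)"

lemma image_edges_UN: "image_edges T f E = (\<Union>e\<in>E. image_edges T f {e})"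
  unfolding image_edges_def by blast

lemma (in tree) image_edges_edge:
  assumes "f a \<in> verts T" "f b \<in> verts T"
  shows "image_edges T f {{a, b}} = sep T (f a) (f b)"
proof -
  have "image_edges T f {{a, b}} = sep T (f a) (f b) \<union> sep T (f b) (f a)"
    unfolding image_edges_def sep_def by (auto simp: doubleton_eq_iff)
  then show ?thesis using sep_commute assms by blast
qed

context vertex_map
begin

lemma image_edge: "{a, b} \<in> edges S \<Longrightarrow> image_edges T k {{a, b}} = sep T (k a) (k b)"
  using T.image_edges_edge k_verts S.edge_verts by metis

lemma image_edge_props:
  assumes "e \<in> edges S"
  shows "finite (image_edges T k {e})" "image_edges T k {e} \<subseteq> edges T"
proof -
  obtain a b where "a \<in> verts S" "b \<in> verts S" "e = {a, b}" using S.edgeE assms by metis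
  then show "finite (image_edges T k {e})" "image_edges T k {e} \<subseteq> edges T"
    using image_edge[of a b] assms T.finite_sep T.sep_edges k_verts by auto
qed

lemma image_edge_act:
  assumes "g \<in> carrier G" "e \<in> edges S"
  shows "image_edges T k {act S g ` e} = (`) (act T g) ` image_edges T k {e}"
proof -
  obtain a b where ab: "a \<in> verts S" "b \<in> verts S" "e = {a, b}" using S.edgeE assms by metis
  then have "{act S g a, act S g b} \<in> edges S" using S.act_edge assms by simp
  then show ?thesis using image_edge ab assms k_act T.sep_act k_verts by simp
qed

definition image_length :: "('w set \<Rightarrow> real) \<Rightarrow> 'v set \<Rightarrow> real" where
  "image_length len e = sum len (image_edges T k {e})"

lemma image_length_act:
  assumes len: "\<And>d g. d \<in> edges T \<Longrightarrow> g \<in> carrier G \<Longrightarrow> len (act T g ` d) = len d"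
    and "g \<in> carrier G" "e \<in> edges S"
  shows "image_length len (act S g ` e) = image_length len e"
proof -
  have sub: "image_edges T k {e} \<subseteq> edges T" using image_edge_props assms by blast
  then have "inj_on ((`) (act T g)) (image_edges T k {e})"
    using inj_on_subset[OF S.gset_inj_on[OF T.gset_edges]] assms by blast
  then have "image_length len (act S g ` e) = (\<Sum>d\<in>image_edges T k {e}. len (act T g ` d))"
    unfolding image_length_def image_edge_act[OF assms(2,3)] by (simp add: sum.reindex)
  also have "\<dots> = image_length len e" unfolding image_length_def by (rule sum.cong) (use len sub assms in auto)
  finally show ?thesis .
qed

lemma image_length_nonneg: "(\<And>d. d \<in> edges T \<Longrightarrow> 0 \<le> len d) \<Longrightarrow> e \<in> edges S \<Longrightarrow> 0 \<le> image_length len e"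
  unfolding image_length_def using image_edge_props by (intro sum_nonneg) blast

text \<open>The union of the images of all edges is an invariant subtree.\<close>

lemma edge_covered:
  assumes d: "d \<in> edges T"
  obtains e where "e \<in> edges S" "d \<in> image_edges T k {e}"
proof (rule ccontr)
  assume "\<not> thesis"
  with that have no: "\<And>e. e \<in> edges S \<Longrightarrow> d \<notin> image_edges T k {e}" by blast
  obtain v where v: "v \<in> verts S" using S.verts_nonempty by blast
  have const: "d \<notin> sep T (k x) (k y)" if "x \<in> verts S" "y \<in> verts S" for x y
    using that
  proof (induction rule: S.walk_induct)
    case (step y z)
    have "d \<notin> sep T (k y) (k z)" using no[OF step(3)] image_edge[OF step(3)] by simp
    then show ?case using step T.sep_xor[of "k x" "k y" "k z" d] k_verts that by blast
  qed (use k_verts that in auto)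
  obtain g h where gh: "g \<in> carrier G" "h \<in> carrier G" "d \<in> sep T (act T g (k v)) (act T h (k v))"
    using T.minimal_sep[OF k_verts[OF v] d] by metis
  then show False using const[of "act S g v" "act S h v"] k_act v S.act_verts by simp
qed

lemma volume_le_image_length:
  assumes len: "\<And>d g. d \<in> edges T \<Longrightarrow> g \<in> carrier G \<Longrightarrow> len (act T g ` d) = len d" "\<And>d. d \<in> edges T \<Longrightarrow> 0 \<le> len d"
    and R: "transversal G (edges S) (\<lambda>g. (`) (act S g)) R" and R': "transversal G (edges T) (\<lambda>g. (`) (act T g)) R'"
  shows "sum len R' \<le> sum (image_length len) R"
proof -
  have RS: "finite R" "R \<subseteq> edges S" using R by (auto simp: transversal_def)
  have "sum len R' \<le> sum len (\<Union>e\<in>R. image_edges T k {e})"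
  proof (rule S.transversal_sum_le[OF T.gset_edges R'])
    show "finite (\<Union>e\<in>R. image_edges T k {e})" "(\<Union>e\<in>R. image_edges T k {e}) \<subseteq> edges T"
      using RS image_edge_props by blast+
    fix d assume "d \<in> edges T"
    then obtain e where e: "e \<in> edges S" "d \<in> image_edges T k {e}" using edge_covered by blast
    then obtain r where r: "r \<in> R" "r \<in> orbit G (\<lambda>g. (`) (act S g)) e" using R unfolding transversal_def by blast
    then obtain g where g: "g \<in> carrier G" "r = act S g ` e" unfolding orbit_def by blast
    then have "act T g ` d \<in> image_edges T k {r}" using image_edge_act e by blast
    then show "\<exists>y\<in>\<Union>e\<in>R. image_edges T k {e}. y \<in> orbit G (\<lambda>g. (`) (act T g)) d"
      using r g unfolding orbit_def by blast
  qed (use len in auto)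
  also have "\<dots> \<le> sum (image_length len) R"
    unfolding image_length_def by (rule sum_UN_le) (use RS image_edge_props len in blast)+
  finally show ?thesis .
qed

definition forest where "forest = {e \<in> edges S. collapsed k e}"

lemma forest_sub: "forest \<subseteq> edges S" by (auto simp: forest_def)

lemma forest_iff: "{a, b} \<in> forest \<longleftrightarrow> {a, b} \<in> edges S \<and> k a = k b" by (simp add: forest_def)

lemma forest_inv: "g \<in> carrier G \<Longrightarrow> e \<in> forest \<Longrightarrow> act S g ` e \<in> forest"
proof -
  assume g: "g \<in> carrier G" and e: "e \<in> forest"
  have "e \<in> edges S" using e forest_sub by blast
  then obtain a b where ab: "a \<in> verts S" "b \<in> verts S" "e = {a, b}" using S.edgeE by metis
  then show ?thesis using g e S.act_edge[OF g] k_act by (auto simp: forest_def)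
qed

lemma joined_k: "(u, v) \<in> joined forest \<Longrightarrow> k u = k v"
  unfolding joined_def by (induction rule: rtrancl_induct) (auto simp: forest_iff)

lemma joined_act: "(u, v) \<in> joined forest \<Longrightarrow> g \<in> carrier G \<Longrightarrow> (act S g u, act S g v) \<in> joined forest"
proof -
  assume "(u, v) \<in> joined forest" "g \<in> carrier G"
  then show ?thesis unfolding joined_def
  proof (induction rule: rtrancl_induct)
    case (step v w)
    then have "(act S g v, act S g w) \<in> {(u, v). {u, v} \<in> forest}" using forest_inv[of g "{v, w}"] by simp
    then show ?case using step by (auto intro: rtrancl_into_rtrancl)
  qed simp
qed

text \<open>If a component of the collapsed forest has trivial stabilizer and all edges leaving it start
  in the same direction, then its image can be moved one edge in that direction. No image of an edge
  grows, and the images of the edges leaving the component shrink.\<close>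

lemma push:
  assumes c: "c \<in> verts S" and y: "{k c, y} \<in> edges T"
    and triv: "\<And>g. g \<in> carrier G \<Longrightarrow> (c, act S g c) \<in> joined forest \<Longrightarrow> g = \<one>"
    and gate: "\<And>u v. (c, u) \<in> joined forest \<Longrightarrow> {u, v} \<in> edges S \<Longrightarrow> {u, v} \<notin> forest \<Longrightarrow> {k c, y} \<in> sep T (k c) (k v)"
  obtains k' where "vertex_map G S T k'" "\<And>e. e \<in> edges S \<Longrightarrow> image_edges T k' {e} \<subseteq> image_edges T k {e}"
    "\<And>u v. (c, u) \<in> joined forest \<Longrightarrow> {u, v} \<in> edges S \<Longrightarrow> {u, v} \<notin> forest \<Longrightarrow>
       image_edges T k' {{u, v}} \<noteq> image_edges T k {{u, v}}"
proof -
  have yV: "y \<in> verts T" using T.edge_verts[OF y] by blast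
  define in_orb where "in_orb g v \<longleftrightarrow> g \<in> carrier G \<and> (act S g c, v) \<in> joined forest" for g v
  have uniq: "g = h" if "in_orb g v" "in_orb h v" for g h v
  proof -
    have gh: "g \<in> carrier G" "h \<in> carrier G" using that by (auto simp: in_orb_def)
    have "(act S g c, act S h c) \<in> joined forest"
      using that joined_sym joined_trans unfolding in_orb_def by metis
    then have "(act S (inv g) (act S g c), act S (inv g) (act S h c)) \<in> joined forest" using joined_act gh by simp
    then have "(c, act S (inv g \<otimes> h) c) \<in> joined forest" using S.act_inv S.act_mult gh c by simp
    then have "inv g \<otimes> h = \<one>" using triv gh by simp
    then show ?thesis using gh S.inv_equality[of "inv g" h] by (metis S.inv_closed S.inv_inv S.inv_comm S.inv_equality)
  qed
  define k' where "k' v = (if \<exists>g. in_orb g v then act T (THE g. in_orb g v) y else k v)" for v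
  have k'1: "k' v = act T g y" if "in_orb g v" for g v
  proof -
    have "(THE g. in_orb g v) = g" using that uniq by (intro the_equality) auto
    then show ?thesis using that by (auto simp: k'_def)
  qed
  have k'2: "k' v = k v" if "\<And>g. \<not> in_orb g v" for v using that by (simp add: k'_def)
  have in_act: "in_orb (h \<otimes> g) (act S h v)" if "in_orb g v" "h \<in> carrier G" for g h v
    using that joined_act[of "act S g c" v h] S.act_mult c by (simp add: in_orb_def)
  have vm: "vertex_map G S T k'"
  proof unfold_locales
    show "k' v \<in> verts T" if "v \<in> verts S" for v
      using that k_verts T.act_verts yV k'1 k'2 by (metis in_orb_def)
    fix g v assume g: "g \<in> carrier G" and v: "v \<in> verts S"
    show "k' (act S g v) = act T g (k' v)"
    proof (cases "\<exists>h. in_orb h v")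
      case True
      then obtain h where h: "in_orb h v" by blast
      then have hc: "h \<in> carrier G" by (simp add: in_orb_def)
      show ?thesis using k'1[OF h] k'1[OF in_act[OF h g]] T.act_mult[OF g hc yV] by simp
    next
      case False
      have "\<not> in_orb h (act S g v)" for h
      proof
        assume "in_orb h (act S g v)"
        then have "in_orb (inv g \<otimes> h) (act S (inv g) (act S g v))" using in_act g by simp
        then show False using False S.act_inv[OF g v] by auto
      qed
      then show ?thesis using False k'2 k_act g v by metis
    qed
  qed
  have edge: "image_edges T k' {{u, v}} = sep T (k' u) (k' v)" if "{u, v} \<in> edges S" for u v
    using vertex_map.image_edge[OF vm that] .
  have k_in: "k v = act T g (k c)" if "in_orb g v" for g v
    using that joined_k k_act c unfolding in_orb_def by metis
  have gate': "act T g ` {k c, y} \<in> sep T (k u) (k v)"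
    if g: "in_orb g u" and uv: "{u, v} \<in> edges S" "{u, v} \<notin> forest" for g u v
  proof -
    have gc: "g \<in> carrier G" and ju: "(act S g c, u) \<in> joined forest" using g by (auto simp: in_orb_def)
    have V: "u \<in> verts S" "v \<in> verts S" using S.edge_verts[OF uv(1)] by auto
    have "(c, act S (inv g) u) \<in> joined forest" using joined_act[OF ju, of "inv g"] S.act_inv[OF gc c] gc by simp
    moreover have "{act S (inv g) u, act S (inv g) v} \<in> edges S" using S.act_edge uv gc by simp
    moreover have "{act S (inv g) u, act S (inv g) v} \<notin> forest"
      using uv k_act V gc T.act_inj[of "inv g" "k u" "k v"] k_verts by (simp add: forest_iff)
    ultimately have "{k c, y} \<in> sep T (k c) (k (act S (inv g) v))" using gate by blast
    then have "act T g ` {k c, y} \<in> (`) (act T g) ` sep T (k c) (k (act S (inv g) v))" by (rule imageI)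
    then have "act T g ` {k c, y} \<in> sep T (act T g (k c)) (act T g (k (act S (inv g) v)))"
      using T.sep_act[OF gc, of "k c" "k (act S (inv g) v)"] k_verts S.act_verts gc V c by simp
    moreover have "act T g (k (act S (inv g) v)) = k v"
      using k_act gc V T.act_inv' k_verts by simp
    ultimately show ?thesis using k_in[OF g] by simp
  qed
  have sep_y: "sep T (act T g (k c)) (act T g y) = {act T g ` {k c, y}}" if "g \<in> carrier G" for g
    using T.sep_edge[of "act T g (k c)" "act T g y"] T.act_edge[OF that y] by simp
  \<comment> \<open>Each end that lies in a translate of the component removes the edge at that end from the image.\<close>
  have main: "sep T (k' u) (k' v) \<subseteq> sep T (k u) (k v) \<and>
      ((\<exists>g. in_orb g u) \<and> {u, v} \<notin> forest \<longrightarrow> sep T (k' u) (k' v) \<noteq> sep T (k u) (k v))"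
    if uv: "{u, v} \<in> edges S" for u v
  proof -
    have V: "u \<in> verts S" "v \<in> verts S" "k u \<in> verts T" "k v \<in> verts T" using S.edge_verts[OF uv] k_verts by auto
    have vu: "{v, u} \<in> edges S" using uv by (simp add: insert_commute)
    have V': "k' u \<in> verts T" "k' v \<in> verts T" using vertex_map.k_verts[OF vm] V by auto
    have iF: "in_orb g v" if "in_orb g u" "{u, v} \<in> forest" for g u v
      using that joined_trans joined_edge unfolding in_orb_def by metis
    show ?thesis
    proof (cases "\<exists>g. in_orb g u")
      case gu: True
      then obtain g where g: "in_orb g u" by blast
      then have gc: "g \<in> carrier G" by (simp add: in_orb_def)
      have ku: "k u = act T g (k c)" "k' u = act T g y" using k_in[OF g] k'1[OF g] by auto
      show ?thesis
      proof (cases "{u, v} \<in> forest")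
        case True
        then have "k' u = k' v" using k'1[OF g] k'1[OF iF[OF g True]] by simp
        then show ?thesis using True V' by simp
      next
        case notF: False
        let ?e = "act T g ` {k c, y}"
        have e: "?e \<in> sep T (k u) (k v)" by (rule gate'[OF g uv notF])
        have 1: "sep T (k u) (k' u) = {?e}" using sep_y[OF gc] ku by simp
        show ?thesis
        proof (cases "\<exists>h. in_orb h v")
          case True
          then obtain h where h: "in_orb h v" by blast
          then have hc: "h \<in> carrier G" by (simp add: in_orb_def)
          have kv: "k v = act T h (k c)" "k' v = act T h y" using k_in[OF h] k'1[OF h] by auto
          let ?d = "act T h ` {k c, y}"
          have d: "?d \<in> sep T (k u) (k v)"
            using gate'[OF h vu] notF T.sep_commute V by (simp add: insert_commute)
          have 2: "sep T (k v) (k' v) = {?d}" using sep_y[OF hc] kv by simp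
          have ne: "?e \<noteq> ?d"
          proof
            assume "?e = ?d"
            then have "act T (inv g) ` act T g ` {k c, y} = act T (inv g) ` act T h ` {k c, y}" by (rule arg_cong)
            then have "{k c, y} = act T (inv g \<otimes> h) ` {k c, y}"
              using S.gset_inv[OF T.gset_edges gc y] S.gset_mult[OF T.gset_edges _ hc y, of "inv g"] gc by simp
            then have st: "act T (inv g \<otimes> h) ` {k c, y} = {k c, y}" by (rule sym)
            have "inv g \<otimes> h = \<one>" by (rule T.edge_stab[OF _ y st]) (use gc hc in simp)
            then have "act S (inv g \<otimes> h) c = c" using S.act_one c by simp
            then have "act S h c = act S g c" using S.act_mult[of "inv g" h c] S.act_inv'[OF gc, of "act S h c"] S.act_verts gc hc c by simp
            then have "in_orb g v" using h gc by (simp add: in_orb_def)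
            then have "k u = k v" using k_in g by metis
            then show False using notF uv by (simp add: forest_iff)
          qed
          have "x \<in> sep T (k' u) (k' v) \<longleftrightarrow> x \<in> sep T (k u) (k v) \<and> x \<noteq> ?e \<and> x \<noteq> ?d" for x
          proof -
            have "x \<in> sep T (k' u) (k' v) \<longleftrightarrow> (x = ?e) \<noteq> (x \<in> sep T (k u) (k' v))"
              using T.sep_xor[OF V'(1) V(3) V'(2), of x] T.sep_commute[OF V'(1) V(3)] 1 by simp
            moreover have "x \<in> sep T (k u) (k' v) \<longleftrightarrow> (x \<in> sep T (k u) (k v)) \<noteq> (x = ?d)"
              using T.sep_xor[OF V(3) V(4) V'(2), of x] 2 by simp
            ultimately show ?thesis using e d ne by metis
          qed
          then show ?thesis using e by blast
        next
          case False
          then have "k' v = k v" using k'2 by blast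
          then have "x \<in> sep T (k' u) (k' v) \<longleftrightarrow> x \<in> sep T (k u) (k v) \<and> x \<noteq> ?e" for x
            using T.sep_xor[OF V'(1) V(3) V(4), of x] T.sep_commute[OF V'(1) V(3)] 1 e by auto
          then show ?thesis using e by blast
        qed
      qed
    next
      case notu: False
      then have ku: "k' u = k u" using k'2 by blast
      show ?thesis
      proof (cases "\<exists>h. in_orb h v")
        case True
        then obtain h where h: "in_orb h v" by blast
        then have hc: "h \<in> carrier G" by (simp add: in_orb_def)
        have kv: "k v = act T h (k c)" "k' v = act T h y" using k_in[OF h] k'1[OF h] by auto
        let ?d = "act T h ` {k c, y}"
        have notF: "{v, u} \<notin> forest" using iF[OF h] notu by blast
        have d: "?d \<in> sep T (k u) (k v)" using gate'[OF h vu notF] T.sep_commute V by simp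
        have 2: "sep T (k v) (k' v) = {?d}" using sep_y[OF hc] kv by simp
        have "x \<in> sep T (k u) (k' v) \<longleftrightarrow> x \<in> sep T (k u) (k v) \<and> x \<noteq> ?d" for x
          using T.sep_xor[OF V(3) V(4) V'(2), of x] 2 d by auto
        then have "sep T (k u) (k' v) = sep T (k u) (k v) - {?d}" by auto
        then show ?thesis using ku notu by simp
      next
        case False
        then have "k' v = k v" using k'2 by blast
        then show ?thesis using ku notu by simp
      qed
    qed
  qed
  show thesis
  proof (rule that[OF vm])
    fix e assume e: "e \<in> edges S"
    then obtain u v where "e = {u, v}" using S.edgeE by metis
    then show "image_edges T k' {e} \<subseteq> image_edges T k {e}" using main edge image_edge e by simp
  next
    fix u v assume uv: "(c, u) \<in> joined forest" "{u, v} \<in> edges S" "{u, v} \<notin> forest"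
    then have "in_orb \<one> u" using S.act_one c by (simp add: in_orb_def)
    then show "image_edges T k' {{u, v}} \<noteq> image_edges T k {{u, v}}" using main[OF uv(2)] edge image_edge uv by auto
  qed
qed

end

section \<open>Taut maps and foldable maps\<close>

context vertex_map
begin

text \<open>Minimality of the images of the edges with respect to inclusion.\<close>

definition taut :: bool where
  "taut \<longleftrightarrow> (\<forall>k'. vertex_map G S T k' \<and> (\<forall>e\<in>edges S. image_edges T k' {e} \<subseteq> image_edges T k {e}) \<longrightarrow>
     (\<forall>e\<in>edges S. image_edges T k' {e} = image_edges T k {e}))"

lemma k_not_constant: "v \<in> verts S \<Longrightarrow> \<exists>g\<in>carrier G. k (act S g v) \<noteq> k v"
  using T.no_fixed_vertex[OF k_verts] k_act by simp

lemma forest_proper: "forest \<noteq> edges S"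
proof
  assume forest: "forest = edges S"
  obtain v where v: "v \<in> verts S" using S.verts_nonempty by blast
  then obtain g where "g \<in> carrier G" "k (act S g v) \<noteq> k v" using k_not_constant by blast
  then show False using joined_k[of v "act S g v"] S.joined_edges[OF v S.act_verts[OF _ v]] forest by metis
qed

lemma leaving_edge:
  assumes c: "c \<in> verts S"
  obtains u v where "(c, u) \<in> joined forest" "{u, v} \<in> edges S" "{u, v} \<notin> forest"
proof (rule ccontr)
  assume "\<not> thesis"
  with that have no: "\<And>u v. (c, u) \<in> joined forest \<Longrightarrow> {u, v} \<in> edges S \<Longrightarrow> {u, v} \<in> forest" by blast
  have "(c, w) \<in> joined forest" if "w \<in> verts S" for w
    using c that
  proof (induction rule: S.walk_induct)
    case (step v w)
    then show ?case using no[of v w] joined_trans joined_edge by metis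
  qed simp
  then have "k w = k c" if "w \<in> verts S" for w using joined_k that by metis
  then show False using k_not_constant[OF c] S.act_verts c by blast
qed

lemma first_step:
  assumes "a \<in> verts T" "b \<in> verts T" "a \<noteq> b"
  shows "{a, tree_geodesic T a b ! 1} \<in> edges T" "{a, tree_geodesic T a b ! 1} \<in> sep T a b"
proof -
  note p = T.geodesic_props[OF assms(1,2)]
  obtain y r where "tree_geodesic T a b = a # y # r"
    using p assms(3) by (cases "tree_geodesic T a b" rule: remdups_adj.cases) auto
  then show "{a, tree_geodesic T a b ! 1} \<in> edges T" "{a, tree_geodesic T a b ! 1} \<in> sep T a b"
    using p(1) by (auto simp: edge_path_Cons sep_def path_edges_Cons)
qed

text \<open>A nontrivial stabilizer of the component fixes the image vertex but no direction at it; for a trivial one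
  a single gate would allow a push.\<close>

lemma two_gates:
  assumes taut: taut and c: "c \<in> verts S"
  shows "\<exists>u v u' v'. ((c, u) \<in> joined forest \<and> {u, v} \<in> edges S \<and> {u, v} \<notin> forest) \<and>
    ((c, u') \<in> joined forest \<and> {u', v'} \<in> edges S \<and> {u', v'} \<notin> forest) \<and>
    tree_geodesic T (k c) (k v) ! 1 \<noteq> tree_geodesic T (k c) (k v') ! 1"
proof (rule ccontr)
  assume no: "\<not> ?thesis"
  obtain u v where uv: "(c, u) \<in> joined forest" "{u, v} \<in> edges S" "{u, v} \<notin> forest" using leaving_edge[OF c] by metis
  define y where "y = tree_geodesic T (k c) (k v) ! 1"
  have one: "tree_geodesic T (k c) (k v') ! 1 = y"
    if "(c, u') \<in> joined forest" "{u', v'} \<in> edges S" "{u', v'} \<notin> forest" for u' v'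
    using no that uv unfolding y_def by metis
  have ne: "k c \<in> verts T \<and> k v' \<in> verts T \<and> k c \<noteq> k v'"
    if "(c, u') \<in> joined forest" "{u', v'} \<in> edges S" "{u', v'} \<notin> forest" for u' v'
    using joined_k[OF that(1)] that(2,3) S.edge_verts[OF that(2)] k_verts c by (auto simp: forest_iff)
  have gate: "{k c, y} \<in> sep T (k c) (k v')"
    if "(c, u') \<in> joined forest" "{u', v'} \<in> edges S" "{u', v'} \<notin> forest" for u' v'
    using first_step(2)[of "k c" "k v'"] ne[OF that] one[OF that] by simp
  have y: "{k c, y} \<in> edges T" using first_step(1)[of "k c" "k v"] ne[OF uv] by (simp add: y_def)
  show False
  proof (cases "\<forall>g\<in>carrier G. (c, act S g c) \<in> joined forest \<longrightarrow> g = \<one>")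
    case True
    then obtain k' where k': "vertex_map G S T k'" "\<And>e. e \<in> edges S \<Longrightarrow> image_edges T k' {e} \<subseteq> image_edges T k {e}"
      "\<And>u v. (c, u) \<in> joined forest \<Longrightarrow> {u, v} \<in> edges S \<Longrightarrow> {u, v} \<notin> forest \<Longrightarrow>
         image_edges T k' {{u, v}} \<noteq> image_edges T k {{u, v}}"
      using push[OF c y] gate by (metis (no_types, lifting))
    then show False using taut uv unfolding taut_def by blast
  next
    case False
    then obtain g where g: "g \<in> carrier G" "(c, act S g c) \<in> joined forest" "g \<noteq> \<one>" by blast
    have V: "u \<in> verts S" "v \<in> verts S" using S.edge_verts[OF uv(2)] by auto
    have fix_c: "act T g (k c) = k c" using joined_k[OF g(2)] k_act[OF g(1) c] by simp
    have "(c, act S g u) \<in> joined forest" using joined_trans[OF g(2) joined_act[OF uv(1) g(1)]] .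
    moreover have "{act S g u, act S g v} \<in> edges S" using S.act_edge[OF g(1) uv(2)] .
    moreover have "{act S g u, act S g v} \<notin> forest"
      using uv V k_act g(1) T.act_inj[OF g(1)] k_verts by (simp add: forest_iff)
    ultimately have "tree_geodesic T (k c) (k (act S g v)) ! 1 = y" by (rule one)
    moreover have "tree_geodesic T (k c) (k (act S g v)) = map (act T g) (tree_geodesic T (k c) (k v))"
      using T.geodesic_act[OF g(1), of "k c" "k v"] fix_c k_act[OF g(1) V(2)] k_verts V c by simp
    moreover have "1 < length (tree_geodesic T (k c) (k v))"
    proof -
      note p = T.geodesic_props[of "k c" "k v"]
      show ?thesis using p ne[OF uv] by (cases "tree_geodesic T (k c) (k v)" rule: remdups_adj.cases) auto
    qed
    ultimately have "act T g y = y" by (simp add: y_def)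
    then have "act T g ` {k c, y} = {k c, y}" using fix_c by simp
    then have "g = \<one>" by (rule T.edge_stab[OF g(1) y])
    then show False using g by simp
  qed
qed

text \<open>After the collapse the map is injective on edges, and the directions leaving a component become the
  directions at the vertex to which it is collapsed.\<close>

lemma foldable_collapse:
  assumes taut and q: "\<And>u v. u \<in> verts S \<Longrightarrow> v \<in> verts S \<Longrightarrow> q u = q v \<longleftrightarrow> (u, v) \<in> joined forest"
  obtains f where "foldable_map G (collapse_tree S q) T f" "\<And>v. v \<in> verts S \<Longrightarrow> f (q v) = k v"
proof -
  note A = forest_sub forest_inv q
  let ?S = "collapse_tree S q"
  define f where "f w = k (SOME v. v \<in> verts S \<and> q v = w)" for w
  have f: "f (q v) = k v" if v: "v \<in> verts S" for v
  proof -
    define u where "u = (SOME u. u \<in> verts S \<and> q u = q v)"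
    have "u \<in> verts S \<and> q u = q v" unfolding u_def by (rule someI[of _ v]) (use v in simp)
    then have "(u, v) \<in> joined forest" using q v by blast
    then show ?thesis unfolding f_def u_def by (rule joined_k)
  qed
  have verts: "verts ?S = q ` verts S" by (simp add: collapse_tree_def)
  have "foldable_map G ?S T f"
    unfolding foldable_map_def verts
  proof (intro conjI ballI allI impI)
    show "f ` q ` verts S \<subseteq> verts T" using f k_verts by auto
    fix g w assume g: "g \<in> carrier G" and "w \<in> q ` verts S"
    then obtain v where v: "v \<in> verts S" "w = q v" by blast
    then show "f (act ?S g w) = act T g (f w)"
      using S.act'[OF A g v(1)] f S.act_verts g k_act by simp
  next
    fix x y assume "{x, y} \<in> edges ?S"
    then obtain e where e: "e \<in> edges S" "e \<notin> forest" "{x, y} = q ` e" using S.edges'E[OF A] by metis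
    obtain a b where ab: "a \<in> verts S" "b \<in> verts S" "e = {a, b}" using S.edgeE[OF e(1)] by metis
    then have "k a \<noteq> k b" using e by (simp add: forest_iff)
    then show "f x \<noteq> f y" using e(3) ab f by (auto simp: doubleton_eq_iff)
  next
    fix w assume "w \<in> q ` verts S"
    then obtain c where c: "c \<in> verts S" "w = q c" by blast
    obtain u v u' v' where g: "(c, u) \<in> joined forest" "{u, v} \<in> edges S" "{u, v} \<notin> forest"
      "(c, u') \<in> joined forest" "{u', v'} \<in> edges S" "{u', v'} \<notin> forest"
      "tree_geodesic T (k c) (k v) ! 1 \<noteq> tree_geodesic T (k c) (k v') ! 1"
      using two_gates[OF assms(1) c(1)] by blast
    have dir: "q v \<in> directions ?S w \<and> f (q v) = k v" if "(c, u) \<in> joined forest" "{u, v} \<in> edges S" "{u, v} \<notin> forest" for u v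
    proof -
      have "u \<in> verts S" "v \<in> verts S" using S.edge_verts[OF that(2)] by auto
      moreover from this have "q u = w" using q[of c u] c that(1) by simp
      moreover have "{q u, q v} \<in> edges ?S" using S.edges'I[OF A that(2,3)] by simp
      ultimately show ?thesis using f verts by (simp add: directions_def)
    qed
    show "\<exists>x\<in>directions ?S w. \<exists>y\<in>directions ?S w. \<not> same_gate T f w x y"
      using dir[OF g(1-3)] dir[OF g(4-6)] g(7) f[OF c(1)] c(2) unfolding same_gate_def by metis
  qed
  then show thesis using that f by blast
qed

text \<open>The edges of two inequivalent natural edges are pairwise inequivalent, hence so are their preimages in
  \<open>S\<close>; their contribution to the total length is at least the length of the two images.\<close>

lemma two_natural_edges_length:
  assumes len: "invariant_lengths G T len" "normalized G T len"
    and q: "\<And>u v. u \<in> verts S \<Longrightarrow> v \<in> verts S \<Longrightarrow> q u = q v \<longleftrightarrow> (u, v) \<in> joined forest"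
    and f: "\<And>v. v \<in> verts S \<Longrightarrow> f (q v) = k v"
    and R: "transversal G (edges S) (\<lambda>g. (`) (act S g)) R"
    and E: "E1 \<in> natural_edges G (collapse_tree S q)" "E2 \<in> natural_edges G (collapse_tree S q)"
      "orbit G (translate (collapse_tree S q)) E1 \<noteq> orbit G (translate (collapse_tree S q)) E2"
    and full: "contains_full_subpaths G T (image_edges T f E1) n" "contains_full_subpaths G T (image_edges T f E2) n"
  shows "2 * real n \<le> sum (image_length len) R"
proof -
  note A = forest_sub forest_inv q
  let ?S = "collapse_tree S q"
  interpret S': splitting G ?S
    by unfold_locales (rule S.free_splitting_collapse[OF A forest_proper])
  have natural: "\<exists>v\<in>verts ?S. natural_vertex G ?S v"
  proof (rule ccontr)
    assume "\<not> ?thesis"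
    then have "E1 = edges ?S" "E2 = edges ?S" using S'.natural_edges_trivial E by blast+
    then show False using E(3) by simp
  qed
  have fin: "finite E1" "finite E2" using S'.finite_natural_edge[OF natural] E by auto
  have sub: "E1 \<subseteq> edges ?S" "E2 \<subseteq> edges ?S" using S'.natural_edge_sub E by auto
  have lenp: "\<And>d. d \<in> edges T \<Longrightarrow> 0 < len d" "\<And>d g. d \<in> edges T \<Longrightarrow> g \<in> carrier G \<Longrightarrow> len (act T g ` d) = len d"
    using len(1) by (auto simp: invariant_lengths_def)
  have disj: "e = d" if e: "e \<in> E1 \<union> E2" "d \<in> E1 \<union> E2" and g: "g \<in> carrier G" "act ?S g ` e = d" for e d g
  proof -
    obtain D D' where D: "D \<in> {E1, E2}" "D' \<in> {E1, E2}" "e \<in> D" "d \<in> D'" using e by blast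
    then have N: "D \<in> natural_edges G ?S" "D' \<in> natural_edges G ?S" using E by auto
    have "translate ?S g D = D'" using S'.act_image_natural[OF N g(1) D(3)] D(4) g(2) by simp
    then have "orbit G (translate ?S) D = orbit G (translate ?S) D'"
      using S.gset_orbit_act[OF S'.gset_natural N(1) g(1)] by simp
    then have "D = D'" using D(1,2) E(3) by auto
    then show ?thesis using S'.natural_edge_inequivalent[OF natural N(1) D(3)] D(4) g by blast
  qed
  have "\<forall>e'\<in>edges ?S. \<exists>e. e \<in> edges S \<and> e \<notin> forest \<and> e' = q ` e" using S.edges'E[OF A] by metis
  then obtain p where p: "\<And>e'. e' \<in> edges ?S \<Longrightarrow> p e' \<in> edges S \<and> p e' \<notin> forest \<and> e' = q ` p e'" by metis
  have im: "image_edges T f {e'} = image_edges T k {p e'}" if e': "e' \<in> edges ?S" for e'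
  proof -
    obtain a b where ab: "a \<in> verts S" "b \<in> verts S" "p e' = {a, b}" using S.edgeE p[OF e'] by metis
    then have "e' = {q a, q b}" using p[OF e'] by simp
    then have "image_edges T f {e'} = sep T (k a) (k b)"
      using T.image_edges_edge[of f "q a" "q b"] f ab k_verts by simp
    then show ?thesis using image_edge[of a b] p[OF e'] ab by simp
  qed
  have pe: "image_length len (p e') = sum len (image_edges T f {e'})" if "e' \<in> edges ?S" for e'
    using im[OF that] by (simp add: image_length_def)
  have im: "finite (image_edges T f {e'}) \<and> image_edges T f {e'} \<subseteq> edges T" if "e' \<in> edges ?S" for e'
    using im[OF that] image_edge_props p[OF that] by simp
  have bound: "real n \<le> (\<Sum>e'\<in>D. image_length len (p e'))"
    if D: "finite D" "D \<subseteq> edges ?S" and full: "contains_full_subpaths G T (image_edges T f D) n" for D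
  proof -
    have "finite (image_edges T f D)" "image_edges T f D \<subseteq> edges T"
      unfolding image_edges_UN[of T f D] using D im by blast+
    then have "real n \<le> sum len (image_edges T f D)"
      using T.contains_full_subpaths_length[OF len] full by blast
    also have "\<dots> \<le> (\<Sum>e'\<in>D. sum len (image_edges T f {e'}))"
      unfolding image_edges_UN[of T f D]
    proof (rule sum_UN_le[OF D(1)])
      fix e' assume e': "e' \<in> D"
      then show "finite (image_edges T f {e'})" using im D by blast
      fix d assume "d \<in> image_edges T f {e'}"
      then have "d \<in> edges T" using im D e' by blast
      then show "0 \<le> len d" using lenp(1) by (simp add: less_imp_le)
    qed
    also have "\<dots> = (\<Sum>e'\<in>D. image_length len (p e'))" by (rule sum.cong) (use pe D in auto)
    finally show ?thesis .
  qed
  have E12: "E1 \<inter> E2 = {}"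
  proof (rule ccontr)
    assume "E1 \<inter> E2 \<noteq> {}"
    then obtain e where "e \<in> E1" "e \<in> E2" by blast
    then have "E1 = E2" using S'.natural_edge_class E by metis
    then show False using E(3) by simp
  qed
  have "2 * real n \<le> (\<Sum>e'\<in>E1. image_length len (p e')) + (\<Sum>e'\<in>E2. image_length len (p e'))"
    using bound[OF fin(1) sub(1) full(1)] bound[OF fin(2) sub(2) full(2)] by simp
  also have "\<dots> = (\<Sum>e'\<in>E1 \<union> E2. image_length len (p e'))" by (rule sum.union_disjoint[symmetric]) (use fin E12 in auto)
  also have "\<dots> = sum (image_length len) (p ` (E1 \<union> E2))"
  proof -
    have "inj_on p (E1 \<union> E2)" by (rule inj_onI) (use p sub in \<open>metis UnE subsetD\<close>)
    then show ?thesis by (simp add: sum.reindex)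
  qed
  also have "\<dots> \<le> sum (image_length len) R"
  proof (rule S.transversal_sum_ge[OF S.gset_edges R])
    show "finite (p ` (E1 \<union> E2))" using fin by simp
    show "p ` (E1 \<union> E2) \<subseteq> edges S" using p sub by blast
    fix x y assume x: "x \<in> p ` (E1 \<union> E2)" and y: "y \<in> p ` (E1 \<union> E2)" and o: "y \<in> orbit G (\<lambda>g. (`) (act S g)) x"
    obtain e where e: "e \<in> E1 \<union> E2" "x = p e" using x by blast
    obtain d where d: "d \<in> E1 \<union> E2" "y = p d" using y by blast
    obtain g where g: "g \<in> carrier G" "y = act S g ` x" using o unfolding orbit_def by blast
    have eS: "e \<in> edges ?S" "d \<in> edges ?S" using e d sub by auto
    have "act ?S g ` q ` p e = q ` act S g ` p e"
      using S.act'_edge[OF A g(1) conjunct1[OF p[OF eS(1)]]] by simp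
    moreover have "q ` p e = e" "q ` p d = d" using p[OF eS(1)] p[OF eS(2)] by metis+
    moreover have "act S g ` p e = p d" using e d g by simp
    ultimately have "act ?S g ` e = d" by simp
    then have "e = d" using disj[OF e(1) d(1) g(1)] by simp
    then show "x = y" using e d by simp
  next
    show "0 \<le> image_length len x" if "x \<in> edges S" for x
      using image_length_nonneg[OF _ that] lenp(1) by (meson less_imp_le)
    show "image_length len (act S g ` x) = image_length len x" if "g \<in> carrier G" "x \<in> edges S" for g x
      using image_length_act[OF lenp(2) that] .
  qed
  finally show ?thesis .
qed

end

text \<open>Minimize the number of edges crossed among the maps of total length at most \<open>L\<close>: a map with smaller
  images would still satisfy the bound and cross fewer edges.\<close>

lemma taut_exists:
  assumes k: "vertex_map G S T k" and R: "transversal G (edges S) (\<lambda>g. (`) (act S g)) R"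
    and len: "\<And>d. d \<in> edges T \<Longrightarrow> 0 \<le> len d" and L: "sum (vertex_map.image_length T k len) R \<le> L"
  obtains k' where "vertex_map G S T k'" "vertex_map.taut G S T k'" "sum (vertex_map.image_length T k' len) R \<le> L"
proof -
  have RS: "finite R" "R \<subseteq> edges S" using R by (auto simp: transversal_def)
  define P where "P k \<longleftrightarrow> vertex_map G S T k \<and> (\<Sum>e\<in>R. sum len (image_edges T k {e})) \<le> L" for k
  define m where "m k = (\<Sum>e\<in>R. card (image_edges T k {e}))" for k
  have image_length: "vertex_map.image_length T k len e = sum len (image_edges T k {e})" if "vertex_map G S T k" for k e
    using vertex_map.image_length_def[OF that] .
  have "P k" using k L image_length unfolding P_def by simp
  then obtain k1 where k1: "P k1" and min: "\<And>k'. P k' \<Longrightarrow> m k1 \<le> m k'"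
    using ex_has_least_nat[of P k m] by blast
  have v1: "vertex_map G S T k1" using k1 by (simp add: P_def)
  interpret k1: vertex_map G S T k1 by (rule v1)
  have "k1.taut"
    unfolding k1.taut_def
  proof (intro allI impI ballI, elim conjE)
    fix k' e assume v': "vertex_map G S T k'" and sub: "\<forall>e\<in>edges S. image_edges T k' {e} \<subseteq> image_edges T k1 {e}"
      and e: "e \<in> edges S"
    interpret k': vertex_map G S T k' by (rule v')
    have "(\<Sum>e\<in>R. sum len (image_edges T k' {e})) \<le> (\<Sum>e\<in>R. sum len (image_edges T k1 {e}))"
    proof (rule sum_mono)
      fix e assume "e \<in> R"
      then have e: "e \<in> edges S" using RS by blast
      show "sum len (image_edges T k' {e}) \<le> sum len (image_edges T k1 {e})"
      proof (rule sum_mono2)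
        show "0 \<le> len d" if "d \<in> image_edges T k1 {e} - image_edges T k' {e}" for d
          using len that k1.image_edge_props(2)[OF e] by blast
      qed (use sub e k1.image_edge_props in blast)+
    qed
    then have "P k'" using v' k1 unfolding P_def by linarith
    then have le: "m k1 \<le> m k'" by (rule min)
    have cle: "card (image_edges T k' {d}) \<le> card (image_edges T k1 {d})" if "d \<in> R" for d
      using that RS sub k1.image_edge_props(1) by (intro card_mono) auto
    have eqR: "image_edges T k' {d} = image_edges T k1 {d}" if d: "d \<in> R" for d
    proof (rule ccontr)
      assume ne: "image_edges T k' {d} \<noteq> image_edges T k1 {d}"
      have dS: "d \<in> edges S" using d RS by blast
      then have "card (image_edges T k' {d}) < card (image_edges T k1 {d})"
        using ne sub k1.image_edge_props(1)[OF dS] by (intro psubset_card_mono) auto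
      then have "m k' < m k1" unfolding m_def using RS(1) cle d by (intro sum_strict_mono_ex1) auto
      then show False using le by simp
    qed
    obtain r where r: "r \<in> R" "r \<in> orbit G (\<lambda>g. (`) (act S g)) e" using R e unfolding transversal_def by blast
    then obtain g where g: "g \<in> carrier G" "r = act S g ` e" unfolding orbit_def by blast
    have e': "e = act S (inv\<^bsub>G\<^esub> g) ` r" using k1.S.gset_inv[OF k1.S.gset_edges g(1) e] g(2) by simp
    show "image_edges T k' {e} = image_edges T k1 {e}"
      unfolding e' using k1.image_edge_act[of "inv\<^bsub>G\<^esub> g" r] k'.image_edge_act[of "inv\<^bsub>G\<^esub> g" r] eqR[OF r(1)] r(1) RS g(1) by auto
  qed
  then show thesis using that[OF v1] k1 image_length[OF v1] unfolding P_def by simp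
qed

section \<open>Path metrics\<close>

text \<open>The set whose infimum is the path metric.\<close>

definition chain_lengths :: "('a, 'v) gtree \<Rightarrow> ('v set \<Rightarrow> real) \<Rightarrow> ('v \<Rightarrow> real) \<Rightarrow> ('v \<Rightarrow> real) \<Rightarrow> real set" where
  "chain_lengths T len x y = {(\<Sum>i<n. segment_length len (e i) (p i) (p (Suc i))) | n p e.
       p 0 = x \<and> p n = y \<and>
       (\<forall>i<n::nat. e i \<in> edges T \<and> p i \<in> cell (e i) \<and> p (Suc i) \<in> cell (e i))}"

lemma tree_dist_eq: "tree_dist T len x y = Inf (chain_lengths T len x y)"
  by (simp add: tree_dist_def chain_lengths_def)

lemma chain_refl: "0 \<in> chain_lengths T len x x"
  unfolding chain_lengths_def by (rule CollectI, rule exI[of _ 0], rule exI[of _ "\<lambda>_. x"]) auto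

lemma chain_step:
  assumes "s \<in> chain_lengths T len x y" "e \<in> edges T" "y \<in> cell e" "z \<in> cell e"
  shows "s + segment_length len e y z \<in> chain_lengths T len x z"
proof -
  obtain n p d where c: "s = (\<Sum>i<n. segment_length len (d i) (p i) (p (Suc i)))" "p 0 = x" "p n = y"
    "\<And>i. i < n \<Longrightarrow> d i \<in> edges T \<and> p i \<in> cell (d i) \<and> p (Suc i) \<in> cell (d i)"
    using assms(1) unfolding chain_lengths_def by auto
  define p' where "p' = p(Suc n := z)"
  define d' where "d' = d(n := e)"
  have "(\<Sum>i<n. segment_length len (d' i) (p' i) (p' (Suc i))) = s"
    unfolding c(1) by (rule sum.cong) (auto simp: p'_def d'_def)
  then have "s + segment_length len e y z = (\<Sum>i<Suc n. segment_length len (d' i) (p' i) (p' (Suc i)))"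
    using c(3) by (simp add: p'_def d'_def)
  moreover have "p' 0 = x" "p' (Suc n) = z" using c by (auto simp: p'_def)
  moreover have "\<forall>i<Suc n. d' i \<in> edges T \<and> p' i \<in> cell (d' i) \<and> p' (Suc i) \<in> cell (d' i)"
    using c(3,4) assms by (auto simp: p'_def d'_def less_Suc_eq)
  ultimately show ?thesis unfolding chain_lengths_def by blast
qed

text \<open>Chains can be built and taken apart one segment at a time.\<close>

lemma chain_induct [consumes 1, case_names refl step]:
  assumes "s \<in> chain_lengths T len x z"
    and refl: "P 0 x"
    and step: "\<And>s y z e. P s y \<Longrightarrow> s \<in> chain_lengths T len x y \<Longrightarrow> e \<in> edges T \<Longrightarrow> y \<in> cell e \<Longrightarrow> z \<in> cell e \<Longrightarrow>
      P (s + segment_length len e y z) z"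
  shows "P s z"
proof -
  obtain n p d where c: "s = (\<Sum>i<n. segment_length len (d i) (p i) (p (Suc i)))" "p 0 = x" "p n = z"
    "\<And>i. i < n \<Longrightarrow> d i \<in> edges T \<and> p i \<in> cell (d i) \<and> p (Suc i) \<in> cell (d i)"
    using assms(1) unfolding chain_lengths_def by auto
  have "m \<le> n \<Longrightarrow> P (\<Sum>i<m. segment_length len (d i) (p i) (p (Suc i))) (p m) \<and>
      (\<Sum>i<m. segment_length len (d i) (p i) (p (Suc i))) \<in> chain_lengths T len x (p m)" for m
  proof (induction m)
    case 0
    then show ?case using refl c(2) chain_refl[of T len x] by simp
  next
    case (Suc m)
    then have "P (\<Sum>i<m. segment_length len (d i) (p i) (p (Suc i))) (p m)"
      "(\<Sum>i<m. segment_length len (d i) (p i) (p (Suc i))) \<in> chain_lengths T len x (p m)" by auto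
    then show ?case using step[of _ "p m" "d m" "p (Suc m)"] chain_step[of _ T len x "p m" "d m" "p (Suc m)"] c(4)[of m] Suc.prems
      by simp
  qed
  then show ?thesis using c by auto
qed

lemma segment_length_seg:
  assumes "a \<noteq> b" shows "segment_length len {a, b} (seg a b s) (seg a b t) = len {a, b} * \<bar>s - t\<bar>"
  using assms by (simp add: segment_length_def seg_def abs_minus_commute)

context splitting
begin

context
  fixes len
  assumes len: "invariant_lengths G T len"
begin

lemma pos: "e \<in> edges T \<Longrightarrow> 0 < len e" and inv_len: "e \<in> edges T \<Longrightarrow> g \<in> carrier G \<Longrightarrow> len (act T g ` e) = len e"
  using len by (auto simp: invariant_lengths_def)

lemma segment_nonneg: "e \<in> edges T \<Longrightarrow> 0 \<le> segment_length len e x y"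
  unfolding segment_length_def using pos by (simp add: less_imp_le sum_nonneg)

lemma chain_nonneg: "s \<in> chain_lengths T len x y \<Longrightarrow> 0 \<le> s"
proof (induction rule: chain_induct)
  case (step s y z e)
  then show ?case using segment_nonneg[of e y z] by simp
qed simp

lemma bdd_below_chains: "bdd_below (chain_lengths T len x y)"
  using chain_nonneg by (meson bdd_below.I)

lemma chain_exists:
  assumes x: "x \<in> realization T" and y: "y \<in> realization T"
  shows "chain_lengths T len x y \<noteq> {}"
proof -
  obtain a b s where A: "a \<in> verts T" "b \<in> verts T" "a \<noteq> b" "{a, b} \<in> edges T" "0 \<le> s" "s \<le> 1" "x = seg a b s"
    using realizationE[OF x] by metis
  obtain c d t where B: "c \<in> verts T" "d \<in> verts T" "c \<noteq> d" "{c, d} \<in> edges T" "0 \<le> t" "t \<le> 1" "y = seg c d t"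
    using realizationE[OF y] by metis
  have vp: "vertex_point u \<in> cell {u, v}" "vertex_point v \<in> cell {u, v}" for u v :: 'v
    using vertex_point_in_cell_iff by (metis finite.emptyI finite.insertI insertI1 insert_commute)+
  have start: "chain_lengths T len x (vertex_point a) \<noteq> {}"
    using chain_step[OF chain_refl[of T len x] A(4) _ vp(1)] seg_in_cell[OF A(5,6,3)] A(7) by blast
  have "chain_lengths T len x (vertex_point c) \<noteq> {}"
    using A(1) B(1)
  proof (induction rule: walk_induct)
    case (step v w)
    then obtain s where "s \<in> chain_lengths T len x (vertex_point v)" by blast
    then show ?case using chain_step[OF _ step(3) vp(1) vp(2)] by blast
  qed (rule start)
  then obtain s where s: "s \<in> chain_lengths T len x (vertex_point c)" by blast
  show ?thesis using chain_step[OF s B(4) vp(1)] seg_in_cell[OF B(5,6,3)] B(7) by blast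
qed

lemma tree_dist_le: "s \<in> chain_lengths T len x y \<Longrightarrow> tree_dist T len x y \<le> s"
  unfolding tree_dist_eq using bdd_below_chains by (rule cInf_lower[rotated])

lemma tree_dist_nonneg: "x \<in> realization T \<Longrightarrow> y \<in> realization T \<Longrightarrow> 0 \<le> tree_dist T len x y"
  unfolding tree_dist_eq using chain_exists chain_nonneg by (intro cInf_greatest) auto

lemma tree_dist_self: "x \<in> realization T \<Longrightarrow> tree_dist T len x x = 0"
  using tree_dist_le[OF chain_refl] tree_dist_nonneg by (simp add: antisym)

lemma tree_dist_ge:
  assumes "x \<in> realization T" "y \<in> realization T" "\<And>s. s \<in> chain_lengths T len x y \<Longrightarrow> c \<le> s"
  shows "c \<le> tree_dist T len x y"
  unfolding tree_dist_eq using chain_exists assms by (intro cInf_greatest) auto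

lemma tree_dist_segment: "e \<in> edges T \<Longrightarrow> y \<in> cell e \<Longrightarrow> z \<in> cell e \<Longrightarrow> tree_dist T len y z \<le> segment_length len e y z"
  using tree_dist_le[OF chain_step[OF chain_refl]] by simp

lemma chain_trans:
  assumes s: "s \<in> chain_lengths T len x y" and "t \<in> chain_lengths T len y z"
  shows "s + t \<in> chain_lengths T len x z"
  using assms(2)
proof (induction rule: chain_induct)
  case (step t y z e)
  then show ?case using chain_step[of "s + t" T len x y e z] by (simp add: add.assoc)
qed (use s in simp)

lemma tree_dist_triangle:
  assumes "x \<in> realization T" "y \<in> realization T" "z \<in> realization T"
  shows "tree_dist T len x z \<le> tree_dist T len x y + tree_dist T len y z"
proof -
  have "tree_dist T len x z - t \<le> tree_dist T len x y" if "t \<in> chain_lengths T len y z" for t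
  proof (rule tree_dist_ge[OF assms(1,2)])
    fix s assume s: "s \<in> chain_lengths T len x y"
    show "tree_dist T len x z - t \<le> s" using tree_dist_le[OF chain_trans[OF s that]] by simp
  qed
  then have "tree_dist T len x z - tree_dist T len x y \<le> tree_dist T len y z"
    by (intro tree_dist_ge[OF assms(2,3)]) (simp add: algebra_simps)
  then show ?thesis by simp
qed

end

section \<open>Rounding points to vertices\<close>

lemma heads_exist: "\<exists>head. (\<forall>e\<in>edges T. head e \<in> e) \<and> (\<forall>g\<in>carrier G. \<forall>e\<in>edges T. head (act T g ` e) = act T g (head e))"
proof -
  have "\<exists>v\<in>verts T. v \<in> e \<and> (\<forall>g\<in>carrier G. act T g ` e = e \<longrightarrow> act T g v = v)" if e: "e \<in> edges T" for e
  proof -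
    obtain a b where ab: "a \<in> verts T" "e = {a, b}" using edgeE[OF e] by metis
    moreover have "act T g a = a" if "g \<in> carrier G" "act T g ` e = e" for g
      using edge_stab[OF that(1) e that(2)] act_one ab by simp
    ultimately show ?thesis by blast
  qed
  note ex = this
  show ?thesis
  proof (rule equivariant_choice[OF gset_edges gset_verts, of "\<lambda>e v. v \<in> e"])
    show "\<exists>v\<in>verts T. v \<in> e \<and> (\<forall>g\<in>carrier G. act T g ` e = e \<longrightarrow> act T g v = v)" if "e \<in> edges T" for e
      using ex[OF that] .
    fix k assume "\<And>e. e \<in> edges T \<Longrightarrow> k e \<in> e"
      "\<And>g e. g \<in> carrier G \<Longrightarrow> e \<in> edges T \<Longrightarrow> k (act T g ` e) = act T g (k e)"
    then show ?thesis by blast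
  qed simp
qed

text \<open>An orientation of the edges that is invariant under the group; it exists because no edge is inverted.\<close>

definition head where
  "head = (SOME head. (\<forall>e\<in>edges T. head e \<in> e) \<and> (\<forall>g\<in>carrier G. \<forall>e\<in>edges T. head (act T g ` e) = act T g (head e)))"

lemma head: "e \<in> edges T \<Longrightarrow> head e \<in> e" "g \<in> carrier G \<Longrightarrow> e \<in> edges T \<Longrightarrow> head (act T g ` e) = act T g (head e)"
  using someI_ex[OF heads_exist] unfolding head_def by auto

text \<open>At a vertex the choice of the edge is irrelevant: for levels in \<open>[0, 1)\<close> all edges there round it to
  itself.\<close>

definition round_at :: "real \<Rightarrow> ('v \<Rightarrow> real) \<Rightarrow> 'v" where
  "round_at \<theta> x = (SOME w. \<exists>e\<in>edges T. x \<in> cell e \<and> w \<in> e \<and> (w = head e \<longleftrightarrow> \<theta> < x (head e)))"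

lemma oriented_edge:
  assumes "e \<in> edges T"
  obtains a where "a \<in> verts T" "head e \<in> verts T" "a \<noteq> head e" "e = {a, head e}"
proof -
  obtain a b where ab: "a \<in> verts T" "b \<in> verts T" "a \<noteq> b" "e = {a, b}" using edgeE[OF assms] by metis
  have "head e = a \<or> head e = b" using head(1)[OF assms] ab by simp
  then show thesis using that[of a] that[of b] ab by (auto simp: insert_commute)
qed

text \<open>The level \<open>1\<close> is excluded so that a vertex which is the head of an edge is rounded to itself.\<close>

lemma round_at_seg:
  assumes e: "{a, b} \<in> edges T" "head {a, b} = b" and s: "0 \<le> s" "s \<le> 1" and \<theta>: "0 \<le> \<theta>" "\<theta> < 1"
  shows "round_at \<theta> (seg a b s) = (if \<theta> < s then b else a)"
proof -
  have ab: "a \<noteq> b" using edge_verts e by blast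
  have sb: "seg a b s b = s" using ab by (simp add: seg_def)
  define r where "r = (if \<theta> < s then b else a)"
  have ex: "\<exists>d\<in>edges T. seg a b s \<in> cell d \<and> r \<in> d \<and> (r = head d \<longleftrightarrow> \<theta> < seg a b s (head d))"
    using e ab s sb by (intro bexI[of _ "{a, b}"]) (auto simp: r_def seg_in_cell)
  have uniq: "w = r" if w: "d \<in> edges T" "seg a b s \<in> cell d" "w \<in> d" "w = head d \<longleftrightarrow> \<theta> < seg a b s (head d)" for w d
  proof -
    obtain c where c: "c \<noteq> head d" "d = {c, head d}" using oriented_edge[OF w(1)] by metis
    define h where "h = head d"
    have wh: "w = (if \<theta> < seg a b s h then h else c)" using w(3,4) c unfolding h_def by auto
    have supp: "seg a b s v = 0" if "v \<noteq> c" "v \<noteq> h" for v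
      using w(2) c(2) that unfolding cell_def h_def by auto
    have dh: "d = {c, h}" using c(2) unfolding h_def .
    consider "0 < s" "s < 1" | "s = 0" | "s = 1" using s by linarith
    then show ?thesis
    proof cases
      case 1
      then have "a \<in> {c, h}" "b \<in> {c, h}" using supp[of a] supp[of b] ab by (auto simp: seg_def split: if_splits)
      then have "{c, h} = {a, b}" using ab by auto
      then have "d = {a, b}" using dh by simp
      then have "h = b" using e(2) unfolding h_def by simp
      moreover from this have "c = a" using \<open>{c, h} = {a, b}\<close> c(1) by (auto simp: doubleton_eq_iff h_def)
      ultimately have "h = b" "c = a" by auto
      then show ?thesis using wh sb by (simp add: r_def)
    next
      case 2
      then have "a = c \<or> a = h" using supp[of a] ab by (auto simp: seg_def)
      moreover have "seg a b s h = (if h = a then 1 else 0)" using 2 by (auto simp: seg_def)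
      ultimately show ?thesis using wh 2 \<theta> c by (auto simp: r_def h_def)
    next
      case 3
      then have "b = c \<or> b = h" using supp[of b] ab by (auto simp: seg_def)
      moreover have "seg a b s h = (if h = b then 1 else 0)" using 3 by (auto simp: seg_def)
      ultimately show ?thesis using wh 3 \<theta> c by (auto simp: r_def h_def)
    qed
  qed
  have "round_at \<theta> (seg a b s) = r"
    unfolding round_at_def by (rule some_equality) (use ex uniq in blast)+
  then show ?thesis by (simp add: r_def)
qed

lemma oriented_cellE:
  assumes "e \<in> edges T" "x \<in> cell e"
  obtains a b s where "e = {a, b}" "head e = b" "a \<in> verts T" "b \<in> verts T" "a \<noteq> b" "0 \<le> s" "s \<le> 1" "x = seg a b s"
proof -
  obtain a where a: "a \<in> verts T" "head e \<in> verts T" "a \<noteq> head e" "e = {a, head e}" using oriented_edge assms(1) by metis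
  then have "x \<in> cell {a, head e}" using assms(2) by simp
  then obtain s where "0 \<le> s" "s \<le> 1" "x = seg a (head e) s" using cell_seg[OF a(3)] by auto
  then show thesis using that a by metis
qed

lemma oriented_realizationE:
  assumes "x \<in> realization T"
  obtains a b s where "{a, b} \<in> edges T" "head {a, b} = b" "a \<in> verts T" "b \<in> verts T" "a \<noteq> b" "0 \<le> s" "s \<le> 1" "x = seg a b s"
proof -
  obtain e where e: "e \<in> edges T" "x \<in> cell e" using assms unfolding realization_eq by blast
  then show thesis using oriented_cellE[OF e] that by metis
qed

lemma round_at_verts: "x \<in> realization T \<Longrightarrow> 0 \<le> \<theta> \<Longrightarrow> \<theta> < 1 \<Longrightarrow> round_at \<theta> x \<in> verts T"
  using oriented_realizationE round_at_seg by metis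

lemma round_at_act:
  assumes g: "g \<in> carrier G" and x: "x \<in> realization T" and \<theta>: "0 \<le> \<theta>" "\<theta> < 1"
  shows "round_at \<theta> (point_act G T g x) = act T g (round_at \<theta> x)"
proof -
  obtain a b s where A: "{a, b} \<in> edges T" "head {a, b} = b" "a \<in> verts T" "b \<in> verts T" "0 \<le> s" "s \<le> 1" "x = seg a b s"
    using oriented_realizationE[OF x] by metis
  have "head {act T g a, act T g b} = act T g b" using head(2)[OF g A(1)] A(2) by simp
  then show ?thesis
    using round_at_seg[OF A(1,2,5,6) \<theta>] round_at_seg[OF act_edge[OF g A(1)] _ A(5,6) \<theta>]
      point_act_seg[OF g A(3,4)] A(7) by simp
qed

definition vdist :: "('v set \<Rightarrow> real) \<Rightarrow> 'v \<Rightarrow> 'v \<Rightarrow> real" where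
  "vdist len u v = sum len (sep T u v)"

text \<open>The levels carry the uniform distribution.\<close>

abbreviation (input) "levels \<equiv> restrict_space lborel {0..<1::real}"

lemma space_levels: "space levels = {0..<1}" and finite_levels: "finite_measure levels"
  and emeasure_levels: "emeasure levels (space levels) = 1"
  by (auto simp: space_restrict_space emeasure_restrict_space intro!: finite_measureI)

context
  fixes len
  assumes len: "invariant_lengths G T len"
begin

lemma vdist_triangle:
  assumes "u \<in> verts T" "v \<in> verts T" "w \<in> verts T"
  shows "vdist len u w \<le> vdist len u v + vdist len v w"
proof -
  have pos: "0 \<le> len e" if "e \<in> sep T u v \<union> sep T v w" for e
    using that sep_edges assms pos[OF len] by (meson Un_iff less_imp_le subsetD)
  have "vdist len u w \<le> sum len (sep T u v \<union> sep T v w)"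
    unfolding vdist_def sep_triangle[OF assms] by (rule sum_mono2) (use finite_sep pos in auto)
  also have "\<dots> \<le> vdist len u v + vdist len v w"
    unfolding vdist_def
    using sum.union_inter[of "sep T u v" "sep T v w" len] finite_sep sum_nonneg[of "sep T u v \<inter> sep T v w" len] pos
    by fastforce
  finally show ?thesis .
qed

lemma round_vdist_integrable:
  assumes x: "x \<in> realization T" and y: "y \<in> realization T"
  shows "integrable levels (\<lambda>\<theta>. vdist len (round_at \<theta> x) (round_at \<theta> y))"
proof -
  obtain a b s where A: "{a, b} \<in> edges T" "head {a, b} = b" "0 \<le> s" "s \<le> 1" "x = seg a b s"
    using oriented_realizationE[OF x] by metis
  obtain c d t where B: "{c, d} \<in> edges T" "head {c, d} = d" "0 \<le> t" "t \<le> 1" "y = seg c d t"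
    using oriented_realizationE[OF y] by metis
  define D where "D \<theta> = (if \<theta> < s then (if \<theta> < t then vdist len b d else vdist len b c)
    else (if \<theta> < t then vdist len a d else vdist len a c))" for \<theta>
  interpret finite_measure levels by (rule finite_levels)
  have "integrable levels D"
  proof (rule integrable_const_bound)
    show "AE \<theta> in levels. norm (D \<theta>) \<le> \<bar>vdist len b d\<bar> + \<bar>vdist len b c\<bar> + \<bar>vdist len a d\<bar> + \<bar>vdist len a c\<bar>"
      by (rule AE_I2) (auto simp: D_def)
    show "D \<in> borel_measurable levels"
      unfolding D_def by (rule measurable_restrict_space1) measurable
  qed
  moreover have "vdist len (round_at \<theta> x) (round_at \<theta> y) = D \<theta>" if "\<theta> \<in> space levels" for \<theta>
    using that round_at_seg[OF A(1-4)] round_at_seg[OF B(1-4)] A(5) B(5) unfolding space_levels D_def by simp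
  ultimately show ?thesis
    using Bochner_Integration.integrable_cong[OF refl, of levels "\<lambda>\<theta>. vdist len (round_at \<theta> x) (round_at \<theta> y)" D] by blast
qed

lemma round_vdist_segment:
  assumes e: "e \<in> edges T" "x \<in> cell e" "y \<in> cell e"
  shows "(\<integral>\<theta>. vdist len (round_at \<theta> x) (round_at \<theta> y) \<partial>levels) = segment_length len e x y"
proof -
  obtain a b s where A: "e = {a, b}" "head e = b" "a \<in> verts T" "b \<in> verts T" "a \<noteq> b" "0 \<le> s" "s \<le> 1" "x = seg a b s"
    using oriented_cellE[OF e(1,2)] by metis
  then obtain t where B: "0 \<le> t" "t \<le> 1" "y = seg a b t" using cell_seg[OF A(5)] e(3) by auto
  have E: "{a, b} \<in> edges T" "head {a, b} = b" using A e by auto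
  have "vdist len (round_at \<theta> x) (round_at \<theta> y) = len e * indicator {min s t..<max s t} \<theta>" if "\<theta> \<in> space levels" for \<theta>
    using that round_at_seg[OF E A(6,7)] round_at_seg[OF E B(1,2)] A B e sep_edge[of a b] sep_commute[of a b]
    unfolding space_levels vdist_def by (auto simp: indicator_def)
  then have "(\<integral>\<theta>. vdist len (round_at \<theta> x) (round_at \<theta> y) \<partial>levels) = (\<integral>\<theta>. len e * indicator {min s t..<max s t} \<theta> \<partial>levels)"
    by (intro Bochner_Integration.integral_cong) auto
  also have "\<dots> = len e * measure levels {min s t..<max s t}"
  proof -
    have "{min s t..<max s t} \<inter> space levels = {min s t..<max s t}" using A(6,7) B(1,2) by (auto simp: space_levels)
    then show ?thesis by simp
  qed
  also have "measure levels {min s t..<max s t} = \<bar>s - t\<bar>"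
  proof -
    have "{min s t..<max s t} \<subseteq> {0..<1}" using A(6,7) B(1,2) by auto
    then have "measure levels {min s t..<max s t} = measure lborel {min s t..<max s t}"
      by (intro measure_restrict_space) auto
    then show ?thesis by (simp add: abs_real_def max_def min_def)
  qed
  finally show ?thesis using segment_length_seg[OF A(5)] A(1,8) B(3) by simp
qed

text \<open>Equality holds for two points of an edge, and the triangle inequality extends the bound to chains.\<close>

lemma round_vdist_le:
  assumes x: "x \<in> realization T" and y: "y \<in> realization T"
  shows "(\<integral>\<theta>. vdist len (round_at \<theta> x) (round_at \<theta> y) \<partial>levels) \<le> tree_dist T len x y"
proof (rule tree_dist_ge[OF len x y])
  fix s assume "s \<in> chain_lengths T len x y"
  then have "(\<integral>\<theta>. vdist len (round_at \<theta> x) (round_at \<theta> y) \<partial>levels) \<le> s \<and> y \<in> realization T"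
  proof (induction rule: chain_induct)
    case refl
    have "(\<integral>\<theta>. vdist len (round_at \<theta> x) (round_at \<theta> x) \<partial>levels) = (\<integral>\<theta>. 0 \<partial>levels)"
      by (rule Bochner_Integration.integral_cong) (use round_at_verts[OF x] in \<open>auto simp: space_levels vdist_def\<close>)
    then show ?case using x by simp
  next
    case (step s y z e)
    have yz: "y \<in> realization T" "z \<in> realization T" using step unfolding realization_eq by auto
    have "(\<integral>\<theta>. vdist len (round_at \<theta> x) (round_at \<theta> z) \<partial>levels) \<le>
      (\<integral>\<theta>. vdist len (round_at \<theta> x) (round_at \<theta> y) + vdist len (round_at \<theta> y) (round_at \<theta> z) \<partial>levels)"
    proof (rule integral_mono)
      show "vdist len (round_at \<theta> x) (round_at \<theta> z) \<le> vdist len (round_at \<theta> x) (round_at \<theta> y) + vdist len (round_at \<theta> y) (round_at \<theta> z)"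
        if "\<theta> \<in> space levels" for \<theta>
        by (rule vdist_triangle) (use that round_at_verts x yz in \<open>auto simp: space_levels\<close>)
    qed (use round_vdist_integrable x yz in auto)
    also have "\<dots> = (\<integral>\<theta>. vdist len (round_at \<theta> x) (round_at \<theta> y) \<partial>levels) + segment_length len e y z"
      using round_vdist_integrable x yz round_vdist_segment[OF step(3-5)] by (subst Bochner_Integration.integral_add) auto
    finally show ?case using step yz by simp
  qed
  then show "(\<integral>\<theta>. vdist len (round_at \<theta> x) (round_at \<theta> y) \<partial>levels) \<le> s" by simp
qed

end

end

text \<open>The expected total length at a random level is at most \<open>L\<close> times the volume of \<open>S\<close>, so some level
  does not exceed this bound.\<close>

lemma rounded_map:
  assumes S: "splitting G S" and T: "splitting G T"
    and lS: "invariant_lengths G S lS" and lT: "invariant_lengths G T lT"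
    and h: "equivariant_map G S T h" and L: "0 \<le> L"
    and lip: "\<And>x y. x \<in> realization S \<Longrightarrow> y \<in> realization S \<Longrightarrow> tree_dist T lT (h x) (h y) \<le> L * tree_dist S lS x y"
    and R: "transversal G (edges S) (\<lambda>g. (`) (act S g)) R"
  obtains k where "vertex_map G S T k" "sum (vertex_map.image_length T k lT) R \<le> L * sum lS R"
proof -
  interpret S: splitting G S by (rule S)
  interpret T: splitting G T by (rule T)
  have RS: "finite R" "R \<subseteq> edges S" using R by (auto simp: transversal_def)
  define k where "k \<theta> v = T.round_at \<theta> (h (vertex_point v))" for \<theta> v
  have hV: "h (vertex_point v) \<in> realization T" if "v \<in> verts S" for v
    using h S.vertex_point_realization[OF that] unfolding equivariant_map_def by blast
  have vm: "vertex_map G S T (k \<theta>)" if \<theta>: "0 \<le> \<theta>" "\<theta> < 1" for \<theta>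
  proof unfold_locales
    show "k \<theta> v \<in> verts T" if "v \<in> verts S" for v
      unfolding k_def using T.round_at_verts[OF hV[OF that] \<theta>] .
    fix g v assume g: "g \<in> carrier G" and v: "v \<in> verts S"
    have "point_act G S g (vertex_point v) = vertex_point (act S g v)"
      using S.point_act_seg[OF g v v, of 0] by simp
    then have "h (vertex_point (act S g v)) = point_act G T g (h (vertex_point v))"
      using h g S.vertex_point_realization[OF v] unfolding equivariant_map_def by metis
    then show "k \<theta> (act S g v) = act T g (k \<theta> v)"
      unfolding k_def using T.round_at_act[OF g hV[OF v] \<theta>] by simp
  qed
  have "\<forall>e\<in>edges S. \<exists>a b. e = {a, b}" using S.edgeE by metis
  then obtain a b where ab: "\<And>e. e \<in> edges S \<Longrightarrow> e = {a e, b e}" by metis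
  have abV: "a e \<in> verts S" "b e \<in> verts S" "a e \<noteq> b e" "{a e, b e} \<in> edges S" if "e \<in> edges S" for e
    using S.edge_verts[of "a e" "b e"] ab[OF that] that by auto
  define \<Phi> where "\<Phi> \<theta> = (\<Sum>e\<in>R. T.vdist lT (k \<theta> (a e)) (k \<theta> (b e)))" for \<theta>
  have image_length: "sum (vertex_map.image_length T (k \<theta>) lT) R = \<Phi> \<theta>" if \<theta>: "0 \<le> \<theta>" "\<theta> < 1" for \<theta>
    unfolding \<Phi>_def
  proof (rule sum.cong)
    fix e assume "e \<in> R"
    then have e: "e \<in> edges S" using RS by blast
    have "image_edges T (k \<theta>) {e} = sep T (k \<theta> (a e)) (k \<theta> (b e))"
      using vertex_map.image_edge[OF vm[OF \<theta>] abV(4)[OF e]] ab[OF e] by simp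
    then show "vertex_map.image_length T (k \<theta>) lT e = T.vdist lT (k \<theta> (a e)) (k \<theta> (b e))"
      by (simp add: vertex_map.image_length_def[OF vm[OF \<theta>]] T.vdist_def)
  qed simp
  have int: "integrable (restrict_space lborel {0..<1::real}) (\<lambda>\<theta>. T.vdist lT (k \<theta> (a e)) (k \<theta> (b e)))" if "e \<in> R" for e
    unfolding k_def by (rule T.round_vdist_integrable[OF lT]) (use that RS abV hV in auto)
  have int\<Phi>: "integrable (restrict_space lborel {0..<1::real}) \<Phi>"
    unfolding \<Phi>_def using int by (rule Bochner_Integration.integrable_sum)
  have "(\<integral>\<theta>. \<Phi> \<theta> \<partial>restrict_space lborel {0..<1::real}) = (\<Sum>e\<in>R. \<integral>\<theta>. T.vdist lT (k \<theta> (a e)) (k \<theta> (b e)) \<partial>restrict_space lborel {0..<1::real})"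
    unfolding \<Phi>_def using int by (rule Bochner_Integration.integral_sum)
  also have "\<dots> \<le> (\<Sum>e\<in>R. L * lS e)"
  proof (rule sum_mono)
    fix e assume "e \<in> R"
    then have e: "e \<in> edges S" using RS by blast
    have "(\<integral>\<theta>. T.vdist lT (k \<theta> (a e)) (k \<theta> (b e)) \<partial>restrict_space lborel {0..<1::real})
      \<le> tree_dist T lT (h (vertex_point (a e))) (h (vertex_point (b e)))"
      unfolding k_def by (rule T.round_vdist_le[OF lT]) (use abV[OF e] hV in auto)
    also have "\<dots> \<le> L * tree_dist S lS (vertex_point (a e)) (vertex_point (b e))"
      by (rule lip) (use abV[OF e] S.vertex_point_realization in auto)
    also have "\<dots> \<le> L * lS e"
    proof (rule mult_left_mono[OF _ L])
      have "tree_dist S lS (vertex_point (a e)) (vertex_point (b e)) \<le> segment_length lS {a e, b e} (vertex_point (a e)) (vertex_point (b e))"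
        by (rule S.tree_dist_segment[OF lS abV(4)[OF e]]) (auto simp: vertex_point_in_cell_iff)
      also have "\<dots> = lS e" using segment_length_seg[OF abV(3)[OF e], of lS 0 1] ab[OF e] by simp
      finally show "tree_dist S lS (vertex_point (a e)) (vertex_point (b e)) \<le> lS e" .
    qed
    finally show "(\<integral>\<theta>. T.vdist lT (k \<theta> (a e)) (k \<theta> (b e)) \<partial>restrict_space lborel {0..<1::real}) \<le> L * lS e" .
  qed
  also have "\<dots> = L * sum lS R" by (simp add: sum_distrib_left)
  finally have le: "(\<integral>\<theta>. \<Phi> \<theta> \<partial>restrict_space lborel {0..<1::real}) \<le> L * sum lS R" .
  have "\<exists>\<theta>\<in>{0..<1}. \<Phi> \<theta> \<le> L * sum lS R"
  proof (rule ccontr)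
    assume "\<not> ?thesis"
    then have gt: "\<And>\<theta>. \<theta> \<in> {0..<1} \<Longrightarrow> L * sum lS R < \<Phi> \<theta>" by force
    interpret M: finite_measure "restrict_space lborel {0..<1::real}" by (rule T.finite_levels)
    have "(\<integral>\<theta>. L * sum lS R \<partial>restrict_space lborel {0..<1::real}) < (\<integral>\<theta>. \<Phi> \<theta> \<partial>restrict_space lborel {0..<1::real})"
      by (rule M.integral_less_AE_space) (use gt int\<Phi> T.emeasure_levels in \<open>auto simp: T.space_levels\<close>)
    moreover have "measure (restrict_space lborel {0..<1::real}) (space (restrict_space lborel {0..<1::real})) = 1"
      using T.emeasure_levels by (simp add: measure_def)
    ultimately show False using le by simp
  qed
  then obtain \<theta> where "0 \<le> \<theta>" "\<theta> < 1" "\<Phi> \<theta> \<le> L * sum lS R" by auto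
  then show thesis using that[OF vm] image_length by simp
qed

section \<open>Linear extension of vertex maps\<close>

text \<open>The point at distance \<open>t\<close> from the start of \<open>p\<close>, for edges of length \<open>1\<close>. Written as a sum of hat functions
  it is visibly compatible with reversal and with the group action.\<close>

definition path_point :: "'v list \<Rightarrow> real \<Rightarrow> 'v \<Rightarrow> real" where
  "path_point p t = (\<lambda>w. \<Sum>i<length p. if p ! i = w then max 0 (1 - \<bar>t - real i\<bar>) else 0)"

lemma path_point_single [simp]: "path_point [a] 0 = vertex_point a"
  by (auto simp: path_point_def vertex_point_def)

lemma path_point_seg:
  assumes "Suc i < length p" "real i \<le> t" "t \<le> real i + 1"
  shows "path_point p t = seg (p ! i) (p ! Suc i) (t - real i)"
proof
  fix w
  let ?f = "\<lambda>j. if p ! j = w then max 0 (1 - \<bar>t - real j\<bar>) else 0"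
  have "path_point p t w = sum ?f {i, Suc i}"
    unfolding path_point_def
  proof (rule sum.mono_neutral_right)
    show "\<forall>j\<in>{..<length p} - {i, Suc i}. ?f j = 0"
    proof
      fix j assume "j \<in> {..<length p} - {i, Suc i}"
      then have "j + 1 \<le> i \<or> i + 2 \<le> j" by auto
      then have "real j + 1 \<le> real i \<or> real i + 2 \<le> real j" by linarith
      then have "1 \<le> \<bar>t - real j\<bar>" using assms by linarith
      then show "?f j = 0" by simp
    qed
  qed (use assms in auto)
  also have "\<dots> = seg (p ! i) (p ! Suc i) (t - real i) w" using assms by (auto simp: seg_def)
  finally show "path_point p t w = seg (p ! i) (p ! Suc i) (t - real i) w" .
qed

lemma path_point_rev:
  assumes "p \<noteq> []"
  shows "path_point (rev p) (real (length p - 1) - t) = path_point p t"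
proof
  fix w
  let ?f = "\<lambda>i. if p ! i = w then max 0 (1 - \<bar>t - real i\<bar>) else 0"
  have "path_point (rev p) (real (length p - 1) - t) w = (\<Sum>i<length p. ?f (length p - Suc i))"
    unfolding path_point_def length_rev
  proof (rule sum.cong)
    fix i assume i: "i \<in> {..<length p}"
    have "real (length p - Suc i) = real (length p - 1) - real i" using i by (auto simp: of_nat_diff)
    then have "\<bar>real (length p - 1) - t - real i\<bar> = \<bar>t - real (length p - Suc i)\<bar>" by linarith
    then show "(if rev p ! i = w then max 0 (1 - \<bar>real (length p - 1) - t - real i\<bar>) else 0) = ?f (length p - Suc i)"
      using i by (simp add: rev_nth)
  qed simp
  also have "\<dots> = path_point p t w" unfolding path_point_def by (rule sum.nat_diff_reindex)
  finally show "path_point (rev p) (real (length p - 1) - t) w = path_point p t w" .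
qed

lemma between_integers:
  assumes "0 \<le> t" "t \<le> real n" "0 < n"
  obtains i where "i < n" "real i \<le> t" "t \<le> real i + 1"
proof (cases "t = real n")
  case True
  then show thesis using that[of "n - 1"] assms by (simp add: of_nat_diff)
next
  case False
  define i where "i = nat \<lfloor>t\<rfloor>"
  have "real i = of_int \<lfloor>t\<rfloor>" using assms by (simp add: i_def)
  then have "real i \<le> t" "t < real i + 1" by linarith+
  moreover from this have "real i < real n" using assms False by linarith
  then have "i < n" by simp
  ultimately show thesis using that[of i] by simp
qed

lemma card_path_edges: "distinct p \<Longrightarrow> card (path_edges p) = length p - 1"
proof (induction p rule: induct_list012)
  case (3 u v p)
  have "{u, v} \<notin> path_edges (v # p)" using 3(3) path_edges_mem[of "{u, v}" "v # p" u] by auto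
  then show ?case using 3 card_insert_disjoint[OF finite_path_edges[of "v # p"]] by (simp add: path_edges_Cons)
qed auto

context splitting
begin

lemma invariant_bounded:
  fixes f :: "'v set \<Rightarrow> real"
  assumes "\<And>g e. g \<in> carrier G \<Longrightarrow> e \<in> edges T \<Longrightarrow> f (act T g ` e) = f e"
  obtains M where "0 \<le> M" "\<And>e. e \<in> edges T \<Longrightarrow> f e \<le> M"
proof -
  obtain R where R: "transversal G (edges T) (\<lambda>g. (`) (act T g)) R" using edge_transversal by blast
  have fin: "finite R" using R by (simp add: transversal_def)
  have "f e \<le> Max (insert 0 (f ` R))" if e: "e \<in> edges T" for e
  proof -
    obtain r where r: "r \<in> R" "r \<in> orbit G (\<lambda>g. (`) (act T g)) e" using R e unfolding transversal_def by blast
    then have "f r = f e" using assms e unfolding orbit_def by auto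
    then have "f e \<in> insert 0 (f ` R)" using r(1) by (metis imageI insertI2)
    then show ?thesis using fin by (intro Max_ge) auto
  qed
  moreover have "0 \<le> Max (insert 0 (f ` R))" using fin by (intro Max_ge) auto
  ultimately show thesis using that by blast
qed

lemma geodesic_rev: "u \<in> verts T \<Longrightarrow> v \<in> verts T \<Longrightarrow> tree_geodesic T v u = rev (tree_geodesic T u v)"
  using geodesic_props[of u v] by (intro geodesic_eq) (auto simp: path_between_def edge_path_rev hd_rev last_rev)

lemma geodesic_length: "u \<in> verts T \<Longrightarrow> v \<in> verts T \<Longrightarrow> length (tree_geodesic T u v) - 1 = card (sep T u v)"
  unfolding sep_def using card_path_edges edge_path_distinct geodesic_props(1) by metis

lemma path_point_in:
  assumes p: "edge_path T p" and t: "0 \<le> t" "t \<le> real (length p - 1)"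
  shows "path_point p t \<in> realization T"
proof (cases "length p = 1")
  case True
  then obtain a where "p = [a]" by (metis One_nat_def length_0_conv length_Suc_conv)
  then show ?thesis using p t vertex_point_realization by (auto simp: edge_path_def)
next
  case False
  then have l: "0 < length p - 1" using p by (cases p) (auto simp: edge_path_def)
  then obtain i where i: "i < length p - 1" "real i \<le> t" "t \<le> real i + 1" using between_integers t by metis
  then have "{p ! i, p ! Suc i} \<in> edges T" using p by (simp add: edge_path_iff_nth)
  then show ?thesis using path_point_seg[of i p t] i seg_realization by simp
qed

lemma path_point_lipschitz:
  assumes len: "invariant_lengths G T len" and M: "\<And>e. e \<in> edges T \<Longrightarrow> len e \<le> M"
    and p: "edge_path T p" and t: "0 \<le> t" "t \<le> t'" "t' \<le> real (length p - 1)"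
  shows "tree_dist T len (path_point p t) (path_point p t') \<le> M * (t' - t)"
proof (cases "length p = 1")
  case True
  then have "t = t'" using t by simp
  then show ?thesis using tree_dist_self[OF len path_point_in[OF p]] t by simp
next
  case False
  then have l: "0 < length p - 1" using p by (cases p) (auto simp: edge_path_def)
  have seg: "tree_dist T len (path_point p s) (path_point p s') \<le> M * (s' - s)"
    if "i < length p - 1" "real i \<le> s" "s \<le> s'" "s' \<le> real i + 1" for i s s'
  proof -
    have e: "{p ! i, p ! Suc i} \<in> edges T" using p that by (simp add: edge_path_iff_nth)
    then have ne: "p ! i \<noteq> p ! Suc i" using edge_verts by blast
    have "tree_dist T len (path_point p s) (path_point p s') \<le> segment_length len {p ! i, p ! Suc i} (path_point p s) (path_point p s')"
      using path_point_seg[of i p s] path_point_seg[of i p s'] that seg_in_cell[OF _ _ ne]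
      by (intro tree_dist_segment[OF len e]) auto
    also have "\<dots> = len {p ! i, p ! Suc i} * (s' - s)"
      using path_point_seg[of i p s] path_point_seg[of i p s'] that segment_length_seg[OF ne] by simp
    also have "\<dots> \<le> M * (s' - s)" using M[OF e] that by (intro mult_right_mono) auto
    finally show ?thesis .
  qed
  obtain i where i: "i < length p - 1" "real i \<le> t" "t \<le> real i + 1" using between_integers[OF t(1) _ l] t by auto
  have main: "tree_dist T len (path_point p t) (path_point p s) \<le> M * (s - t)"
    if "i \<le> j" "j < length p - 1" "real j \<le> s" "t \<le> s" "s \<le> real j + 1" for j s
    using that
  proof (induction j arbitrary: s rule: dec_induct)
    case base
    then show ?case using seg i by simp
  next
    case (step j)
    have "t \<le> real (Suc j)" using i step by simp
    then have 1: "tree_dist T len (path_point p t) (path_point p (real (Suc j))) \<le> M * (real (Suc j) - t)"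
      using step by (intro step.IH) auto
    have 2: "tree_dist T len (path_point p (real (Suc j))) (path_point p s) \<le> M * (s - real (Suc j))"
      using step by (intro seg[of "Suc j"]) auto
    have "tree_dist T len (path_point p t) (path_point p s) \<le>
      tree_dist T len (path_point p t) (path_point p (real (Suc j))) + tree_dist T len (path_point p (real (Suc j))) (path_point p s)"
      using step t i by (intro tree_dist_triangle[OF len] path_point_in[OF p]) auto
    then show ?case using 1 2 by (simp add: algebra_simps)
  qed
  show ?thesis
  proof (cases "t' \<le> real i + 1")
    case True
    then show ?thesis using seg[OF i(1,2) t(2)] by simp
  next
    case False
    obtain j where j: "j < length p - 1" "real j \<le> t'" "t' \<le> real j + 1" using between_integers[of t' "length p - 1"] t l by auto
    then have "i \<le> j" using False by linarith
    then show ?thesis using main[of j t'] j t by simp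
  qed
qed

lemma path_point_act:
  assumes g: "g \<in> carrier G" and p: "edge_path T p" and t: "0 \<le> t" "t \<le> real (length p - 1)"
  shows "path_point (map (act T g) p) t = point_act G T g (path_point p t)"
proof (cases "length p = 1")
  case True
  then obtain a where a: "p = [a]" by (metis One_nat_def length_0_conv length_Suc_conv)
  then have "t = 0" "a \<in> verts T" using p t by (auto simp: edge_path_def)
  then show ?thesis using a point_act_seg[OF g, of a a 0] by simp
next
  case False
  then have l: "0 < length p - 1" using p by (cases p) (auto simp: edge_path_def)
  then obtain i where i: "i < length p - 1" "real i \<le> t" "t \<le> real i + 1" using between_integers t by metis
  then have "{p ! i, p ! Suc i} \<in> edges T" using p by (simp add: edge_path_iff_nth)
  then show ?thesis
    using path_point_seg[of i p t] path_point_seg[of i "map (act T g) p" t] i point_act_seg[OF g] edge_verts by simp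
qed

end

context vertex_map
begin

definition edge_map :: "'v \<Rightarrow> 'v \<Rightarrow> real \<Rightarrow> 'w \<Rightarrow> real" where
  "edge_map a b s = path_point (tree_geodesic T (k a) (k b)) (real (length (tree_geodesic T (k a) (k b)) - 1) * s)"

text \<open>The choice of the edge and of its orientation is irrelevant, see \<open>linear_map_seg\<close>.\<close>

definition linear_map :: "('v \<Rightarrow> real) \<Rightarrow> 'w \<Rightarrow> real" where
  "linear_map x = (let ab = SOME ab. {fst ab, snd ab} \<in> edges S \<and> x \<in> cell {fst ab, snd ab}
     in edge_map (fst ab) (snd ab) (x (snd ab)))"

lemma edge_map_swap:
  assumes "a \<in> verts S" "b \<in> verts S"
  shows "edge_map b a (1 - s) = edge_map a b s"
proof -
  have "tree_geodesic T (k b) (k a) = rev (tree_geodesic T (k a) (k b))"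
    using T.geodesic_rev k_verts assms by blast
  then show ?thesis unfolding edge_map_def
    using path_point_rev[OF T.geodesic_props(4)[OF k_verts[OF assms(1)] k_verts[OF assms(2)]],
        of "real (length (tree_geodesic T (k a) (k b)) - 1) * s"]
    by (simp add: algebra_simps)
qed

lemma edge_map_0:
  assumes "a \<in> verts S" "b \<in> verts S"
  shows "edge_map a b 0 = vertex_point (k a)"
proof -
  note p = T.geodesic_props[OF k_verts[OF assms(1)] k_verts[OF assms(2)]]
  obtain r where r: "tree_geodesic T (k a) (k b) = k a # r" using p by (metis list.collapse)
  show ?thesis
  proof (cases r)
    case Nil
    then show ?thesis unfolding edge_map_def using r by simp
  next
    case (Cons y r')
    then show ?thesis unfolding edge_map_def using r path_point_seg[of 0 "k a # r" 0] by simp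
  qed
qed

lemma edge_map_1: "a \<in> verts S \<Longrightarrow> b \<in> verts S \<Longrightarrow> edge_map a b 1 = vertex_point (k b)"
  using edge_map_swap[of b a 0] edge_map_0[of b a] by simp

lemma linear_map_seg:
  assumes ab: "{a, b} \<in> edges S" and s: "0 \<le> s" "s \<le> 1"
  shows "linear_map (seg a b s) = edge_map a b s"
proof -
  let ?P = "\<lambda>ab. {fst ab, snd ab} \<in> edges S \<and> seg a b s \<in> cell {fst ab, snd ab}"
  have V: "a \<in> verts S" "b \<in> verts S" "a \<noteq> b" using S.edge_verts ab by auto
  define c d where "c = fst (SOME ab. ?P ab)" and "d = snd (SOME ab. ?P ab)"
  have "?P (a, b)" using ab seg_in_cell[OF s V(3)] by simp
  then have "?P (SOME ab. ?P ab)" by (rule someI)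
  then have cd: "{c, d} \<in> edges S" "seg a b s \<in> cell {c, d}" unfolding c_def d_def by auto
  then have W: "c \<in> verts S" "d \<in> verts S" "c \<noteq> d" using S.edge_verts by auto
  obtain t where t: "0 \<le> t" "t \<le> 1" "seg a b s = seg c d t" using cd(2) cell_seg[OF W(3)] by auto
  have "linear_map (seg a b s) = edge_map c d (seg a b s d)"
    unfolding linear_map_def Let_def c_def d_def by simp
  also have "seg a b s d = t" using t W(3) by (simp add: seg_def)
  also have "edge_map c d t = edge_map a b s"
  proof -
    consider "0 < s" "s < 1" | "s = 0" | "s = 1" using s by linarith
    then show ?thesis
    proof cases
      case 1
      have "seg c d t a \<noteq> 0" "seg c d t b \<noteq> 0" using 1 V(3) unfolding t(3)[symmetric] by (auto simp: seg_def)
      then have "a \<in> {c, d}" "b \<in> {c, d}" by (auto simp: seg_def split: if_splits)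
      then have "c = a \<and> d = b \<or> c = b \<and> d = a" using V(3) by auto
      then show ?thesis
      proof
        assume A: "c = a \<and> d = b"
        then have "t = s" using t(3) seg_eq_iff[OF V(3)] by simp
        then show ?thesis using A by simp
      next
        assume A: "c = b \<and> d = a"
        then have "seg a b s = seg a b (1 - t)" using t(3) seg_swap[of b a t] by simp
        then have "t = 1 - s" using seg_eq_iff[OF V(3)] by simp
        then show ?thesis using A edge_map_swap[OF V(1,2)] by simp
      qed
    next
      case 2
      then have "t = 0 \<and> a = c \<or> t = 1 \<and> a = d" using t(3) seg_eq_vertex_point[OF W(3), of t a] by simp
      then show ?thesis using 2 edge_map_0[OF V(1,2)] edge_map_0[OF W(1,2)] edge_map_1[OF W(1,2)] by auto
    next
      case 3
      then have "t = 0 \<and> b = c \<or> t = 1 \<and> b = d" using t(3) seg_eq_vertex_point[OF W(3), of t b] by simp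
      then show ?thesis using 3 edge_map_1[OF V(1,2)] edge_map_0[OF W(1,2)] edge_map_1[OF W(1,2)] by auto
    qed
  qed
  finally show ?thesis .
qed

lemma edge_map_in:
  assumes "a \<in> verts S" "b \<in> verts S" "0 \<le> s" "s \<le> 1"
  shows "edge_map a b s \<in> realization T"
  unfolding edge_map_def using assms T.geodesic_props(1) k_verts
  by (intro T.path_point_in) (auto simp: mult_left_le)

lemma linear_map_equivariant: "equivariant_map G S T linear_map"
  unfolding equivariant_map_def
proof (intro conjI ballI)
  show "linear_map ` realization S \<subseteq> realization T"
  proof
    fix y assume "y \<in> linear_map ` realization S"
    then obtain x where x: "x \<in> realization S" "y = linear_map x" by blast
    obtain a b s where A: "a \<in> verts S" "b \<in> verts S" "{a, b} \<in> edges S" "0 \<le> s" "s \<le> 1" "x = seg a b s"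
      using S.realizationE[OF x(1)] by metis
    then show "y \<in> realization T" using linear_map_seg edge_map_in x by simp
  qed
  fix g x assume g: "g \<in> carrier G" and x: "x \<in> realization S"
  obtain a b s where A: "a \<in> verts S" "b \<in> verts S" "{a, b} \<in> edges S" "0 \<le> s" "s \<le> 1" "x = seg a b s"
    using S.realizationE[OF x] by metis
  have kV: "k a \<in> verts T" "k b \<in> verts T" using k_verts A by auto
  have "linear_map (point_act G S g x) = edge_map (act S g a) (act S g b) s"
    using A S.point_act_seg[OF g A(1,2)] linear_map_seg[OF S.act_edge[OF g A(3)] A(4,5)] by simp
  also have "\<dots> = point_act G T g (edge_map a b s)"
    unfolding edge_map_def k_act[OF g A(1)] k_act[OF g A(2)] T.geodesic_act[OF g kV]
    using A T.path_point_act[OF g T.geodesic_props(1)[OF kV]] by (simp add: mult_left_le)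
  finally show "linear_map (point_act G S g x) = point_act G T g (linear_map x)"
    using linear_map_seg A by simp
qed

lemma linear_map_lipschitz:
  assumes lS: "invariant_lengths G S lS" and lT: "invariant_lengths G T lT"
  obtains L where "0 \<le> L"
    "\<And>x y. x \<in> realization S \<Longrightarrow> y \<in> realization S \<Longrightarrow> tree_dist T lT (linear_map x) (linear_map y) \<le> L * tree_dist S lS x y"
proof -
  obtain M where M: "0 \<le> M" "\<And>e. e \<in> edges T \<Longrightarrow> lT e \<le> M"
    using T.invariant_bounded[of lT] lT unfolding invariant_lengths_def by metis
  have inv: "card (image_edges T k {act S g ` e}) / lS (act S g ` e) = card (image_edges T k {e}) / lS e"
    if g: "g \<in> carrier G" and e: "e \<in> edges S" for g e
  proof -
    have "inj_on ((`) (act T g)) (image_edges T k {e})"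
      using inj_on_subset[OF S.gset_inj_on[OF T.gset_edges g] image_edge_props(2)[OF e]] .
    then show ?thesis using image_edge_act[OF g e] lS e g by (simp add: card_image invariant_lengths_def)
  qed
  obtain N where N: "0 \<le> N" "\<And>e. e \<in> edges S \<Longrightarrow> card (image_edges T k {e}) / lS e \<le> N"
    using S.invariant_bounded[of "\<lambda>e. card (image_edges T k {e}) / lS e"] inv by metis
  define L where "L = M * N + 1"
  have L: "0 < L" using M N by (simp add: L_def add_nonneg_pos)
  have seg_le: "tree_dist T lT (linear_map x) (linear_map y) \<le> L * segment_length lS e x y"
    if e: "e \<in> edges S" "x \<in> cell e" "y \<in> cell e" for e x y
  proof -
    obtain a b s where A: "a \<in> verts S" "b \<in> verts S" "a \<noteq> b" "e = {a, b}" "0 \<le> s" "s \<le> 1" "x = seg a b s"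
      using S.cellE[OF e(1,2)] by metis
    then obtain t where B: "0 \<le> t" "t \<le> 1" "y = seg a b t" using e(3) cell_seg[OF A(3)] by auto
    have ab: "{a, b} \<in> edges S" using e A by simp
    have kV: "k a \<in> verts T" "k b \<in> verts T" using k_verts A by auto
    define n where "n = real (length (tree_geodesic T (k a) (k b)) - 1)"
    have n: "n = card (image_edges T k {e})" unfolding n_def T.geodesic_length[OF kV] A(4) image_edge[OF ab] ..
    have pos: "0 < lS e" using lS e by (simp add: invariant_lengths_def)
    have le: "tree_dist T lT (edge_map a b s) (edge_map a b t) \<le> M * (n * t - n * s)" if "0 \<le> s" "s \<le> t" "t \<le> 1" for s t
      unfolding edge_map_def n_def[symmetric]
    proof (rule T.path_point_lipschitz[OF lT M(2) T.geodesic_props(1)[OF kV]])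
      have "0 \<le> n" by (simp add: n)
      then show "0 \<le> n * s" "n * s \<le> n * t" using that by (auto intro: mult_left_mono)
      have "n * t \<le> n" using that \<open>0 \<le> n\<close> by (simp add: mult_left_le)
      then show "n * t \<le> real (length (tree_geodesic T (k a) (k b)) - 1)" unfolding n_def .
    qed
    have le': "tree_dist T lT (edge_map a b s) (edge_map a b t) \<le> M * n * \<bar>s - t\<bar>"
    proof (cases "s \<le> t")
      case True
      then show ?thesis using le[of s t] A B by (simp add: algebra_simps)
    next
      case False
      have "edge_map a b s = edge_map b a (1 - s)" "edge_map a b t = edge_map b a (1 - t)"
        using edge_map_swap A by simp_all
      have sw: "tree_dist T lT (edge_map a b s) (edge_map a b t) = tree_dist T lT (edge_map b a (1 - s)) (edge_map b a (1 - t))"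
        using edge_map_swap[OF A(1,2)] by simp
      have kV': "length (tree_geodesic T (k b) (k a)) = length (tree_geodesic T (k a) (k b))"
        using T.geodesic_rev[OF kV] by simp
      have "tree_dist T lT (edge_map b a (1 - s)) (edge_map b a (1 - t)) \<le> M * (n * (1 - t) - n * (1 - s))"
        unfolding edge_map_def kV' n_def[symmetric]
      proof (rule T.path_point_lipschitz[OF lT M(2) T.geodesic_props(1)[OF kV(2,1)]])
        have "0 \<le> n" by (simp add: n)
        then show "0 \<le> n * (1 - s)" "n * (1 - s) \<le> n * (1 - t)"
          using False A B by (auto intro: mult_left_mono)
        have "n * (1 - t) \<le> n" using A B \<open>0 \<le> n\<close> by (simp add: mult_left_le)
        then show "n * (1 - t) \<le> real (length (tree_geodesic T (k b) (k a)) - 1)" unfolding n_def kV' .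
      qed
      then show ?thesis using sw False by (simp add: algebra_simps)
    qed
    have "n \<le> N * lS e" using N(2)[OF e(1)] pos n by (simp add: pos_divide_le_eq)
    then have "M * n * \<bar>s - t\<bar> \<le> M * (N * lS e) * \<bar>s - t\<bar>"
      using M(1) by (intro mult_right_mono mult_left_mono) auto
    also have "\<dots> \<le> L * (lS e * \<bar>s - t\<bar>)" unfolding L_def using pos by (simp add: algebra_simps)
    also have "lS e * \<bar>s - t\<bar> = segment_length lS e x y" using segment_length_seg[OF A(3)] A B by simp
    finally show ?thesis using le' linear_map_seg[OF ab] A B by simp
  qed
  have in_T: "linear_map x \<in> realization T" if "x \<in> realization S" for x
    using linear_map_equivariant that unfolding equivariant_map_def by blast
  have "tree_dist T lT (linear_map x) (linear_map y) \<le> L * tree_dist S lS x y"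
    if x: "x \<in> realization S" and y: "y \<in> realization S" for x y
  proof -
    have "tree_dist T lT (linear_map x) (linear_map y) / L \<le> tree_dist S lS x y"
    proof (rule S.tree_dist_ge[OF lS x y])
      fix s assume "s \<in> chain_lengths S lS x y"
      then have "tree_dist T lT (linear_map x) (linear_map y) \<le> L * s \<and> y \<in> realization S"
      proof (induction rule: chain_induct)
        case refl
        then show ?case using T.tree_dist_self[OF lT in_T[OF x]] x by simp
      next
        case (step s y z e)
        have yz: "y \<in> realization S" "z \<in> realization S" using step unfolding S.realization_eq by auto
        then have "tree_dist T lT (linear_map x) (linear_map z) \<le>
          tree_dist T lT (linear_map x) (linear_map y) + tree_dist T lT (linear_map y) (linear_map z)"
          using x in_T by (intro T.tree_dist_triangle[OF lT]) auto
        also have "\<dots> \<le> L * s + L * segment_length lS e y z"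
          using step.IH seg_le[OF step.hyps(2-4)] by simp
        finally show ?case using yz by (simp add: algebra_simps)
      qed
      then show "tree_dist T lT (linear_map x) (linear_map y) / L \<le> s"
        using L by (simp add: pos_divide_le_eq mult.commute)
    qed
    then show ?thesis using L by (simp add: pos_divide_le_eq mult.commute)
  qed
  then show thesis using that[of L] L by simp
qed

end

lemma (in splitting) conj_class_stabilizer:
  assumes "v \<in> verts T"
  shows "conj_class G (stabilizer G (act T) v) = (\<lambda>g. stabilizer G (act T) (act T g v)) ` carrier G"
proof -
  have "conj_class G (stabilizer G (act T) v) = (\<lambda>g. g <# stabilizer G (act T) v #> inv g) ` carrier G"
    unfolding conj_class_def by auto
  also have "\<dots> = (\<lambda>g. stabilizer G (act T) (act T g v)) ` carrier G"
    by (rule image_cong) (use stabilizer_act[OF _ assms] in auto)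
  finally show ?thesis .
qed

text \<open>Every vertex stabilizer of \<open>S\<close> is one of \<open>T\<close>, or trivial.\<close>

lemma vertex_map_exists:
  assumes S: "splitting G S" and T: "splitting G T" and ell: "F_ell G S = F_ell G T"
  obtains k where "vertex_map G S T k"
proof -
  interpret S: splitting G S by (rule S)
  interpret T: splitting G T by (rule T)
  have ex: "\<exists>w\<in>verts T. True \<and> (\<forall>g\<in>carrier G. act S g v = v \<longrightarrow> act T g w = w)" if v: "v \<in> verts S" for v
  proof (cases "stabilizer G (act S) v = {\<one>\<^bsub>G\<^esub>}")
    case True
    obtain w where w: "w \<in> verts T" using T.verts_nonempty by blast
    have "act T g w = w" if "g \<in> carrier G" "act S g v = v" for g
    proof -
      have "g \<in> stabilizer G (act S) v" using that by (simp add: stabilizer_def)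
      then show ?thesis using True T.act_one[OF w] by simp
    qed
    then show ?thesis using w by blast
  next
    case False
    then have "conj_class G (stabilizer G (act S) v) \<in> F_ell G S" using v unfolding F_ell_def by blast
    then have "conj_class G (stabilizer G (act S) v) \<in> F_ell G T" using ell by simp
    then obtain w where w: "w \<in> verts T" "conj_class G (stabilizer G (act S) v) = conj_class G (stabilizer G (act T) w)"
      unfolding F_ell_def by blast
    have "stabilizer G (act S) v \<in> conj_class G (stabilizer G (act S) v)"
      unfolding S.conj_class_stabilizer[OF v] using S.act_one[OF v] by (metis S.one_closed imageI)
    then have "stabilizer G (act S) v \<in> (\<lambda>g. stabilizer G (act T) (act T g w)) ` carrier G"
      unfolding w(2) T.conj_class_stabilizer[OF w(1)] .
    then obtain g where g: "g \<in> carrier G" "stabilizer G (act S) v = stabilizer G (act T) (act T g w)" by blast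
    have "\<forall>h\<in>carrier G. act S h v = v \<longrightarrow> act T h (act T g w) = act T g w"
    proof (intro ballI impI)
      fix h assume "h \<in> carrier G" "act S h v = v"
      then have "h \<in> stabilizer G (act S) v" by (simp add: stabilizer_def)
      then show "act T h (act T g w) = act T g w" unfolding g(2) by (simp add: stabilizer_def)
    qed
    then show ?thesis using T.act_verts[OF g(1) w(1)] by blast
  qed
  show thesis
  proof (rule S.equivariant_choice[OF S.gset_verts T.gset_verts, of "\<lambda>_ _. True"])
    show "\<exists>w\<in>verts T. True \<and> (\<forall>g\<in>carrier G. act S g v = v \<longrightarrow> act T g w = w)" if "v \<in> verts S" for v
      using ex[OF that] .
    fix k assume k: "\<And>v. v \<in> verts S \<Longrightarrow> k v \<in> verts T"
      "\<And>g v. g \<in> carrier G \<Longrightarrow> v \<in> verts S \<Longrightarrow> k (act S g v) = act T g (k v)"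
    have "vertex_map G S T k" by unfold_locales (use k in auto)
    then show thesis by (rule that)
  qed simp
qed

section \<open>Distances in the free splitting complex\<close>

locale fs_complex = group G for G :: "('a, 'm) monoid_scheme" (structure) +
  fixes \<A> :: "'a set set set"
begin

abbreviation "rel \<equiv> free_splitting_rel G \<A> :: 'a splitting \<Rightarrow> bool"
abbreviation "cls \<equiv> fs_class G \<A>"

lemma rel_splitting: "free_splitting_rel G \<A> S \<Longrightarrow> splitting G S"
  unfolding splitting_def splitting_axioms_def free_splitting_rel_def by (simp add: is_group)

lemma rel_fs: "free_splitting_rel G \<A> S \<Longrightarrow> free_splitting G S"
  by (simp add: free_splitting_rel_def)

lemma cls_self: "rel S \<Longrightarrow> S \<in> cls S"
  unfolding fs_class_def using equivalent_refl[OF is_group] by blast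

lemma cls_eq: "rel S \<Longrightarrow> rel T \<Longrightarrow> equivalent_splittings G S T \<Longrightarrow> cls S = cls T"
  unfolding fs_class_def
  using equivalent_sym[OF is_group rel_fs] equivalent_trans[OF is_group] by blast

lemma cls_mem: "rel S \<Longrightarrow> T \<in> cls S \<Longrightarrow> rel T \<and> cls T = cls S"
  using cls_eq[of S T] unfolding fs_class_def by auto

lemma cls_vertex: "rel S \<Longrightarrow> cls S \<in> fs_vertices G \<A>"
  unfolding fs_vertices_def by blast

lemma vertexE: "c \<in> fs_vertices G \<A> \<Longrightarrow> T \<in> c \<Longrightarrow> rel T \<and> c = cls T"
  using cls_mem unfolding fs_vertices_def by blast

lemma collapse_simplex:
  assumes "rel S" "rel T" "collapses G S T" "cls S \<noteq> cls T"
  shows "{cls S, cls T} \<in> fs_simplices G \<A>"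
proof -
  have "class_collapses G (cls S) (cls T)" unfolding class_collapses_def using cls_self assms by blast
  then show ?thesis unfolding fs_simplices_def
    using cls_vertex assms by (intro CollectI exI[of _ "[cls S, cls T]"]) auto
qed

definition edge_walk :: "nat \<Rightarrow> (nat \<Rightarrow> 'a splitting set) \<Rightarrow> 'a splitting set \<Rightarrow> 'a splitting set \<Rightarrow> bool" where
  "edge_walk n p c d \<longleftrightarrow> p 0 = c \<and> p n = d \<and> (\<forall>i\<le>n. p i \<in> fs_vertices G \<A>) \<and>
     (\<forall>i<n. p i \<noteq> p (Suc i) \<and> {p i, p (Suc i)} \<in> fs_simplices G \<A>)"

lemma fs_vertex_dist_le: "edge_walk n p c d \<Longrightarrow> fs_vertex_dist G \<A> c d \<le> enat n"
  unfolding fs_vertex_dist_def edge_walk_def by (rule Inf_lower) blast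

lemma fs_vertex_dist_attained:
  assumes "fs_vertex_dist G \<A> c d = enat n" obtains p where "edge_walk n p c d"
proof -
  let ?A = "{enat n | n p. edge_walk n p c d}"
  have A: "fs_vertex_dist G \<A> c d = Inf ?A" unfolding fs_vertex_dist_def edge_walk_def ..
  have ne: "?A \<noteq> {}"
  proof
    assume "?A = {}"
    then have "fs_vertex_dist G \<A> c d = Inf {}" unfolding A by (rule arg_cong)
    then show False using assms by (simp add: Inf_enat_def)
  qed
  then have "Inf ?A = (LEAST x. x \<in> ?A)" unfolding Inf_enat_def by (simp only: if_False)
  moreover have "(LEAST x. x \<in> ?A) \<in> ?A" by (rule LeastI_ex) (use ne in blast)
  ultimately have "Inf ?A \<in> ?A" by simp
  then show thesis using that assms A by auto
qed

lemma fs_vertex_dist_step: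
  assumes c: "c \<in> fs_vertices G \<A>" and cc': "c = c' \<or> {c, c'} \<in> fs_simplices G \<A>"
  shows "fs_vertex_dist G \<A> c d \<le> 1 + fs_vertex_dist G \<A> c' d"
proof (cases "c = c' \<or> fs_vertex_dist G \<A> c' d = \<infinity>")
  case True
  then show ?thesis by (auto simp: add_increasing)
next
  case False
  then obtain n where n: "fs_vertex_dist G \<A> c' d = enat n" by auto
  then obtain p where p: "edge_walk n p c' d" using fs_vertex_dist_attained by blast
  have "edge_walk (Suc n) (\<lambda>i. case i of 0 \<Rightarrow> c | Suc j \<Rightarrow> p j) c d"
    using p c cc' False unfolding edge_walk_def by (auto split: nat.splits)
  then have "fs_vertex_dist G \<A> c d \<le> enat (Suc n)" by (rule fs_vertex_dist_le)
  then show ?thesis using n by (simp add: one_enat_def)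
qed

lemma collapse_exists:
  assumes S: "rel S" and F: "F \<subset> edges S" "\<And>g e. g \<in> carrier G \<Longrightarrow> e \<in> F \<Longrightarrow> act S g ` e \<in> F"
    and q: "\<And>u v. u \<in> verts S \<Longrightarrow> v \<in> verts S \<Longrightarrow> q u = q v \<longleftrightarrow> (u, v) \<in> joined F"
  shows "free_splitting_rel G \<A> (collapse_tree S q)" "collapses_along G S F (collapse_tree S q)"
proof -
  interpret S: splitting G S by (rule rel_splitting[OF S])
  have A: "F \<subseteq> edges S" using F by blast
  note A = A F(2) q
  have fs: "free_splitting G (collapse_tree S q)" by (rule S.free_splitting_collapse[OF A]) (use F in auto)
  then show "free_splitting_rel G \<A> (collapse_tree S q)"
    using S.ffs_le_collapse[OF A] S unfolding free_splitting_rel_def by blast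
  interpret collapse G S "collapse_tree S q" q
    using fs S.simplicial_collapse[OF A] by unfold_locales
  have "{e \<in> edges S. collapsed q e} = F" using S.collapsed_iff[OF A] F by blast
  then show "collapses_along G S F (collapse_tree S q)"
    using collapse_map_realize unfolding collapses_along_def forest_def by auto
qed

section \<open>The inequality\<close>

lemma outer_props:
  assumes "X \<in> outer_space G \<A>"
  shows "rel (fst X)" "F_ell G (fst X) = \<A>" "invariant_lengths G (fst X) (snd X)" "normalized G (fst X) (snd X)"
proof -
  have X: "free_splitting G (fst X)" "\<A> = F_ell G (fst X)" "invariant_lengths G (fst X) (snd X)" "normalized G (fst X) (snd X)"
    using assms unfolding outer_space_def grushko_splitting_rel_def by auto
  then show "F_ell G (fst X) = \<A>" "invariant_lengths G (fst X) (snd X)" "normalized G (fst X) (snd X)" by auto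
  have "ffs_le \<A> \<A>" unfolding ffs_le_def by blast
  then show "rel (fst X)" using X unfolding free_splitting_rel_def by simp
qed

text \<open>Rounding, tightening and collapsing yield a foldable map out of a collapse of \<open>S\<close>; passing to the
  collapse costs the summand \<open>1\<close>.\<close>

lemma lipschitz_constant_bound:
  assumes \<Delta>: "two_over_all G \<A> \<Delta>" and X: "X \<in> outer_space G \<A>" and Y: "Y \<in> outer_space G \<A>"
    and h: "equivariant_map G (fst X) (fst Y) h" and L: "lipschitz_bound X Y h L"
  shows "1 \<le> L" "1 \<le> n \<Longrightarrow> enat (n * \<Delta> + 1) \<le> d_FS G \<A> (fst X) (fst Y) \<Longrightarrow> 2 ^ n \<le> L"
proof -
  let ?S = "fst X" and ?T = "fst Y"
  note X' = outer_props[OF X] and Y' = outer_props[OF Y]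
  interpret S: splitting G ?S by (rule rel_splitting[OF X'(1)])
  interpret T: splitting G ?T by (rule rel_splitting[OF Y'(1)])
  obtain R where R: "transversal G (edges ?S) (\<lambda>g. (`) (act ?S g)) R" using S.edge_transversal by blast
  obtain R' where R': "transversal G (edges ?T) (\<lambda>g. (`) (act ?T g)) R'" using T.edge_transversal by blast
  have L0: "0 \<le> L" and lip: "\<And>x y. x \<in> realization ?S \<Longrightarrow> y \<in> realization ?S \<Longrightarrow>
      tree_dist ?T (snd Y) (h x) (h y) \<le> L * tree_dist ?S (snd X) x y"
    using L unfolding lipschitz_bound_def by auto
  obtain k0 where k0: "vertex_map G ?S ?T k0" "sum (vertex_map.image_length ?T k0 (snd Y)) R \<le> L * sum (snd X) R"
    using rounded_map[OF S.splitting_axioms T.splitting_axioms X'(3) Y'(3) h L0 lip R] by blast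
  then have k0L: "sum (vertex_map.image_length ?T k0 (snd Y)) R \<le> L" using S.volume[OF X'(3,4) R] by simp
  have len: "0 \<le> snd Y d" "\<And>g. g \<in> carrier G \<Longrightarrow> snd Y (act ?T g ` d) = snd Y d" if "d \<in> edges ?T" for d
    using that Y'(3) by (auto simp: invariant_lengths_def less_imp_le)
  obtain k where k: "vertex_map G ?S ?T k" "vertex_map.taut G ?S ?T k" "sum (vertex_map.image_length ?T k (snd Y)) R \<le> L"
    using taut_exists[OF k0(1) R len(1) k0L] by blast
  interpret k: vertex_map G ?S ?T k by (rule k(1))
  show "1 \<le> L" using k.volume_le_image_length[OF len(2,1) R R'] T.volume[OF Y'(3,4) R'] k(3) by simp
  obtain q :: "'a set \<times> nat \<Rightarrow> 'a set \<times> nat" where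
    q: "\<And>u v. u \<in> verts ?S \<Longrightarrow> v \<in> verts ?S \<Longrightarrow> q u = q v \<longleftrightarrow> (u, v) \<in> joined k.forest"
    using S.quotient_map_exists[OF k.forest_sub k.forest_inv] by blast
  let ?S' = "collapse_tree ?S q"
  have proper: "k.forest \<subset> edges ?S" using k.forest_sub k.forest_proper by blast
  note S' = collapse_exists[OF X'(1) proper k.forest_inv q]
  obtain f where f: "foldable_map G ?S' ?T f" "\<And>v. v \<in> verts ?S \<Longrightarrow> f (q v) = k v"
    using k.foldable_collapse[OF k(2) q] by blast
  show "2 ^ n \<le> L" if n: "1 \<le> n" and d: "enat (n * \<Delta> + 1) \<le> d_FS G \<A> ?S ?T"
  proof -
    have "cls ?S = cls ?S' \<or> {cls ?S, cls ?S'} \<in> fs_simplices G \<A>"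
      using collapse_simplex[OF X'(1) S'(1)] S'(2) unfolding collapses_def by blast
    then have "d_FS G \<A> ?S ?T \<le> 1 + d_FS G \<A> ?S' ?T"
      unfolding d_FS_def by (rule fs_vertex_dist_step[OF cls_vertex[OF X'(1)]])
    with d have "enat (n * \<Delta> + 1) \<le> 1 + d_FS G \<A> ?S' ?T" by (rule order_trans)
    then have "enat (n * \<Delta>) \<le> d_FS G \<A> ?S' ?T" by (cases "d_FS G \<A> ?S' ?T") (auto simp: one_enat_def)
    then obtain E1 E2 where E: "E1 \<in> natural_edges G ?S'" "E2 \<in> natural_edges G ?S'"
      "orbit G (translate ?S') E1 \<noteq> orbit G (translate ?S') E2"
      "contains_full_subpaths G ?T (image_edges ?T f E1) (2 ^ (n - 1))"
      "contains_full_subpaths G ?T (image_edges ?T f E2) (2 ^ (n - 1))"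
      using \<Delta> S'(1) Y'(1) f(1) n unfolding two_over_all_def by blast
    have "2 * real (2 ^ (n - 1)) \<le> sum (k.image_length (snd Y)) R"
      by (rule k.two_natural_edges_length[OF Y'(3,4) q f(2) R E])
    moreover have "2 * real (2 ^ (n - 1)) = 2 ^ n" using n by (cases n) auto
    ultimately show ?thesis using k(3) by simp
  qed
qed

lemma lipschitz_map_exists:
  assumes X: "X \<in> outer_space G \<A>" and Y: "Y \<in> outer_space G \<A>"
  obtains h L where "equivariant_map G (fst X) (fst Y) h" "lipschitz_bound X Y h L"
proof -
  note X' = outer_props[OF X] and Y' = outer_props[OF Y]
  obtain k where "vertex_map G (fst X) (fst Y) k"
    using vertex_map_exists[OF rel_splitting[OF X'(1)] rel_splitting[OF Y'(1)]] X'(2) Y'(2) by metis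
  then interpret vertex_map G "fst X" "fst Y" k .
  obtain L where "0 \<le> L" "\<And>x y. x \<in> realization (fst X) \<Longrightarrow> y \<in> realization (fst X) \<Longrightarrow>
      tree_dist (fst Y) (snd Y) (linear_map x) (linear_map y) \<le> L * tree_dist (fst X) (snd X) x y"
    using linear_map_lipschitz[OF X'(3) Y'(3)] by blast
  then have "lipschitz_bound X Y linear_map L" unfolding lipschitz_bound_def by blast
  then show thesis using that linear_map_equivariant by blast
qed

lemma d_outer_ge:
  assumes X: "X \<in> outer_space G \<A>" and Y: "Y \<in> outer_space G \<A>" and c: "0 < c"
    and bound: "\<And>h L. equivariant_map G (fst X) (fst Y) h \<Longrightarrow> lipschitz_bound X Y h L \<Longrightarrow> c \<le> L"
  shows "ln c \<le> d_outer G X Y"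
proof -
  let ?A = "{Lip X Y f | f. equivariant_map G (fst X) (fst Y) f \<and> (\<exists>L. lipschitz_bound X Y f L)}"
  obtain h L where "equivariant_map G (fst X) (fst Y) h" "lipschitz_bound X Y h L"
    using lipschitz_map_exists[OF X Y] by metis
  then have "?A \<noteq> {}" by blast
  moreover have "c \<le> a" if "a \<in> ?A" for a
  proof -
    obtain f L where f: "a = Lip X Y f" "equivariant_map G (fst X) (fst Y) f" "lipschitz_bound X Y f L"
      using \<open>a \<in> ?A\<close> by blast
    then show ?thesis unfolding f(1) Lip_def by (intro cInf_greatest) (use bound in auto)
  qed
  ultimately have "c \<le> Inf ?A" by (rule cInf_greatest)
  then show ?thesis unfolding d_outer_def using c by simp
qed

text \<open>With \<open>n = (m - 1) div \<Delta>\<close> the bound \<open>n ln 2 \<le> d\<close> leaves a remainder of at most \<open>\<Delta> + 1\<close>.\<close>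

lemma d_FS_le:
  assumes \<Delta>: "two_over_all G \<A> \<Delta>" "0 < \<Delta>" and X: "X \<in> outer_space G \<A>" and Y: "Y \<in> outer_space G \<A>"
  obtains m where "d_FS G \<A> (fst X) (fst Y) = enat m" "real m \<le> real \<Delta> / ln 2 * d_outer G X Y + 2 * real \<Delta> + 1"
proof -
  let ?d = "d_FS G \<A> (fst X) (fst Y)"
  have d0: "0 \<le> d_outer G X Y"
    using d_outer_ge[OF X Y, of 1] lipschitz_constant_bound(1)[OF \<Delta>(1) X Y] by simp
  have dn: "real n * ln 2 \<le> d_outer G X Y" if "enat (n * \<Delta> + 1) \<le> ?d" for n
  proof (cases "n = 0")
    case False
    then have "ln (2 ^ n) \<le> d_outer G X Y"
      using that by (intro d_outer_ge[OF X Y]) (auto intro: lipschitz_constant_bound(2)[OF \<Delta>(1) X Y])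
    then show ?thesis by (simp add: ln_realpow)
  qed (use d0 in simp)
  have "?d \<noteq> \<infinity>"
  proof
    assume "?d = \<infinity>"
    then have "real n * ln 2 \<le> d_outer G X Y" for n using dn by simp
    moreover obtain n where "d_outer G X Y < real n * ln 2" using reals_Archimedean3[of "ln (2::real)"] by auto
    ultimately show False by (meson not_le)
  qed
  then obtain m where m: "?d = enat m" by auto
  define n where "n = (m - 1) div \<Delta>"
  have mod: "(m - 1) = n * \<Delta> + (m - 1) mod \<Delta>" "(m - 1) mod \<Delta> < \<Delta>" unfolding n_def using \<Delta>(2) by auto
  have ub: "m \<le> n * \<Delta> + \<Delta> + 1" using mod by linarith
  have nd: "real n * ln 2 \<le> d_outer G X Y"
  proof (cases "m = 0")
    case True
    then show ?thesis using d0 by (simp add: n_def)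
  next
    case False
    then have "n * \<Delta> + 1 \<le> m" using mod(1) by linarith
    then show ?thesis using dn m by simp
  qed
  then have "real n \<le> d_outer G X Y / ln 2" by (simp add: pos_le_divide_eq)
  then have "real n * real \<Delta> \<le> d_outer G X Y / ln 2 * real \<Delta>" by (rule mult_right_mono) simp
  moreover have "real m \<le> real n * real \<Delta> + real \<Delta> + 1" using ub by (metis of_nat_1 of_nat_add of_nat_le_iff of_nat_mult)
  ultimately have "real m \<le> real \<Delta> / ln 2 * d_outer G X Y + 2 * real \<Delta> + 1" by (simp add: algebra_simps)
  then show thesis using that m by blast
qed

end

section \<open>The inclusion of outer space\<close>

text \<open>The gaps between consecutive elements of \<open>A\<close> up to \<open>x\<close>, starting from \<open>0\<close>, telescope.\<close>

lemma sum_gaps: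
  fixes A :: "real set"
  assumes A: "finite A" "\<And>x. x \<in> A \<Longrightarrow> 0 \<le> x" and x: "x \<in> A"
  shows "(\<Sum>t\<in>{t \<in> A. t \<le> x}. t - Max (insert 0 {s \<in> A. s < t})) = x"
  using x
proof (induction "card {s \<in> A. s < x}" arbitrary: x rule: less_induct)
  case less
  show ?case
  proof (cases "{s \<in> A. s < x} = {}")
    case True
    have "{t \<in> A. t \<le> x} = {x}" using True less.prems by force
    then show ?thesis by (simp add: True)
  next
    case False
    define m where "m = Max {s \<in> A. s < x}"
    have fin: "finite {s \<in> A. s < x}" using A by simp
    have m: "m \<in> A" "m < x" using Max_in[OF fin False] unfolding m_def by auto
    have le: "s \<le> m" if "s \<in> A" "s < x" for s unfolding m_def using fin that by (intro Max_ge) auto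
    have "{s \<in> A. s < m} \<subset> {s \<in> A. s < x}" using m by auto
    then have "card {s \<in> A. s < m} < card {s \<in> A. s < x}" using fin by (rule psubset_card_mono[rotated])
    then have IH: "(\<Sum>t\<in>{t \<in> A. t \<le> m}. t - Max (insert 0 {s \<in> A. s < t})) = m" using less.hyps m by blast
    have "{t \<in> A. t \<le> x} = insert x {t \<in> A. t \<le> m}" using le m less.prems by force
    moreover have "Max (insert 0 {s \<in> A. s < x}) = m"
      using fin False A(2)[OF m(1)] unfolding m_def by simp
    moreover have "x \<notin> {t \<in> A. t \<le> m}" using m by simp
    ultimately show ?thesis using A(1) IH by simp
  qed
qed

lemma simplex_dist_le_1:
  assumes s: "finite s" and x: "x \<in> cell s" and y: "y \<in> cell s"
  shows "simplex_dist s x y \<le> 1"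
proof -
  have X: "\<And>c. 0 \<le> x c" "sum x s = 1" and Y: "\<And>c. 0 \<le> y c" "sum y s = 1" using x y by (auto simp: cell_def)
  have "(\<Sum>c\<in>s. (x c - y c)\<^sup>2) \<le> (\<Sum>c\<in>s. x c + y c)"
  proof (rule sum_mono)
    fix c assume c: "c \<in> s"
    have "x c \<le> 1" "y c \<le> 1" using member_le_sum[OF c _ s, of x] member_le_sum[OF c _ s, of y] X Y by auto
    then have "(x c)\<^sup>2 \<le> x c" "(y c)\<^sup>2 \<le> y c" using X(1)[of c] Y(1)[of c]
      by (auto simp: power2_eq_square mult_left_le)
    moreover have "0 \<le> x c * y c" using X(1) Y(1) by simp
    ultimately show "(x c - y c)\<^sup>2 \<le> x c + y c" by (simp add: power2_diff)
  qed
  also have "\<dots> = 2" using X Y by (simp add: sum.distrib)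
  finally show ?thesis unfolding simplex_dist_def by simp
qed

lemma sorted_wrt_remdups: "sorted_wrt P xs \<Longrightarrow> sorted_wrt P (remdups xs)"
  by (induction xs) auto

context fs_complex
begin

text \<open>The collapses that occur in the coordinates of a point of outer space form a chain, and the
  first one, which collapses nothing, is the underlying free splitting.\<close>

lemma outer_inclusion_simplex:
  assumes X: "X \<in> outer_space G \<A>"
  obtains s where "s \<in> fs_simplices G \<A>" "outer_inclusion G \<A> X \<in> cell s" "cls (fst X) \<in> s"
proof -
  let ?S = "fst X"
  let ?N = "natural_lengths G X"
  note X' = outer_props[OF X]
  interpret S: splitting G ?S by (rule rel_splitting[OF X'(1)])
  define len where "len = snd X"
  have len: "invariant_lengths G ?S len" "normalized G ?S len" using X' by (auto simp: len_def)
  have lpos: "0 < len e" "\<And>g. g \<in> carrier G \<Longrightarrow> len (act ?S g ` e) = len e" if "e \<in> edges ?S" for e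
    using that len by (auto simp: invariant_lengths_def)
  let ?l = "natural_length len"
  have l_act: "?l (translate ?S g E) = ?l E" if g: "g \<in> carrier G" and E: "E \<in> natural_edges G ?S" for g E
  proof -
    have sub: "E \<subseteq> edges ?S" using S.natural_edge_sub[OF E] .
    have "inj_on ((`) (act ?S g)) E" using inj_on_subset[OF gset_inj_on[OF S.gset_edges g] sub] .
    then have "?l (translate ?S g E) = (\<Sum>e\<in>E. len (act ?S g ` e))"
      by (simp add: natural_length_def translate_def sum.reindex)
    also have "\<dots> = ?l E" unfolding natural_length_def by (rule sum.cong) (use lpos g sub in auto)
    finally show ?thesis .
  qed
  have l_nonneg: "0 \<le> ?l E" if "E \<in> natural_edges G ?S" for E
    unfolding natural_length_def
    by (rule sum_nonneg) (use S.natural_edge_sub[OF that] lpos in \<open>meson less_imp_le subsetD\<close>)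
  let ?O = "natural_edge_orbits G ?S"
  have finO: "finite ?O" by (rule S.finite_natural_orbits[OF len])
  have orb: "\<exists>E\<in>natural_edges G ?S. E \<in> \<O> \<and> E = (SOME E. E \<in> \<O>)" "\<forall>E\<in>\<O>. ?l E = ?l (SOME E. E \<in> \<O>)" if "\<O> \<in> ?O" for \<O>
  proof -
    have O: "(SOME E. E \<in> \<O>) \<in> natural_edges G ?S" "\<O> = orbit G (translate ?S) (SOME E. E \<in> \<O>)"
      using orbits_someE[OF S.gset_natural] that unfolding natural_edge_orbits_def by metis+
    show "\<exists>E\<in>natural_edges G ?S. E \<in> \<O> \<and> E = (SOME E. E \<in> \<O>)"
      using O gset_orbit_refl[OF S.gset_natural O(1)] by auto
    show "\<forall>E\<in>\<O>. ?l E = ?l (SOME E. E \<in> \<O>)"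
    proof
      fix E assume "E \<in> \<O>"
      then obtain g where "g \<in> carrier G" "E = translate ?S g (SOME E. E \<in> \<O>)" using O(2) unfolding orbit_def by blast
      then show "?l E = ?l (SOME E. E \<in> \<O>)" using l_act O(1) by metis
    qed
  qed
  have N: "?N = (\<lambda>\<O>. ?l (SOME E. E \<in> \<O>)) ` ?O"
  proof
    show "?N \<subseteq> (\<lambda>\<O>. ?l (SOME E. E \<in> \<O>)) ` ?O"
    proof
      fix t assume "t \<in> ?N"
      then obtain E where E: "E \<in> natural_edges G ?S" "t = ?l E" by (auto simp: natural_lengths_def len_def)
      let ?\<O> = "orbit G (translate ?S) E"
      have "?\<O> \<in> ?O" using E by (auto simp: natural_edge_orbits_def orbits_def)
      moreover from this have "t = ?l (SOME E. E \<in> ?\<O>)" using orb(2) gset_orbit_refl[OF S.gset_natural E(1)] E(2) by blast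
      ultimately show "t \<in> (\<lambda>\<O>. ?l (SOME E. E \<in> \<O>)) ` ?O" by blast
    qed
    show "(\<lambda>\<O>. ?l (SOME E. E \<in> \<O>)) ` ?O \<subseteq> ?N"
      using orb(1) by (auto simp: natural_lengths_def len_def)
  qed
  have finN: "finite ?N" unfolding N using finO by simp
  have Npos: "0 \<le> t" if "t \<in> ?N" for t using that l_nonneg by (auto simp: natural_lengths_def len_def)
  have Nne: "?N \<noteq> {}" using S.edges_nonempty S.natural_edge_of by (auto simp: natural_lengths_def)
  define F where "F t = shorter_edges G X t" for t
  have F_iff: "e \<in> F t \<longleftrightarrow> (\<exists>E\<in>natural_edges G ?S. e \<in> E \<and> ?l E < t)" for e t
    by (auto simp: F_def shorter_edges_def len_def)
  have F_inv: "act ?S g ` e \<in> F t" if g: "g \<in> carrier G" and e: "e \<in> F t" for g e t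
  proof -
    obtain E where E: "E \<in> natural_edges G ?S" "e \<in> E" "?l E < t" using e F_iff by blast
    then have "act ?S g ` e \<in> translate ?S g E" by (auto simp: translate_def)
    then show ?thesis using E g l_act gset_closed[OF S.gset_natural] unfolding F_iff by metis
  qed
  have F_proper: "F t \<subset> edges ?S" if t: "t \<in> ?N" for t
  proof -
    obtain E where E: "E \<in> natural_edges G ?S" "t = ?l E" using t by (auto simp: natural_lengths_def len_def)
    then obtain e where e: "e \<in> E" using S.natural_edge_nonempty by blast
    have "e \<notin> F t"
    proof
      assume "e \<in> F t"
      then obtain E' where "E' \<in> natural_edges G ?S" "e \<in> E'" "?l E' < t" using F_iff by blast
      then show False using S.natural_edge_class E e by (metis less_irrefl)
    qed
    moreover have "F t \<subseteq> edges ?S" using F_iff S.natural_edge_sub by blast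
    ultimately show ?thesis using e E S.natural_edge_sub by blast
  qed
  have F_mono: "F t \<subseteq> F t'" if "t \<le> t'" for t t' using that F_iff by fastforce
  have "\<exists>q :: 'a set \<times> nat \<Rightarrow> 'a set \<times> nat. \<forall>u\<in>verts ?S. \<forall>v\<in>verts ?S. q u = q v \<longleftrightarrow> (u, v) \<in> joined (F t)" if "t \<in> ?N" for t
    using S.quotient_map_exists[of "F t"] F_proper[OF that] F_inv by (metis psubset_imp_subset)
  then obtain q :: "real \<Rightarrow> 'a set \<times> nat \<Rightarrow> 'a set \<times> nat" where
    q: "\<And>t u v. t \<in> ?N \<Longrightarrow> u \<in> verts ?S \<Longrightarrow> v \<in> verts ?S \<Longrightarrow> q t u = q t v \<longleftrightarrow> (u, v) \<in> joined (F t)"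
    by metis
  define U where "U t = collapse_tree ?S (q t)" for t
  have U: "rel (U t)" "collapses_along G ?S (F t) (U t)" if "t \<in> ?N" for t
    unfolding U_def using collapse_exists[OF X'(1) F_proper[OF that] F_inv q[OF that]] by blast+
  define c where "c t = cls (U t)" for t
  have c_iff: "C \<in> fs_vertices G \<A> \<and> (\<exists>T\<in>C. collapses_along G ?S (F t) T) \<longleftrightarrow> C = c t" if t: "t \<in> ?N" for C t
  proof
    assume A: "C \<in> fs_vertices G \<A> \<and> (\<exists>T\<in>C. collapses_along G ?S (F t) T)"
    then obtain T where T: "T \<in> C" "collapses_along G ?S (F t) T" by blast
    then have "rel T" "C = cls T" using vertexE A by blast+
    moreover have "equivalent_splittings G T (U t)"
      using T(2) U(2)[OF t] collapse_unique[OF is_group rel_fs[OF X'(1)]] unfolding collapses_along_def by blast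
    ultimately show "C = c t" unfolding c_def using cls_eq U(1)[OF t] by blast
  next
    assume "C = c t"
    then show "C \<in> fs_vertices G \<A> \<and> (\<exists>T\<in>C. collapses_along G ?S (F t) T)"
      unfolding c_def using U[OF t] cls_self cls_vertex by blast
  qed
  define coef where "coef t = (t - Max (insert 0 {s \<in> ?N. s < t})) * real (card {\<O> \<in> ?O. \<forall>E\<in>\<O>. t \<le> ?l E})" for t
  have incl: "outer_inclusion G \<A> X C = (\<Sum>t\<in>?N. if C = c t then coef t else 0)" for C
    unfolding outer_inclusion_def coef_def
    by (rule sum.cong) (use c_iff in \<open>auto simp: F_def len_def\<close>)
  have coef_nonneg: "0 \<le> coef t" if "t \<in> ?N" for t
  proof -
    have "Max (insert 0 {s \<in> ?N. s < t}) \<le> t" using finN Npos[OF that] by (subst Max_le_iff) auto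
    then show ?thesis unfolding coef_def by simp
  qed
  have coef_sum: "sum coef ?N = 1"
  proof -
    let ?g = "\<lambda>t. t - Max (insert 0 {s \<in> ?N. s < t})"
    have "coef t = (\<Sum>\<O>\<in>?O. if t \<le> ?l (SOME E. E \<in> \<O>) then ?g t else 0)" for t
    proof -
      have "{\<O> \<in> ?O. \<forall>E\<in>\<O>. t \<le> ?l E} = {\<O> \<in> ?O. t \<le> ?l (SOME E. E \<in> \<O>)}"
        using orb by (intro Collect_cong) metis
      then show ?thesis unfolding coef_def using finO by (simp add: sum.If_cases Int_def mult.commute)
    qed
    then have "sum coef ?N = (\<Sum>t\<in>?N. \<Sum>\<O>\<in>?O. if t \<le> ?l (SOME E. E \<in> \<O>) then ?g t else 0)" by simp
    also have "\<dots> = (\<Sum>\<O>\<in>?O. \<Sum>t\<in>?N. if t \<le> ?l (SOME E. E \<in> \<O>) then ?g t else 0)" by (rule sum.swap)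
    also have "\<dots> = (\<Sum>\<O>\<in>?O. ?l (SOME E. E \<in> \<O>))"
    proof (rule sum.cong)
      fix \<O> assume "\<O> \<in> ?O"
      then have "?l (SOME E. E \<in> \<O>) \<in> ?N" unfolding N by blast
      then have "(\<Sum>t\<in>{t \<in> ?N. t \<le> ?l (SOME E. E \<in> \<O>)}. ?g t) = ?l (SOME E. E \<in> \<O>)"
        by (rule sum_gaps[OF finN, rotated]) (rule Npos)
      then show "(\<Sum>t\<in>?N. if t \<le> ?l (SOME E. E \<in> \<O>) then ?g t else 0) = ?l (SOME E. E \<in> \<O>)"
        using finN by (simp add: sum.If_cases Int_def)
    qed simp
    also have "\<dots> = 1" using len(2) unfolding normalized_def .
    finally show ?thesis .
  qed
  have cell: "outer_inclusion G \<A> X \<in> cell (c ` ?N)"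
    unfolding cell_def mem_Collect_eq
  proof (intro conjI allI impI)
    show "0 \<le> outer_inclusion G \<A> X C" for C
      unfolding incl using coef_nonneg by (intro sum_nonneg) auto
    show "outer_inclusion G \<A> X C = 0" if "C \<notin> c ` ?N" for C
      unfolding incl by (rule sum.neutral) (use that in auto)
    have "(\<Sum>C\<in>c ` ?N. outer_inclusion G \<A> X C) = (\<Sum>t\<in>?N. \<Sum>C\<in>c ` ?N. if C = c t then coef t else 0)"
      unfolding incl by (rule sum.swap)
    also have "\<dots> = sum coef ?N"
      by (rule sum.cong) (use finN in auto)
    finally show "(\<Sum>C\<in>c ` ?N. outer_inclusion G \<A> X C) = 1" using coef_sum by simp
  qed
  have chain: "class_collapses G (c t) (c t')" if tt: "t \<in> ?N" "t' \<in> ?N" "t \<le> t'" for t t'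
  proof -
    have sub: "F t \<subseteq> edges ?S" "F t' \<subseteq> edges ?S" using F_proper tt by blast+
    obtain r where r: "simplicial_collapse G (U t) (U t') r"
      using S.collapse_factor[OF sub(1) F_inv q[OF tt(1)] sub(2) F_inv q[OF tt(2)] F_mono[OF tt(3)]]
      unfolding U_def by blast
    interpret r: collapse G "U t" "U t'" r
      using r rel_splitting[OF U(1)[OF tt(1)]] rel_splitting[OF U(1)[OF tt(2)]]
      by (simp add: collapse_def collapse_axioms_def)
    have "collapses G (U t) (U t')"
      unfolding collapses_def collapses_along_def using r.collapse_map_realize by blast
    then show ?thesis unfolding class_collapses_def c_def using cls_self U(1) tt by blast
  qed
  have simplex: "c ` ?N \<in> fs_simplices G \<A>"
  proof -
    define ts where "ts = sorted_list_of_set ?N"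
    have ts: "set ts = ?N" "sorted ts" unfolding ts_def using finN by auto
    have "sorted_wrt (\<lambda>t t'. class_collapses G (c t) (c t')) ts"
      using ts(2) by (rule sorted_wrt_mono_rel[rotated]) (use chain ts(1) in auto)
    then have "sorted_wrt (class_collapses G) (map c ts)" by (simp add: sorted_wrt_map)
    then have "successively (class_collapses G) (remdups (map c ts))"
      by (intro successively_if_sorted_wrt sorted_wrt_remdups)
    moreover have "set (remdups (map c ts)) = c ` ?N" using ts by simp
    moreover have "c ` ?N \<subseteq> fs_vertices G \<A>" unfolding c_def using U(1) cls_vertex by blast
    moreover have "remdups (map c ts) \<noteq> []" using ts Nne by auto
    ultimately show ?thesis unfolding fs_simplices_def
      by (intro CollectI exI[of _ "remdups (map c ts)"]) simp
  qed
  have "cls ?S \<in> c ` ?N"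
  proof -
    define t where "t = Min ?N"
    have t: "t \<in> ?N" unfolding t_def using finN Nne by simp
    have "F t = {}"
    proof -
      have "t \<le> ?l E" if "E \<in> natural_edges G ?S" for E
        unfolding t_def using finN that by (intro Min_le) (auto simp: natural_lengths_def len_def)
      then show ?thesis using F_iff by fastforce
    qed
    moreover have "quotient_map (tree_topology ?S) (tree_topology ?S) id"
      using homeomorphic_map_id[of "tree_topology ?S" "tree_topology ?S"] unfolding homeomorphic_map_def by simp
    then have "collapse_map_along G ?S ?S {} id"
      using S.edges_nonempty
      by (auto simp: collapse_map_along_def equivariant_map_def same_component_def translate_def)
    ultimately have "equivalent_splittings G ?S (U t)"
      using U(2)[OF t] collapse_unique[OF is_group rel_fs[OF X'(1)]] unfolding collapses_along_def by metis
    then have "cls ?S = c t" unfolding c_def using cls_eq X'(1) U(1)[OF t] by blast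
    then show ?thesis using t by blast
  qed
  then show thesis using that[OF simplex cell] by blast
qed

lemma simplex_finite: "s \<in> fs_simplices G \<A> \<Longrightarrow> finite s"
  unfolding fs_simplices_def by auto

text \<open>Walk inside a simplex to the vertex of the underlying splitting, along an edge path, and back into a
  simplex; each step has length at most \<open>1\<close>.\<close>

lemma fs_point_dist_le:
  assumes X: "X \<in> outer_space G \<A>" and Y: "Y \<in> outer_space G \<A>"
    and d: "d_FS G \<A> (fst X) (fst Y) = enat m"
  shows "fs_point_dist G \<A> (outer_inclusion G \<A> X) (outer_inclusion G \<A> Y) \<le> ereal (real m + 2)"
proof -
  obtain s where s: "s \<in> fs_simplices G \<A>" "outer_inclusion G \<A> X \<in> cell s" "cls (fst X) \<in> s"
    using outer_inclusion_simplex[OF X] by blast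
  obtain s' where s': "s' \<in> fs_simplices G \<A>" "outer_inclusion G \<A> Y \<in> cell s'" "cls (fst Y) \<in> s'"
    using outer_inclusion_simplex[OF Y] by blast
  obtain w where w: "edge_walk m w (cls (fst X)) (cls (fst Y))"
    using d fs_vertex_dist_attained unfolding d_FS_def by blast
  define p where "p i = (if i = 0 then outer_inclusion G \<A> X else if i \<le> Suc m then vertex_point (w (i - 1))
    else outer_inclusion G \<A> Y)" for i
  define \<sigma> where "\<sigma> i = (if i = 0 then s else if i \<le> m then {w (i - 1), w i} else s')" for i
  have w': "w 0 = cls (fst X)" "w m = cls (fst Y)" "\<And>i. i < m \<Longrightarrow> {w i, w (Suc i)} \<in> fs_simplices G \<A>"
    using w by (auto simp: edge_walk_def)
  have step: "\<sigma> i \<in> fs_simplices G \<A> \<and> p i \<in> cell (\<sigma> i) \<and> p (Suc i) \<in> cell (\<sigma> i)" if "i < m + 2" for i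
  proof -
    consider "i = 0" | "0 < i" "i \<le> m" | "i = Suc m" using \<open>i < m + 2\<close> by linarith
    then show ?thesis
    proof cases
      case 1
      then show ?thesis using s w'(1) vertex_point_in_cell_iff[OF simplex_finite[OF s(1)]] by (simp add: p_def \<sigma>_def)
    next
      case 2
      then obtain j where j: "i = Suc j" by (cases i) auto
      then show ?thesis using 2 w'(3)[of j] vertex_point_in_cell_iff[of "{w j, w (Suc j)}"]
        by (simp add: p_def \<sigma>_def)
    next
      case 3
      then show ?thesis using s' w'(2) vertex_point_in_cell_iff[OF simplex_finite[OF s'(1)]] by (simp add: p_def \<sigma>_def)
    qed
  qed
  have "fs_point_dist G \<A> (outer_inclusion G \<A> X) (outer_inclusion G \<A> Y)
    \<le> ereal (\<Sum>i<m + 2. simplex_dist (\<sigma> i) (p i) (p (Suc i)))"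
    unfolding fs_point_dist_def
  proof (rule Inf_lower, intro CollectI exI conjI)
    show "p 0 = outer_inclusion G \<A> X" "p (m + 2) = outer_inclusion G \<A> Y" by (simp_all add: p_def)
    show "\<forall>i<m + 2. \<sigma> i \<in> fs_simplices G \<A> \<and> p i \<in> cell (\<sigma> i) \<and> p (Suc i) \<in> cell (\<sigma> i)" using step by blast
  qed (rule refl)
  also have "\<dots> \<le> ereal (\<Sum>i<m + 2. 1)"
  proof -
    have "simplex_dist (\<sigma> i) (p i) (p (Suc i)) \<le> 1" if "i < m + 2" for i
      by (rule simplex_dist_le_1) (use step[OF that] simplex_finite in blast)+
    then show ?thesis unfolding ereal_less_eq by (intro sum_mono) simp
  qed
  finally show ?thesis by (simp add: add.commute)
qed

end

theorem mainTheorem2: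
  fixes G :: "('a, 'm) monoid_scheme" and \<A> :: "'a set set set" and \<Delta> :: nat
  assumes "group G"
    and "carrier G \<noteq> {\<one>\<^bsub>G\<^esub>}"
    and "\<not> G \<cong> integer_group"
    and "\<not> G \<cong> infinite_dihedral_group"
    and "free_factor_system G \<A>"
    and "\<not> full_ffs G \<A>"
    and "0 < \<Delta>"
    and "two_over_all G \<A> \<Delta>"
  shows "coarsely_lipschitz_on (outer_space G \<A>) (d_outer G) (fs_point_dist G \<A>)
           (outer_inclusion G \<A>) \<and>
         (\<forall>X\<in>outer_space G \<A>. \<forall>Y\<in>outer_space G \<A>.
            ereal_of_enat (d_FS G \<A> (fst X) (fst Y)) \<le>
              ereal (real \<Delta> / ln 2 * d_outer G X Y + 2 * real \<Delta> + 1))"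
proof
  interpret fs_complex G \<A> using assms(1) by (simp add: fs_complex_def)
  show "coarsely_lipschitz_on (outer_space G \<A>) (d_outer G) (fs_point_dist G \<A>) (outer_inclusion G \<A>)"
    unfolding coarsely_lipschitz_on_def
  proof (intro exI conjI ballI)
    fix X Y assume XY: "X \<in> outer_space G \<A>" "Y \<in> outer_space G \<A>"
    obtain m where m: "d_FS G \<A> (fst X) (fst Y) = enat m"
      "real m \<le> real \<Delta> / ln 2 * d_outer G X Y + 2 * real \<Delta> + 1"
      using d_FS_le[OF assms(8,7) XY] by blast
    have "fs_point_dist G \<A> (outer_inclusion G \<A> X) (outer_inclusion G \<A> Y) \<le> ereal (real m + 2)"
      by (rule fs_point_dist_le[OF XY m(1)])
    also have "\<dots> \<le> ereal (real \<Delta> / ln 2 * d_outer G X Y + (2 * real \<Delta> + 3))" using m(2) by simp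
    finally show "fs_point_dist G \<A> (outer_inclusion G \<A> X) (outer_inclusion G \<A> Y)
      \<le> ereal (real \<Delta> / ln 2 * d_outer G X Y + (2 * real \<Delta> + 3))" .
  qed simp_all
  show "\<forall>X\<in>outer_space G \<A>. \<forall>Y\<in>outer_space G \<A>.
            ereal_of_enat (d_FS G \<A> (fst X) (fst Y)) \<le>
              ereal (real \<Delta> / ln 2 * d_outer G X Y + 2 * real \<Delta> + 1)"
  proof (intro ballI)
    fix X Y assume XY: "X \<in> outer_space G \<A>" "Y \<in> outer_space G \<A>"
    obtain m where "d_FS G \<A> (fst X) (fst Y) = enat m"
      "real m \<le> real \<Delta> / ln 2 * d_outer G X Y + 2 * real \<Delta> + 1"
      using d_FS_le[OF assms(8,7) XY] by blast
    then show "ereal_of_enat (d_FS G \<A> (fst X) (fst Y)) \<le>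
      ereal (real \<Delta> / ln 2 * d_outer G X Y + 2 * real \<Delta> + 1)" by simp
  qed
qed

end
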